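(* Let $k$ be a field and let $R$ be a $k$-algebra which is oriented by three idempotents $e, e'_1, e'_2$. Put $e_i=e'_i+e$ and $A_i=e_iRe_i$ for $i=1,2$, and $C=eRe$. There exists a long exact sequence of cyclic homology groups $$\cdots\to{\rm HC}_1(C)\to {\rm HC}_1(A_1)\oplus{\rm HC}_1(A_2)\to{\rm HC}_1(R)\to{\rm HC}_0(C)\to{\rm HC}_0(A_1)\oplus{\rm HC}_0(A_2)\to{\rm HC}_0(R)\to0 .$$
   Context: Algebras are associative unital algebras over a field $k$; $\otimes=\otimes_k$. An algebra $R$ is \emph{oriented} by $e,e'_1,e'_2$ if $e,e'_1,e'_2$ are orthogonal idempotents of $R$ with $1_R=e'_1+e+e'_2$, such that $e'_1Re'_2=e'_2Re'_1=0$ and at least one of the following holds: (1) $eRe'_1=eRe'_2=0$; (2) $e'_1Re=e'_2Re=0$; (3) $e'_1Re=eRe'_2=0$. The algebras $C$, $A_1$, $A_2$ have units $e$, $e_1$, $e_2$. Cyclic homology of an algebra $\Lambda$: on $\Lambda^{\otimes n+1}$ let $b'(r_0\otimes\cdots\otimes r_n)=\sum_{i=0}^{n-1}(-1)^ir_0\otimes\cdots\otimes r_ir_{i+1}\otimes\cdots\otimes r_n$, $b(r_0\otimes\cdots\otimes r_n)=b'(r_0\otimes\cdots\otimes r_n)+(-1)^nr_nr_0\otimes r_1\otimes\cdots\otimes r_{n-1}$, $t(r_0\otimes\cdots\otimes r_n)=(-1)^nr_n\otimes r_0\otimes\cdots\otimes r_{n-1}$, $N=1+t+\cdots+t^n$.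 The cyclic bicomplex $CC(\Lambda)$ is the first quadrant bicomplex with $CC(\Lambda)_{p,q}=\Lambda^{\otimes q+1}$, vertical differential $b$ in even columns and $-b'$ in odd columns, and horizontal differential $1-t$ from odd to even columns and $N$ from even to odd columns. Then ${\rm HC}_n(\Lambda)={\rm H}_n({\rm Tot}\,CC(\Lambda))$, where ${\rm Tot}$ is the total complex. *)

theory Defs
  imports Complex_Main "HOL-Algebra.AbelCoset" "HOL-Algebra.Module" "HOL-Library.Poly_Mapping"
begin

section \<open>Algebras, corners and orientations\<close>

text \<open>The unit is an explicit parameter on a type of class \<^class>\<open>ring\<close> (which does not require
  a unit), so that the zero algebra is included.\<close>

locale unital_algebra = vector_space scale
  for scale :: "'k::field \<Rightarrow> 'a::ring \<Rightarrow> 'a" +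
  fixes unit :: 'a
  assumes unit_left: "unit * x = x"
    and unit_right: "x * unit = x"
    and scale_mult_left: "scale c x * y = scale c (x * y)"
    and scale_mult_right: "x * scale c y = scale c (x * y)"

definition corner :: "'a::ring \<Rightarrow> 'a set" where
  "corner e = {e * x * e | x. True}"

definition oriented_by :: "'a::ring \<Rightarrow> 'a \<Rightarrow> 'a \<Rightarrow> 'a \<Rightarrow> bool" where
  "oriented_by unit e e1' e2' \<longleftrightarrow>
     e * e = e \<and> e1' * e1' = e1' \<and> e2' * e2' = e2' \<and>
     e * e1' = 0 \<and> e1' * e = 0 \<and> e * e2' = 0 \<and> e2' * e = 0 \<and> e1' * e2' = 0 \<and> e2' * e1' = 0 \<and>
     unit = e1' + e + e2' \<and>
     (\<forall>x. e1' * x * e2' = 0) \<and> (\<forall>x. e2' * x * e1' = 0) \<and>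
     ((\<forall>x. e * x * e1' = 0) \<and> (\<forall>x. e * x * e2' = 0) \<or>
      (\<forall>x. e1' * x * e = 0) \<and> (\<forall>x. e2' * x * e = 0) \<or>
      (\<forall>x. e1' * x * e = 0) \<and> (\<forall>x. e * x * e2' = 0))"

section \<open>Vector spaces with explicit carrier\<close>

text \<open>Vector spaces over \<^typ>\<open>'k\<close> are presented as HOL-Algebra module records.
  The ring multiplication and ring unit slots of these records carry no meaning and are left
  \<^const>\<open>undefined\<close>.\<close>

definition quotient_space :: "('k, 'v) module \<Rightarrow> 'v set \<Rightarrow> ('k, 'v set) module" where
  "quotient_space V W =
     \<lparr>carrier = a_rcosets\<^bsub>V\<^esub> W, mult = undefined, one = undefined,
      zero = W, add = set_add V, smult = (\<lambda>c X. \<Union>x\<in>X. W +>\<^bsub>V\<^esub> (c \<odot>\<^bsub>V\<^esub> x))\<rparr>"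

text \<open>The map \<open>U/W' \<rightarrow> V/W\<close> induced by \<open>\<phi> : U \<rightarrow> V\<close>, provided that \<open>\<phi>\<close> takes \<open>W'\<close> into \<open>W\<close>: all
  cosets in the union are then equal.\<close>

definition induced_map :: "('k, 'v) module \<Rightarrow> 'v set \<Rightarrow> ('u \<Rightarrow> 'v) \<Rightarrow> 'u set \<Rightarrow> 'v set" where
  "induced_map V W \<phi> X = (\<Union>x\<in>X. W +>\<^bsub>V\<^esub> \<phi> x)"

definition direct_sum :: "('k, 'u) module \<Rightarrow> ('k, 'v) module \<Rightarrow> ('k, 'u \<times> 'v) module" where
  "direct_sum U V =
     \<lparr>carrier = carrier U \<times> carrier V, mult = undefined, one = undefined,
      zero = (\<zero>\<^bsub>U\<^esub>, \<zero>\<^bsub>V\<^esub>),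
      add = (\<lambda>x y. (fst x \<oplus>\<^bsub>U\<^esub> fst y, snd x \<oplus>\<^bsub>V\<^esub> snd y)),
      smult = (\<lambda>c x. (c \<odot>\<^bsub>U\<^esub> fst x, c \<odot>\<^bsub>V\<^esub> snd x))\<rparr>"

text \<open>Product of a family of spaces; it is only used for finite \<open>I\<close>, where it is the direct sum.\<close>

definition product_space :: "'i set \<Rightarrow> ('i \<Rightarrow> ('k, 'v) module) \<Rightarrow> ('k, 'i \<Rightarrow> 'v) module" where
  "product_space I V =
     \<lparr>carrier = (\<Pi>\<^sub>E i\<in>I. carrier (V i)), mult = undefined, one = undefined,
      zero = (\<lambda>i\<in>I. \<zero>\<^bsub>V i\<^esub>),
      add = (\<lambda>f g. \<lambda>i\<in>I. f i \<oplus>\<^bsub>V i\<^esub> g i),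
      smult = (\<lambda>c f. \<lambda>i\<in>I. c \<odot>\<^bsub>V i\<^esub> f i)\<rparr>"

definition linear_maps :: "('k, 'u) module \<Rightarrow> ('k, 'v) module \<Rightarrow> ('u \<Rightarrow> 'v) set" where
  "linear_maps U V =
     {f \<in> carrier U \<rightarrow> carrier V.
        (\<forall>x\<in>carrier U. \<forall>y\<in>carrier U. f (x \<oplus>\<^bsub>U\<^esub> y) = f x \<oplus>\<^bsub>V\<^esub> f y) \<and>
        (\<forall>c. \<forall>x\<in>carrier U. f (c \<odot>\<^bsub>U\<^esub> x) = c \<odot>\<^bsub>V\<^esub> f x)}"

text \<open>Exactness of \<open>U \<rightarrow> V \<rightarrow> W\<close> at \<open>V\<close>.\<close>

definition exact_at ::
  "('k, 'u) module \<Rightarrow> ('k, 'v) module \<Rightarrow> ('k, 'w) module \<Rightarrow> ('u \<Rightarrow> 'v) \<Rightarrow> ('v \<Rightarrow> 'w) \<Rightarrow> bool" where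
  "exact_at U V W f g \<longleftrightarrow> f ` carrier U = a_kernel V W g"

section \<open>Tensor powers\<close>

text \<open>For a \<open>'k\<close>-subspace \<open>A\<close> of \<open>'a\<close>, the \<open>m\<close>-th tensor power is the free vector space on the words
  of length \<open>m\<close> in \<open>A\<close>, modulo the multilinearity relations. The word \<open>[r\<^sub>0, \<dots>, r\<^sub>n]\<close> stands for
  \<open>r\<^sub>0 \<otimes> \<dots> \<otimes> r\<^sub>n\<close>.\<close>

definition free_scale :: "'k::field \<Rightarrow> ('w \<Rightarrow>\<^sub>0 'k) \<Rightarrow> ('w \<Rightarrow>\<^sub>0 'k)" where
  "free_scale c = Poly_Mapping.map ((*) c)"

definition free_space :: "'w set \<Rightarrow> ('k::field, 'w \<Rightarrow>\<^sub>0 'k) module" where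
  "free_space S =
     \<lparr>carrier = {x. Poly_Mapping.keys x \<subseteq> S}, mult = undefined, one = undefined,
      zero = 0, add = (+), smult = free_scale\<rparr>"

definition linear_extension :: "('w \<Rightarrow> ('v \<Rightarrow>\<^sub>0 'k::field)) \<Rightarrow> ('w \<Rightarrow>\<^sub>0 'k) \<Rightarrow> ('v \<Rightarrow>\<^sub>0 'k)" where
  "linear_extension \<phi> x =
     (\<Sum>w\<in>Poly_Mapping.keys x. free_scale (Poly_Mapping.lookup x w) (\<phi> w))"

definition words :: "'a set \<Rightarrow> nat \<Rightarrow> 'a list set" where
  "words A m = {rs. length rs = m \<and> set rs \<subseteq> A}"

definition tensor_relations ::
  "('k::field \<Rightarrow> 'a::ring \<Rightarrow> 'a) \<Rightarrow> 'a set \<Rightarrow> nat \<Rightarrow> ('a list \<Rightarrow>\<^sub>0 'k) set" where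
  "tensor_relations scale A m = Modules.module.span free_scale
     ({Poly_Mapping.single (xs @ (x + y) # ys) 1 - Poly_Mapping.single (xs @ x # ys) 1
         - Poly_Mapping.single (xs @ y # ys) 1 | xs x y ys.
         x \<in> A \<and> y \<in> A \<and> set xs \<subseteq> A \<and> set ys \<subseteq> A \<and> length xs + 1 + length ys = m} \<union>
      {Poly_Mapping.single (xs @ scale c x # ys) 1 - Poly_Mapping.single (xs @ x # ys) c | xs c x ys.
         x \<in> A \<and> set xs \<subseteq> A \<and> set ys \<subseteq> A \<and> length xs + 1 + length ys = m})"

definition tensor_power ::
  "('k::field \<Rightarrow> 'a::ring \<Rightarrow> 'a) \<Rightarrow> 'a set \<Rightarrow> nat \<Rightarrow> ('k, ('a list \<Rightarrow>\<^sub>0 'k) set) module" where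
  "tensor_power scale A m =
     quotient_space (free_space (words A m)) (tensor_relations scale A m)"

text \<open>The linear map into the \<open>m\<close>-th tensor power given by a map on words.\<close>

definition tensor_map ::
  "('k::field \<Rightarrow> 'a::ring \<Rightarrow> 'a) \<Rightarrow> 'a set \<Rightarrow> nat \<Rightarrow> ('a list \<Rightarrow> ('a list \<Rightarrow>\<^sub>0 'k))
     \<Rightarrow> ('a list \<Rightarrow>\<^sub>0 'k) set \<Rightarrow> ('a list \<Rightarrow>\<^sub>0 'k) set" where
  "tensor_map scale A m \<phi> =
     induced_map (free_space (words A m)) (tensor_relations scale A m) (linear_extension \<phi>)"

section \<open>Cyclic homology\<close>

text \<open>The operators \<open>b'\<close>, \<open>b\<close>, \<open>t\<close> and \<open>N\<close> on a word of length \<open>n + 1\<close>; the operator \<open>b\<close> is only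
  meant for \<open>n \<ge> 1\<close>.\<close>

definition op_b' :: "'a::ring list \<Rightarrow> ('a list \<Rightarrow>\<^sub>0 'k::field)" where
  "op_b' rs = (\<Sum>i<length rs - 1.
     Poly_Mapping.single (take i rs @ (rs ! i * rs ! (i + 1)) # drop (i + 2) rs) ((-1) ^ i))"

definition op_b :: "'a::ring list \<Rightarrow> ('a list \<Rightarrow>\<^sub>0 'k::field)" where
  "op_b rs = op_b' rs +
     Poly_Mapping.single ((last rs * hd rs) # butlast (tl rs)) ((-1) ^ (length rs - 1))"

definition op_t :: "'a list \<Rightarrow> ('a list \<Rightarrow>\<^sub>0 'k::field)" where
  "op_t rs = Poly_Mapping.single (last rs # butlast rs) ((-1) ^ (length rs - 1))"

definition op_N :: "'a list \<Rightarrow> ('a list \<Rightarrow>\<^sub>0 'k::field)" where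
  "op_N rs = (\<Sum>i<length rs. (linear_extension op_t ^^ i) (Poly_Mapping.single rs 1))"

text \<open>The cyclic bicomplex of the algebra \<open>A\<close>. As its definition does not refer to units, it applies
  to any subspace \<open>A\<close> of \<open>'a\<close> closed under multiplication, such as the corners, whose units are
  idempotents of \<open>'a\<close>.\<close>

definition CC ::
  "('k::field \<Rightarrow> 'a::ring \<Rightarrow> 'a) \<Rightarrow> 'a set \<Rightarrow> nat \<Rightarrow> nat \<Rightarrow> ('k, ('a list \<Rightarrow>\<^sub>0 'k) set) module" where
  "CC scale A p q = tensor_power scale A (q + 1)"

text \<open>Both differentials are indexed by their target: \<open>CC_vert p q\<close> goes from \<open>(p, q + 1)\<close> to
  \<open>(p, q)\<close>, and \<open>CC_horiz p q\<close> from \<open>(p + 1, q)\<close> to \<open>(p, q)\<close>.\<close>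

definition CC_vert ::
  "('k::field \<Rightarrow> 'a::ring \<Rightarrow> 'a) \<Rightarrow> 'a set \<Rightarrow> nat \<Rightarrow> nat
     \<Rightarrow> ('a list \<Rightarrow>\<^sub>0 'k) set \<Rightarrow> ('a list \<Rightarrow>\<^sub>0 'k) set" where
  "CC_vert scale A p q =
     tensor_map scale A (q + 1) (if even p then op_b else (\<lambda>rs. - op_b' rs))"

definition CC_horiz ::
  "('k::field \<Rightarrow> 'a::ring \<Rightarrow> 'a) \<Rightarrow> 'a set \<Rightarrow> nat \<Rightarrow> nat
     \<Rightarrow> ('a list \<Rightarrow>\<^sub>0 'k) set \<Rightarrow> ('a list \<Rightarrow>\<^sub>0 'k) set" where
  "CC_horiz scale A p q =
     tensor_map scale A (q + 1)
       (if even p then (\<lambda>rs. Poly_Mapping.single rs 1 - op_t rs) else op_N)"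

text \<open>An element of degree \<open>n\<close> of the total complex is the family of its components in the positions
  \<open>(p, n - p)\<close>, \<open>p \<le> n\<close>.\<close>

definition Tot ::
  "('k::field \<Rightarrow> 'a::ring \<Rightarrow> 'a) \<Rightarrow> 'a set \<Rightarrow> nat
     \<Rightarrow> ('k, nat \<Rightarrow> ('a list \<Rightarrow>\<^sub>0 'k) set) module" where
  "Tot scale A n = product_space {..n} (\<lambda>p. CC scale A p (n - p))"

text \<open>The differential from degree \<open>n + 1\<close> to degree \<open>n\<close>.\<close>

definition Tot_diff ::
  "('k::field \<Rightarrow> 'a::ring \<Rightarrow> 'a) \<Rightarrow> 'a set \<Rightarrow> nat
     \<Rightarrow> (nat \<Rightarrow> ('a list \<Rightarrow>\<^sub>0 'k) set) \<Rightarrow> (nat \<Rightarrow> ('a list \<Rightarrow>\<^sub>0 'k) set)" where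
  "Tot_diff scale A n f =
     (\<lambda>p\<in>{..n}. CC_vert scale A p (n - p) (f p)
        \<oplus>\<^bsub>CC scale A p (n - p)\<^esub> CC_horiz scale A p (n - p) (f (p + 1)))"

definition Tot_cycles ::
  "('k::field \<Rightarrow> 'a::ring \<Rightarrow> 'a) \<Rightarrow> 'a set \<Rightarrow> nat \<Rightarrow> (nat \<Rightarrow> ('a list \<Rightarrow>\<^sub>0 'k) set) set" where
  "Tot_cycles scale A n = (case n of
       0 \<Rightarrow> carrier (Tot scale A 0)
     | Suc m \<Rightarrow> a_kernel (Tot scale A (Suc m)) (Tot scale A m) (Tot_diff scale A m))"

definition Tot_boundaries ::
  "('k::field \<Rightarrow> 'a::ring \<Rightarrow> 'a) \<Rightarrow> 'a set \<Rightarrow> nat \<Rightarrow> (nat \<Rightarrow> ('a list \<Rightarrow>\<^sub>0 'k) set) set" where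
  "Tot_boundaries scale A n = Tot_diff scale A n ` carrier (Tot scale A (Suc n))"

definition HC ::
  "('k::field \<Rightarrow> 'a::ring \<Rightarrow> 'a) \<Rightarrow> 'a set \<Rightarrow> nat
     \<Rightarrow> ('k, (nat \<Rightarrow> ('a list \<Rightarrow>\<^sub>0 'k) set) set) module" where
  "HC scale A n =
     quotient_space (Tot scale A n\<lparr>carrier := Tot_cycles scale A n\<rparr>) (Tot_boundaries scale A n)"

end

theory Submission
  imports Defs "HOL-Library.Function_Algebras" "HOL-Library.Product_Plus"
begin

text \<open>In each orientation, one of \<open>e R e'\<^sub>i\<close> and \<open>e'\<^sub>i R e\<close> vanishes for \<open>i = 1, 2\<close>, and
  therefore the compressions \<open>x \<mapsto> e\<^sub>1 x e\<^sub>1\<close>, \<open>x \<mapsto> e\<^sub>2 x e\<^sub>2\<close> and \<open>x \<mapsto> e x e\<close> are algebra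
  homomorphisms from \<open>R\<close> onto the corners. The induced retractions make
  \<open>HC(C) \<rightarrow> HC(A\<^sub>1) \<oplus> HC(A\<^sub>2)\<close> injective and give exactness in the middle, so the connecting maps
  can be taken to be zero, and only the surjectivity of \<open>HC(A\<^sub>1) \<oplus> HC(A\<^sub>2) \<rightarrow> HC(R)\<close> needs an
  argument. The part of the bicomplex spanned by words lying in neither corner has contractible
  columns: the odd ones by prefixing the unit, and the even ones because each such word, decomposed
  by the idempotents, has two cyclically consecutive letters whose idempotents do not match.\<close>

text \<open>Multiplicativity of the compression to \<open>A_1\<close> could only be spoiled by a
  product passing through e'_2. Since e'_1 R e'_2 = e'_2 R e'_1 = 0, such a product starts and ends
  at e, and then one of its two halves vanishes. The compressions c1, c2 commute with composite c0,
  so 1 - c1 - c2 + c0 = (1 - c1)(1 - c2) is a projection commuting with all differentials, and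
  surjectivity amounts to bounding its image. The first-quadrant shape lets the contractions of the
  columns be assembled column by column. The obstacle is the even columns: the Hochschild complex is
  in general not contractible, as the prefix homotopy fails at the cyclic face. The orientation
  helps by ordering the idempotents: nonzero off-diagonal Peirce components go strictly up, so
  labels that match all the way round a circle are constant, and a word with constant label lies in
  a corner. A second difficulty is that decomposing a word by the idempotents is valid only modulo
  multilinearity. The operators are therefore built on free spaces and compared modulo one common
  subspace of relations.\<close>

section \<open>Quotients presented by representatives\<close>

text \<open>The record \<open>V\<close> is the quotient \<open>X/B\<close> with class map \<open>cl\<close>. Presentations are compatible with
  products and with further quotients, so that a cyclic homology class is handled through a
  family of elements of free spaces.\<close>

definition presented ::
  "('k, 'v) module \<Rightarrow> 'x::ab_group_add set \<Rightarrow> 'x set \<Rightarrow> ('k \<Rightarrow> 'x \<Rightarrow> 'x) \<Rightarrow> ('x \<Rightarrow> 'v) \<Rightarrow> bool" where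
  "presented V X B sc cl \<longleftrightarrow>
     carrier V = cl ` X \<and> \<zero>\<^bsub>V\<^esub> = cl 0 \<and>
     (\<forall>x\<in>X. \<forall>y\<in>X. cl x \<oplus>\<^bsub>V\<^esub> cl y = cl (x + y)) \<and>
     (\<forall>c. \<forall>x\<in>X. c \<odot>\<^bsub>V\<^esub> cl x = cl (sc c x)) \<and>
     (\<forall>x\<in>X. \<forall>y\<in>X. cl x = cl y \<longleftrightarrow> x - y \<in> B)"

text \<open>Only closure is demanded and no law for \<open>sc\<close>, so that the same notion
  serves chains, families of chains and pairs of families.\<close>

definition scaled_group :: "('k \<Rightarrow> 'x::ab_group_add \<Rightarrow> 'x) \<Rightarrow> 'x set \<Rightarrow> bool" where
  "scaled_group sc X \<longleftrightarrow>
     0 \<in> X \<and> (\<forall>x\<in>X. \<forall>y\<in>X. x + y \<in> X) \<and> (\<forall>x\<in>X. - x \<in> X) \<and> (\<forall>c. \<forall>x\<in>X. sc c x \<in> X)"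

lemma scaled_groupD:
  assumes "scaled_group sc X"
  shows "0 \<in> X" "x \<in> X \<Longrightarrow> y \<in> X \<Longrightarrow> x + y \<in> X" "x \<in> X \<Longrightarrow> - x \<in> X" "x \<in> X \<Longrightarrow> sc c x \<in> X"
    "x \<in> X \<Longrightarrow> y \<in> X \<Longrightarrow> x - y \<in> X"
  using assms unfolding scaled_group_def
  by (auto simp: diff_conv_add_uminus simp del: add_uminus_conv_diff)

text \<open>Cosets see only the addition of \<open>V\<close>, so shrinking the carrier to
  \<open>Z'\<close> changes nothing. This matters because \<open>HC\<close> is a quotient of the
  record of cycles, whereas its class map is written with cosets in the full
  \<open>Tot\<close>.\<close>

lemma presented_coset:
  fixes X :: "'x::ab_group_add set"
  assumes V: "presented V X B0 sc cl" and X: "scaled_group sc X"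
    and B: "B \<subseteq> X" and x: "x \<in> X"
  shows "(cl ` B) +>\<^bsub>V\<lparr>carrier := Z'\<rparr>\<^esub> cl x = cl ` ((\<lambda>b. b + x) ` B)"
proof -
  have "cl b \<oplus>\<^bsub>V\<^esub> cl x = cl (b + x)" if "b \<in> B" for b
    using that B x V unfolding presented_def by (meson subsetD)
  then show ?thesis by (simp add: a_r_coset_def' image_image UNION_singleton_eq_range)
qed

text \<open>An equality of classes in the first quotient costs an error in \<open>B0\<close>, which
  \<open>B\<close> absorbs; a double quotient is thus tested on representatives in a single
  step.\<close>

lemma presented_coset_eq_iff:
  fixes X :: "'x::ab_group_add set"
  assumes V: "presented V X B0 sc cl" and X: "scaled_group sc X"
    and B: "scaled_group sc B" "B \<subseteq> X" "B0 \<subseteq> B" and xy: "x \<in> X" "y \<in> X"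
  shows "cl ` ((\<lambda>b. b + x) ` B) = cl ` ((\<lambda>b. b + y) ` B) \<longleftrightarrow> x - y \<in> B"
proof
  assume "cl ` ((\<lambda>b. b + x) ` B) = cl ` ((\<lambda>b. b + y) ` B)"
  moreover have "cl x \<in> cl ` ((\<lambda>b. b + x) ` B)"
    using scaled_groupD(1)[OF B(1)] by (force intro!: rev_image_eqI)
  ultimately obtain b where b: "b \<in> B" "cl x = cl (b + y)" by auto
  then have "x - (b + y) \<in> B0"
    using V xy B scaled_groupD(2)[OF X] unfolding presented_def by blast
  then have "(x - (b + y)) + b \<in> B" using B b scaled_groupD(2)[OF B(1)] by blast
  then show "x - y \<in> B" by (simp add: algebra_simps)
next
  assume d: "x - y \<in> B"
  have sub: "(\<lambda>b. b + x) ` B \<subseteq> (\<lambda>b. b + y) ` B" if "x - y \<in> B" for x y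
  proof
    fix z assume "z \<in> (\<lambda>b. b + x) ` B"
    then obtain b where "b \<in> B" "z = b + x" by auto
    then show "z \<in> (\<lambda>b. b + y) ` B"
      using scaled_groupD(2)[OF B(1) \<open>b \<in> B\<close> that] by (intro image_eqI[of _ _ "b + (x - y)"]) auto
  qed
  have "y - x \<in> B" using scaled_groupD(3)[OF B(1) d] by simp
  with sub[of x y] sub[of y x] d show "cl ` ((\<lambda>b. b + x) ` B) = cl ` ((\<lambda>b. b + y) ` B)" by blast
qed

text \<open>The third isomorphism theorem for records. It is applied with \<open>B0 = {0}\<close> to
  obtain tensor powers and with \<open>B0\<close> the families of relations to obtain
  homology.\<close>

lemma presented_quotient:
  fixes X :: "'x::ab_group_add set"
  assumes V: "presented V X B0 sc cl" and X: "scaled_group sc X"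
    and Z: "scaled_group sc Z" "Z \<subseteq> X"
    and B: "scaled_group sc B" "B \<subseteq> X" "B0 \<subseteq> B"
    and sc: "\<And>c x y. sc c (x + y) = sc c x + sc c y"
  shows "presented (quotient_space (V\<lparr>carrier := cl ` Z\<rparr>) (cl ` B)) Z B sc
           (\<lambda>x. (cl ` B) +>\<^bsub>V\<^esub> cl x)"
proof -
  note XD = scaled_groupD[OF X] and ZD = scaled_groupD[OF Z(1)] and BD = scaled_groupD[OF B(1)]
  have vcl: "cl x \<oplus>\<^bsub>V\<^esub> cl y = cl (x + y)" "c \<odot>\<^bsub>V\<^esub> cl x = cl (sc c x)" if "x \<in> X" "y \<in> X" for x y c
    using V that by (auto simp: presented_def)
  have coset: "(cl ` B) +>\<^bsub>V\<lparr>carrier := Y\<rparr>\<^esub> cl x = cl ` ((\<lambda>b. b + x) ` B)"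
    "(cl ` B) +>\<^bsub>V\<^esub> cl x = cl ` ((\<lambda>b. b + x) ` B)" if "x \<in> X" for x Y
    using presented_coset[OF V X B(2) that, of Y] presented_coset[OF V X B(2) that, of "carrier V"]
    by simp_all
  have eq: "cl ` ((\<lambda>b. b + x) ` B) = cl ` ((\<lambda>b. b + y) ` B) \<longleftrightarrow> x - y \<in> B" if "x \<in> X" "y \<in> X" for x y
    by (rule presented_coset_eq_iff[OF V X B that])
  let ?Q = "quotient_space (V\<lparr>carrier := cl ` Z\<rparr>) (cl ` B)"
  let ?cl = "\<lambda>x. (cl ` B) +>\<^bsub>V\<^esub> cl x"
  have BX: "b \<in> X" if "b \<in> B" for b using that B(2) by auto
  have ZX: "z \<in> X" if "z \<in> Z" for z using that Z(2) by auto
  show ?thesis unfolding presented_def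
  proof (intro conjI ballI allI)
    show "carrier ?Q = ?cl ` Z"
      using Z(2) by (auto simp: quotient_space_def A_RCOSETS_def' coset subset_iff)
    show "\<zero>\<^bsub>?Q\<^esub> = ?cl 0"
      using XD(1) by (simp add: quotient_space_def coset)
  next
    fix x y assume xy: "x \<in> Z" "y \<in> Z"
    have "set_add (V\<lparr>carrier := cl ` Z\<rparr>) (cl ` ((\<lambda>b. b + x) ` B)) (cl ` ((\<lambda>b. b + y) ` B))
        = cl ` ((\<lambda>b. b + (x + y)) ` B)" (is "?L = ?R")
    proof (intro equalityI subsetI)
      fix z assume "z \<in> ?L"
      then obtain b b' where b: "b \<in> B" "b' \<in> B" "z = cl (b + x) \<oplus>\<^bsub>V\<^esub> cl (b' + y)"
        by (auto simp: set_add_def')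
      then have "z = cl ((b + x) + (b' + y))" using vcl(1) XD(2) BX ZX xy by auto
      then have "z = cl ((b + b') + (x + y))" by (simp add: algebra_simps)
      then show "z \<in> ?R" using BD(2) b by blast
    next
      fix z assume "z \<in> ?R"
      then obtain b where b: "b \<in> B" "z = cl (b + (x + y))" by auto
      have "z = cl (b + x) \<oplus>\<^bsub>V\<^esub> cl (0 + y)"
        using vcl(1)[of "b + x" "0 + y"] XD(2) BX ZX xy b by (auto simp: algebra_simps)
      moreover have "cl (b + x) \<in> cl ` ((\<lambda>b. b + x) ` B)" "cl (0 + y) \<in> cl ` ((\<lambda>b. b + y) ` B)"
        using b(1) BD(1) by blast+
      ultimately show "z \<in> ?L" unfolding set_add_def' by (simp only: UN_iff) force
    qed
    then show "?cl x \<oplus>\<^bsub>?Q\<^esub> ?cl y = ?cl (x + y)"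
      using xy XD ZX by (simp add: quotient_space_def coset)
  next
    fix c x assume x: "x \<in> Z"
    \<comment> \<open>Scalar multiplication in \<open>quotient_space\<close> is a union of cosets.
      All of them coincide, and the union is not empty because \<open>0 \<in> B\<close>.\<close>
    have "(\<Union>\<xi>\<in>cl ` ((\<lambda>b. b + x) ` B). (cl ` B) +>\<^bsub>V\<lparr>carrier := cl ` Z\<rparr>\<^esub> (c \<odot>\<^bsub>V\<^esub> \<xi>))
        = (\<Union>b\<in>B. cl ` ((\<lambda>b. b + sc c x) ` B))"
    proof -
      have "(cl ` B) +>\<^bsub>V\<lparr>carrier := cl ` Z\<rparr>\<^esub> (c \<odot>\<^bsub>V\<^esub> cl (b + x)) = cl ` ((\<lambda>b. b + sc c x) ` B)"
        if "b \<in> B" for b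
      proof -
        have X': "b \<in> X" "x \<in> X" "b + x \<in> X" "sc c (b + x) \<in> X" "sc c x \<in> X"
          using that x BX ZX XD(2,4) by auto
        have "sc c (b + x) - sc c x \<in> B" using BD(4) that by (simp add: sc)
        then show ?thesis using eq X'(4,5) by (simp add: vcl[OF X'(3,3)] coset[OF X'(4)])
      qed
      then show ?thesis by auto
    qed
    also have "\<dots> = cl ` ((\<lambda>b. b + sc c x) ` B)" using BD(1) by auto
    finally show "c \<odot>\<^bsub>?Q\<^esub> ?cl x = ?cl (sc c x)"
      using x XD ZX by (simp add: quotient_space_def coset)
  next
    fix x y assume "x \<in> Z" "y \<in> Z"
    then show "?cl x = ?cl y \<longleftrightarrow> x - y \<in> B" using eq ZX coset(2) by simp
  qed
qed

lemma induced_map_coset: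
  fixes \<phi> :: "'x \<Rightarrow> 'y::ab_group_add"
  assumes V: "presented V X B0 sc cl" and X: "scaled_group sc X"
    and B: "scaled_group sc B" "B \<subseteq> X" "B0 \<subseteq> B"
    and Y: "\<xi> \<noteq> {}" "\<And>u. u \<in> \<xi> \<Longrightarrow> \<exists>v\<in>X. \<phi> u = cl v \<and> v - x \<in> B" and x: "x \<in> X"
  shows "induced_map V (cl ` B) \<phi> \<xi> = (cl ` B) +>\<^bsub>V\<^esub> cl x"
proof -
  have "(cl ` B) +>\<^bsub>V\<^esub> \<phi> u = (cl ` B) +>\<^bsub>V\<^esub> cl x" if u: "u \<in> \<xi>" for u
  proof -
    obtain v where v: "v \<in> X" "\<phi> u = cl v" "v - x \<in> B" using Y(2)[OF u] by blast
    then show ?thesis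
      using presented_coset[OF V X B(2), of _ "carrier V"] presented_coset_eq_iff[OF V X B v(1) x] x
      by simp
  qed
  with Y(1) show ?thesis by (auto simp: induced_map_def)
qed

lemma presented_product:
  assumes V: "\<And>i. i \<in> I \<Longrightarrow> presented (V i) (X i) (B i) sc (cl i)"
  shows "presented (product_space I V) {x. \<forall>i\<in>I. x i \<in> X i} {x. \<forall>i\<in>I. x i \<in> B i}
           (\<lambda>c x i. sc c (x i)) (\<lambda>x. \<lambda>i\<in>I. cl i (x i))"
  unfolding presented_def
proof (intro conjI ballI allI)
  note VD = V[unfolded presented_def]
  show "carrier (product_space I V) = (\<lambda>x. \<lambda>i\<in>I. cl i (x i)) ` {x. \<forall>i\<in>I. x i \<in> X i}" (is "?L = ?R")
  proof (intro equalityI subsetI)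
    fix f assume f: "f \<in> ?L"
    have "\<exists>x. x \<in> X i \<and> f i = cl i x" if "i \<in> I" for i
    proof -
      have "f i \<in> carrier (V i)" using f that by (auto simp: product_space_def)
      then show ?thesis using V[OF that] by (auto simp: presented_def)
    qed
    then obtain x where x: "\<forall>i\<in>I. x i \<in> X i \<and> f i = cl i (x i)" by metis
    then have "f = (\<lambda>i\<in>I. cl i (x i))"
      using f by (auto simp: product_space_def PiE_def extensional_def)
    with x show "f \<in> ?R" by blast
  next
    fix f assume "f \<in> ?R"
    then show "f \<in> ?L" using VD by (auto simp: product_space_def)
  qed
  show "\<zero>\<^bsub>product_space I V\<^esub> = (\<lambda>i\<in>I. cl i (0 i))"
    using VD by (auto simp: product_space_def intro!: restrict_ext)
next
  note VD = V[unfolded presented_def]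
  fix x y assume "x \<in> {x. \<forall>i\<in>I. x i \<in> X i}" "y \<in> {x. \<forall>i\<in>I. x i \<in> X i}"
  then show "(\<lambda>i\<in>I. cl i (x i)) \<oplus>\<^bsub>product_space I V\<^esub> (\<lambda>i\<in>I. cl i (y i)) = (\<lambda>i\<in>I. cl i ((x + y) i))"
    "((\<lambda>i\<in>I. cl i (x i)) = (\<lambda>i\<in>I. cl i (y i))) = (x - y \<in> {x. \<forall>i\<in>I. x i \<in> B i})"
    using VD by (auto simp: product_space_def fun_eq_iff restrict_def)
next
  note VD = V[unfolded presented_def]
  fix c x assume "x \<in> {x. \<forall>i\<in>I. x i \<in> X i}"
  then show "c \<odot>\<^bsub>product_space I V\<^esub> (\<lambda>i\<in>I. cl i (x i)) = (\<lambda>i\<in>I. cl i (sc c (x i)))"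
    using VD by (auto simp: product_space_def fun_eq_iff restrict_def)
qed

section \<open>Free spaces and the multilinearity relations\<close>

lemma lookup_free_scale [simp]:
  "Poly_Mapping.lookup (free_scale c x) w = c * Poly_Mapping.lookup x w"
  by (simp add: free_scale_def Poly_Mapping.map.rep_eq when_def)

interpretation free: vector_space "free_scale :: 'k::field \<Rightarrow> ('w \<Rightarrow>\<^sub>0 'k) \<Rightarrow> _"
  by unfold_locales (auto intro!: poly_mapping_eqI simp: lookup_add algebra_simps)

abbreviation free_linear :: "(('w \<Rightarrow>\<^sub>0 'k::field) \<Rightarrow> ('v \<Rightarrow>\<^sub>0 'k)) \<Rightarrow> bool" where
  "free_linear \<equiv> module_hom free_scale free_scale"

definition supported :: "'w set \<Rightarrow> ('w \<Rightarrow>\<^sub>0 'k::field) set" where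
  "supported S = {x. Poly_Mapping.keys x \<subseteq> S}"

lemma free_scale_single [simp]: "free_scale c (Poly_Mapping.single w d)
    = Poly_Mapping.single w (c * d)"
  by (auto intro!: poly_mapping_eqI simp: lookup_single when_def)

lemma keys_free_scale: "Poly_Mapping.keys (free_scale c x) \<subseteq> Poly_Mapping.keys x"
  by (auto simp: in_keys_iff)

lemma subspace_supported: "free.subspace (supported S)"
  by (auto simp: free.subspace_def supported_def
      dest!: subsetD[OF Poly_Mapping.keys_add] subsetD[OF keys_free_scale])

lemmas supported_0 = free.subspace_0[OF subspace_supported]
  and supported_add = free.subspace_add[OF subspace_supported]
  and supported_diff = free.subspace_diff[OF subspace_supported]
  and supported_neg = free.subspace_neg[OF subspace_supported]

lemma single_supported: "w \<in> S \<Longrightarrow> Poly_Mapping.single w c \<in> supported S"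
  by (auto simp: supported_def)

lemma free_expand:
  assumes "finite S" "Poly_Mapping.keys x \<subseteq> S"
  shows "x = (\<Sum>w\<in>S. free_scale (Poly_Mapping.lookup x w) (Poly_Mapping.single w 1))"
proof (rule poly_mapping_eqI)
  fix v
  have "(\<Sum>w\<in>S. Poly_Mapping.lookup (Poly_Mapping.single w (Poly_Mapping.lookup x w)) v)
      = (\<Sum>w\<in>S. if w = v then Poly_Mapping.lookup x w else 0)"
    by (rule sum.cong) (auto simp: lookup_single when_def)
  also have "\<dots> = Poly_Mapping.lookup x v"
    using assms by (auto simp: in_keys_iff subset_iff)
  finally show "Poly_Mapping.lookup x v = Poly_Mapping.lookup
      (\<Sum>w\<in>S. free_scale (Poly_Mapping.lookup x w) (Poly_Mapping.single w 1)) v"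
    by (simp add: lookup_sum)
qed

lemma supported_induct:
  assumes x: "x \<in> supported S" and P: "free.subspace P"
    and w: "\<And>w. w \<in> S \<Longrightarrow> Poly_Mapping.single w 1 \<in> P"
  shows "x \<in> P"
proof -
  have "(\<Sum>w\<in>Poly_Mapping.keys x. free_scale (Poly_Mapping.lookup x w) (Poly_Mapping.single w 1))
      \<in> P"
    using x w by (intro free.subspace_sum[OF P] free.subspace_scale[OF P]) (auto
        simp: supported_def)
  then show ?thesis using free_expand[OF finite_keys order_refl, of x] by simp
qed

text \<open>The keys of a sum can shrink by cancellation, so additivity of
  \<open>linear_extension\<close> is read off over a common larger index set.\<close>

lemma linear_extension_superset:
  assumes "finite S" "Poly_Mapping.keys x \<subseteq> S"
  shows "linear_extension \<phi> x = (\<Sum>w\<in>S. free_scale (Poly_Mapping.lookup x w) (\<phi> w))"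
  unfolding linear_extension_def
  using assms by (intro sum.mono_neutral_left) (auto simp: in_keys_iff)

lemma free_linear_iff:
  "free_linear g \<longleftrightarrow>
     (\<forall>x y. g (x + y) = g x + g y) \<and> (\<forall>c x. g (free_scale c x) = free_scale c (g x))"
  by (simp add: module_hom_iff free.module_axioms)

lemma free_linear_linear_extension:
  fixes \<phi> :: "'w \<Rightarrow> ('v \<Rightarrow>\<^sub>0 'k::field)"
  shows "free_linear (linear_extension \<phi>)"
  unfolding free_linear_iff
proof (intro conjI allI)
  fix x y :: "'w \<Rightarrow>\<^sub>0 'k"
  let ?S = "Poly_Mapping.keys x \<union> Poly_Mapping.keys y"
  show "linear_extension \<phi> (x + y) = linear_extension \<phi> x + linear_extension \<phi> y"
    using linear_extension_superset[of ?S x \<phi>] linear_extension_superset[of ?S y \<phi>]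
      linear_extension_superset[of ?S "x + y" \<phi>] Poly_Mapping.keys_add[of x y]
    by (simp add: lookup_add free.scale_left_distrib sum.distrib)
next
  fix c and x :: "'w \<Rightarrow>\<^sub>0 'k"
  show "linear_extension \<phi> (free_scale c x) = free_scale c (linear_extension \<phi> x)"
    using linear_extension_superset[OF finite_keys keys_free_scale, of \<phi> c x]
    by (simp add: linear_extension_def free.scale_sum_right)
qed

lemma linear_extension_single [simp]:
  "linear_extension \<phi> (Poly_Mapping.single w c) = free_scale c (\<phi> w)"
  by (cases "c = 0") (auto simp: linear_extension_def)

lemmas linear_extension_simps =
  module_hom.add[OF free_linear_linear_extension] module_hom.diff[OF free_linear_linear_extension]
  module_hom.neg[OF free_linear_linear_extension] module_hom.zero[OF free_linear_linear_extension]
  module_hom.scale[OF free_linear_linear_extension] module_hom.sum[OF free_linear_linear_extension]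

lemma free_linear_compose: "free_linear f \<Longrightarrow> free_linear g \<Longrightarrow> free_linear (\<lambda>x. g (f x))"
  by (simp add: free_linear_iff)

lemma free_linear_add: "free_linear f \<Longrightarrow> free_linear g \<Longrightarrow> free_linear (\<lambda>x. f x + g x)"
  by (simp add: free_linear_iff free.scale_right_distrib algebra_simps)

lemma free_linear_minus: "free_linear f \<Longrightarrow> free_linear g \<Longrightarrow> free_linear (\<lambda>x. f x - g x)"
  by (simp add: free_linear_iff free.scale_right_diff_distrib algebra_simps)

lemma free_linear_uminus: "free_linear f \<Longrightarrow> free_linear (\<lambda>x. - f x)"
  by (simp add: free_linear_iff free.scale_minus_right algebra_simps)

lemma free_linear_id: "free_linear (\<lambda>x. x)"
  by (simp add: free_linear_iff)

lemma free_linear_sum: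
  "(\<And>i. i \<in> I \<Longrightarrow> free_linear (f i)) \<Longrightarrow> free_linear (\<lambda>x. \<Sum>i\<in>I. f i x)"
  by (simp add: free_linear_iff free.scale_sum_right sum.distrib)

lemma free_linear_funpow:
  fixes f :: "('w \<Rightarrow>\<^sub>0 'k::field) \<Rightarrow> ('w \<Rightarrow>\<^sub>0 'k)"
  shows "free_linear f \<Longrightarrow> free_linear (f ^^ i)"
  unfolding free_linear_iff by (induction i) auto

lemma free_linear_0: "free_linear f \<Longrightarrow> f 0 = 0"
  by (rule module_hom.zero)

lemma free_linear_eq_on:
  assumes "free_linear f" "free_linear g"
    and "\<And>w. w \<in> S \<Longrightarrow> f (Poly_Mapping.single w 1) = g (Poly_Mapping.single w 1)"
    and "x \<in> supported S"
  shows "f x = g x"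
proof -
  have "free.subspace {x. f x = g x}"
    using assms(1,2) free_linear_0[OF assms(1)] free_linear_0[OF assms(2)]
        by (auto simp: free.subspace_def free_linear_iff)
  from supported_induct[OF assms(4) this] assms(3) show ?thesis by auto
qed

lemma free_linear_supported:
  assumes "free_linear f" "\<And>w. w \<in> S \<Longrightarrow> f (Poly_Mapping.single w 1) \<in> supported S'"
    and "x \<in> supported S"
  shows "f x \<in> supported S'"
proof -
  have "free.subspace {x. f x \<in> supported S'}"
    using assms(1) subspace_supported[of S'] free_linear_0[OF assms(1)] 
        by (auto simp: free.subspace_def free_linear_iff)
  from supported_induct[OF assms(3) this] assms(2) show ?thesis by auto
qed

lemma scaled_group_subspace: "free.subspace P \<Longrightarrow> scaled_group free_scale P"
  by (auto simp: scaled_group_def free.subspace_def free.subspace_neg)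

lemma scaled_group_supported: "scaled_group free_scale (supported S)"
  by (rule scaled_group_subspace[OF subspace_supported])

section \<open>Congruence modulo the multilinearity relations\<close>

context unital_algebra
begin

text \<open>One subspace of relations serves for all corners and all tensor degrees, because the relations
  of a corner are those of the whole algebra that are supported on its words
  (\<open>tensor_relations_eq\<close>).\<close>

definition rels :: "('a list \<Rightarrow>\<^sub>0 'k) set" where
  "rels = free.span
     ({Poly_Mapping.single (xs @ (x + y) # ys) 1 - Poly_Mapping.single (xs @ x # ys) 1
         - Poly_Mapping.single (xs @ y # ys) 1 | xs x y ys. True} \<union>
      {Poly_Mapping.single (xs @ scale c x # ys) 1 - Poly_Mapping.single (xs @ x # ys) c
         | xs c x ys. True})"

lemma subspace_rels: "free.subspace rels"
  unfolding rels_def by (rule free.subspace_span)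

lemmas rels_0 = free.subspace_0[OF subspace_rels]
  and rels_add = free.subspace_add[OF subspace_rels]
  and rels_diff = free.subspace_diff[OF subspace_rels]
  and rels_neg = free.subspace_neg[OF subspace_rels]
  and rels_scale = free.subspace_scale[OF subspace_rels]
  and rels_sum = free.subspace_sum[OF subspace_rels]

lemma rels_gen_add: "Poly_Mapping.single (xs @ (x + y) # ys) 1 - Poly_Mapping.single (xs @ x # ys) 1
         - Poly_Mapping.single (xs @ y # ys) 1 \<in> rels"
  unfolding rels_def by (rule free.span_base) blast

lemma rels_gen_scale: "Poly_Mapping.single (xs @ scale c x # ys) 1
    - Poly_Mapping.single (xs @ x # ys) c \<in> rels"
  unfolding rels_def by (rule free.span_base) blast

definition eqv :: "('a list \<Rightarrow>\<^sub>0 'k) \<Rightarrow> ('a list \<Rightarrow>\<^sub>0 'k) \<Rightarrow> bool" (infix "\<approx>" 50) where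
  "x \<approx> y \<longleftrightarrow> x - y \<in> rels"

lemma eqv_refl [simp, intro]: "x \<approx> x"
  by (simp add: eqv_def rels_0)

lemma eqv_sym: "x \<approx> y \<Longrightarrow> y \<approx> x"
  using rels_neg[of "x - y"] by (simp add: eqv_def)

lemma eqv_trans [trans]: "x \<approx> y \<Longrightarrow> y \<approx> z \<Longrightarrow> x \<approx> z"
  using rels_add[of "x - y" "y - z"] by (simp add: eqv_def)

lemma eqv_add: "x \<approx> y \<Longrightarrow> x' \<approx> y' \<Longrightarrow> x + x' \<approx> y + y'"
  using rels_add[of "x - y" "x' - y'"] by (simp add: eqv_def algebra_simps)

lemma eqv_neg: "x \<approx> y \<Longrightarrow> - x \<approx> - y"
  using rels_neg[of "x - y"] by (simp add: eqv_def algebra_simps)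

lemma eqv_diff: "x \<approx> y \<Longrightarrow> x' \<approx> y' \<Longrightarrow> x - x' \<approx> y - y'"
  using rels_diff[of "x - y" "x' - y'"] by (simp add: eqv_def algebra_simps)

lemma eqv_scale: "x \<approx> y \<Longrightarrow> free_scale c x \<approx> free_scale c y"
  using rels_scale[of "x - y" c] by (simp add: eqv_def free.scale_right_diff_distrib)

lemma eqv_sum: "(\<And>i. i \<in> I \<Longrightarrow> f i \<approx> g i) \<Longrightarrow> sum f I \<approx> sum g I"
  using rels_sum[of I "\<lambda>i. f i - g i"] by (simp add: eqv_def sum_subtractf)

lemma eqv_0_iff: "x \<approx> 0 \<longleftrightarrow> x \<in> rels"
  by (simp add: eqv_def)

text \<open>As \<open>rels\<close> collects the relations of every length, this one condition makes
  the map well defined on tensors of all degrees simultaneously.\<close>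

definition descends :: "(('a list \<Rightarrow>\<^sub>0 'k) \<Rightarrow> ('a list \<Rightarrow>\<^sub>0 'k)) \<Rightarrow> bool" where
  "descends g \<longleftrightarrow> free_linear g \<and> (\<forall>x\<in>rels. g x \<in> rels)"

lemma descends_linear: "descends g \<Longrightarrow> free_linear g"
  by (simp add: descends_def)

lemma descends_rels: "descends g \<Longrightarrow> x \<in> rels \<Longrightarrow> g x \<in> rels"
  by (simp add: descends_def)

lemma descends_eqv: "descends g \<Longrightarrow> x \<approx> y \<Longrightarrow> g x \<approx> g y"
  by (auto simp: descends_def eqv_def simp flip: module_hom.diff)

text \<open>Being fixed modulo relations depends only on the class, so a contraction identity can be
  tested on a convenient representative.\<close>

lemma descends_fixed_eqv: "descends g \<Longrightarrow> x \<approx> u \<Longrightarrow> g u \<approx> u \<Longrightarrow> g x \<approx> x"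
  by (rule eqv_trans[OF descends_eqv eqv_trans[OF _ eqv_sym]])

lemma descends_simps:
  assumes "descends g"
  shows "g (x + y) = g x + g y" "g (x - y) = g x - g y" "g (- x) = - g x" "g 0 = 0"
    "g (free_scale c x) = free_scale c (g x)" "g (sum f I) = (\<Sum>i\<in>I. g (f i))"
  using assms module_hom.add module_hom.diff module_hom.neg module_hom.zero module_hom.scale
    module_hom.sum by (fastforce simp: descends_def)+

lemma descends_id: "descends (\<lambda>x. x)"
  by (simp add: descends_def free_linear_id)

lemma descends_compose: "descends f \<Longrightarrow> descends g \<Longrightarrow> descends (\<lambda>x. g (f x))"
  by (simp add: descends_def free_linear_compose)

lemma descends_add: "descends f \<Longrightarrow> descends g \<Longrightarrow> descends (\<lambda>x. f x + g x)"
  by (simp add: descends_def free_linear_add rels_add)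

lemma descends_minus: "descends f \<Longrightarrow> descends g \<Longrightarrow> descends (\<lambda>x. f x - g x)"
  by (simp add: descends_def free_linear_minus rels_diff)

lemma descends_uminus: "descends f \<Longrightarrow> descends (\<lambda>x. - f x)"
  by (simp add: descends_def free_linear_uminus rels_neg)

lemma descends_funpow: "descends f \<Longrightarrow> descends (f ^^ i)"
  unfolding descends_def free_linear_iff by (induction i) auto

definition multilinear_at :: "'a list \<Rightarrow> 'a list \<Rightarrow> ('a list \<Rightarrow> ('a list \<Rightarrow>\<^sub>0 'k)) \<Rightarrow> bool" where
  "multilinear_at xs ys \<phi> \<longleftrightarrow>
     (\<forall>x y. \<phi> (xs @ (x + y) # ys) \<approx> \<phi> (xs @ x # ys) + \<phi> (xs @ y # ys)) \<and>
     (\<forall>c x. \<phi> (xs @ scale c x # ys) \<approx> free_scale c (\<phi> (xs @ x # ys)))"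

text \<open>Each generator of \<open>rels\<close> varies a single letter, so linearity in one slot
  at a time is enough.\<close>

lemma descends_linear_extension:
  assumes "\<And>xs ys. multilinear_at xs ys \<phi>"
  shows "descends (linear_extension \<phi>)"
  unfolding descends_def
proof (intro conjI ballI)
  fix x assume "x \<in> rels"
  then show "linear_extension \<phi> x \<in> rels"
    unfolding rels_def
  proof (rule free.span_induct)
    have "free.subspace {x. linear_extension \<phi> x \<in> rels}"
      by (auto simp: free.subspace_def linear_extension_simps rels_0 rels_add rels_scale)
    then show "free.subspace {x. linear_extension \<phi> x \<in> free.span
     ({Poly_Mapping.single (xs @ (x + y) # ys) 1 - Poly_Mapping.single (xs @ x # ys) 1
         - Poly_Mapping.single (xs @ y # ys) 1 | xs x y ys. True} \<union>
      {Poly_Mapping.single (xs @ scale c x # ys) 1 - Poly_Mapping.single (xs @ x # ys) c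
         | xs c x ys. True})}"
      by (simp add: rels_def)
  next
    fix x :: "'a list \<Rightarrow>\<^sub>0 'k"
    assume "x \<in> {Poly_Mapping.single (xs @ (x + y) # ys) 1 - Poly_Mapping.single (xs @ x # ys) 1
         - Poly_Mapping.single (xs @ y # ys) 1 | xs x y ys. True} \<union>
      {Poly_Mapping.single (xs @ scale c x # ys) 1 - Poly_Mapping.single (xs @ x # ys) c
         | xs c x ys. True}"
    then have "linear_extension \<phi> x \<in> rels"
      using assms by (auto simp: linear_extension_simps multilinear_at_def eqv_def diff_diff_eq)
    then show "linear_extension \<phi> x \<in> free.span
     ({Poly_Mapping.single (xs @ (x + y) # ys) 1 - Poly_Mapping.single (xs @ x # ys) 1
         - Poly_Mapping.single (xs @ y # ys) 1 | xs x y ys. True} \<union>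
      {Poly_Mapping.single (xs @ scale c x # ys) 1 - Poly_Mapping.single (xs @ x # ys) c
         | xs c x ys. True})"
      by (simp add: rels_def)
  qed
qed (rule free_linear_linear_extension)

lemma multilinear_at_sum:
  assumes "\<And>i. i \<in> I \<Longrightarrow> multilinear_at xs ys (f i)"
  shows "multilinear_at xs ys (\<lambda>w. \<Sum>i\<in>I. f i w)"
  using assms by (auto simp: multilinear_at_def free.scale_sum_right intro!: eqv_sum
      simp flip: sum.distrib)

lemma multilinear_at_descends:
  assumes "descends g" "multilinear_at xs ys f"
  shows "multilinear_at xs ys (\<lambda>w. g (f w))"
  using assms descends_eqv[OF assms(1)]
      by (auto simp: multilinear_at_def descends_simps[OF assms(1), symmetric])

text \<open>Summation ranges and signs that depend on the length of the word become constants once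
  the slot, and with it the length, is fixed.\<close>

lemma multilinear_at_cong: "(\<And>z. f (xs @ z # ys) = g (xs @ z # ys)) \<Longrightarrow> multilinear_at xs ys f
    \<longleftrightarrow> multilinear_at xs ys g"
  by (simp add: multilinear_at_def)

text \<open>The common pattern of faces, rotations, insertions and compressions: the varying letter
  enters the result exactly once, through a linear map \<open>\<psi>\<close>, and everything around
  it stays fixed.\<close>

definition linear_slot :: "'a list \<Rightarrow> 'a list \<Rightarrow> ('a list \<Rightarrow> 'a list) \<Rightarrow> bool" where
  "linear_slot xs ys \<delta> \<longleftrightarrow> (\<exists>us vs \<psi>. (\<forall>x y. \<psi> (x + y) = \<psi> x + \<psi> y)
      \<and> (\<forall>c x. \<psi> (scale c x) = scale c (\<psi> x)) \<and>
      (\<forall>z. \<delta> (xs @ z # ys) = us @ \<psi> z # vs))"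

lemma linear_slotI:
  assumes "\<And>z. \<delta> (xs @ z # ys) = us @ \<psi> z # vs"
    "\<And>x y. \<psi> (x + y) = \<psi> x + \<psi> y" "\<And>c x. \<psi> (scale c x) = scale c (\<psi> x)"
  shows "linear_slot xs ys \<delta>"
  using assms unfolding linear_slot_def by blast

lemma multilinear_at_single:
  assumes "linear_slot xs ys \<delta>"
  shows "multilinear_at xs ys (\<lambda>w. Poly_Mapping.single (\<delta> w) c)"
proof -
  have "Poly_Mapping.single (us @ (x + y) # vs) c \<approx>
      Poly_Mapping.single (us @ x # vs) c + Poly_Mapping.single (us @ y # vs) c" for us vs x y
    using rels_scale[OF rels_gen_add, of c us x y vs]
    by (simp add: eqv_def free.scale_right_diff_distrib free.scale_right_distrib diff_diff_eq)
  moreover have "Poly_Mapping.single (us @ scale d x # vs) c \<approx>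
      free_scale d (Poly_Mapping.single (us @ x # vs) c)" for us vs d x
    using rels_scale[OF rels_gen_scale, of c us d x vs]
    by (simp add: eqv_def free.scale_right_diff_distrib mult.commute)
  ultimately show ?thesis using assms by (auto simp: multilinear_at_def linear_slot_def)
qed

text \<open>Since \<open>scale 0 0 = 0\<close>, the scaling relation with coefficient
  \<open>0\<close> is the word itself.\<close>

lemma zero_letter: "0 \<in> set w \<Longrightarrow> Poly_Mapping.single w c \<in> rels"
  using rels_gen_scale[of _ 0 0] rels_scale[of "Poly_Mapping.single w 1" c]
  by (auto simp: in_set_conv_decomp)

section \<open>Corners and the relations of a corner\<close>

definition compress :: "'a \<Rightarrow> 'a \<Rightarrow> 'a" where
  "compress \<epsilon> x = \<epsilon> * x * \<epsilon>"

lemma compress_add: "compress \<epsilon> (x + y) = compress \<epsilon> x + compress \<epsilon> y"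
  by (simp add: compress_def algebra_simps)

lemma compress_scale: "compress \<epsilon> (scale c x) = scale c (compress \<epsilon> x)"
  by (simp add: compress_def scale_mult_left scale_mult_right)

lemma corner_eq: "corner \<epsilon> = range (compress \<epsilon>)"
  by (auto simp: corner_def compress_def)

lemma corner_closed:
  assumes "\<epsilon> * \<epsilon> = \<epsilon>" "x \<in> corner \<epsilon>" "y \<in> corner \<epsilon>"
  shows "x + y \<in> corner \<epsilon>" "scale c x \<in> corner \<epsilon>" "x * y \<in> corner \<epsilon>" "compress \<epsilon> x = x"
proof -
  obtain u v where "x = \<epsilon> * u * \<epsilon>" "y = \<epsilon> * v * \<epsilon>" using assms by (auto simp: corner_def)
  then show "x + y \<in> corner \<epsilon>" "scale c x \<in> corner \<epsilon>" "x * y \<in> corner \<epsilon>"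
    unfolding corner_eq
    by (auto simp: image_iff compress_def scale_mult_left scale_mult_right algebra_simps
        intro: exI[of _ "u + v"] exI[of _ "scale c u"] exI[of _ "u * \<epsilon> * (\<epsilon> * v)"])
  have "\<epsilon> * (\<epsilon> * u * \<epsilon>) * \<epsilon> = (\<epsilon> * \<epsilon>) * u * (\<epsilon> * \<epsilon>)" by (simp only: mult.assoc)
  then show "compress \<epsilon> x = x" using assms(1) \<open>x = _\<close> by (simp add: compress_def)
qed

text \<open>Compression \<open>x \<mapsto> \<epsilon> x \<epsilon>\<close> is a linear retraction onto the corner; applied to every letter
  it turns the relations of the whole algebra into relations of the corner.\<close>

lemma tensor_relations_eq:
  assumes idem: "\<epsilon> * \<epsilon> = \<epsilon>" and A: "A = corner \<epsilon>"
  shows "tensor_relations scale A m = rels \<inter> supported (words A m)"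
proof (intro equalityI subsetI)
  have sub: "free.subspace (rels \<inter> supported (words A m))"
    by (intro free.subspace_inter subspace_rels subspace_supported)
  fix x assume "x \<in> tensor_relations scale A m"
  then show "x \<in> rels \<inter> supported (words A m)"
    unfolding tensor_relations_def
  proof (rule free.span_induct)
    show "free.subspace {x. x \<in> rels \<inter> supported (words A m)}" using sub
        by (simp only: Collect_mem_eq)
  next
    fix g :: "'a list \<Rightarrow>\<^sub>0 'k"
    assume "g \<in> {Poly_Mapping.single (xs @ (x + y) # ys) 1 - Poly_Mapping.single (xs @ x # ys) 1
         - Poly_Mapping.single (xs @ y # ys) 1 | xs x y ys.
         x \<in> A \<and> y \<in> A \<and> set xs \<subseteq> A \<and> set ys \<subseteq> A \<and> length xs + 1 + length ys = m} \<union>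
      {Poly_Mapping.single (xs @ scale c x # ys) 1 - Poly_Mapping.single (xs @ x # ys) c | xs c x
          ys.
         x \<in> A \<and> set xs \<subseteq> A \<and> set ys \<subseteq> A \<and> length xs + 1 + length ys = m}"
    then show "g \<in> rels \<inter> supported (words A m)"
    proof (elim UnE CollectE exE conjE)
      fix xs x y ys
      assume "g = Poly_Mapping.single (xs @ (x + y) # ys) 1 - Poly_Mapping.single (xs @ x # ys) 1
         - Poly_Mapping.single (xs @ y # ys) 1" "x \<in> A" "y \<in> A" "set xs \<subseteq> A" "set ys \<subseteq> A"
        "length xs + 1 + length ys = m"
      then show ?thesis using corner_closed(1)[OF idem] A
        by (auto intro!: rels_gen_add supported_diff single_supported simp: words_def)
    next
      fix xs c x ys
      assume "g = Poly_Mapping.single (xs @ scale c x # ys) 1 - Poly_Mapping.single (xs @ x # ys) c"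
        "x \<in> A" "set xs \<subseteq> A" "set ys \<subseteq> A" "length xs + 1 + length ys = m"
      then show ?thesis using corner_closed(2)[OF idem] A
        by (auto intro!: rels_gen_scale supported_diff single_supported simp: words_def)
    qed
  qed
next
  \<comment> \<open>Elements of \<open>rels\<close> mix words of all lengths, whereas
    \<open>tensor_relations scale A m\<close> knows only length \<open>m\<close>; words of any other
    length are therefore sent to zero.\<close>
  define \<rho> where "\<rho> = linear_extension (\<lambda>w. if length w = m
    then Poly_Mapping.single (map (compress \<epsilon>) w) (1::'k) else 0)"
  note rho = linear_extension_simps[of "\<lambda>w. if length w = m
    then Poly_Mapping.single (map (compress \<epsilon>) w) (1::'k) else 0", folded \<rho>_def]
  have sub: "free.subspace {x. \<rho> x \<in> tensor_relations scale A m}"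
    unfolding tensor_relations_def
    by (auto simp: free.subspace_def rho free.span_zero free.span_add free.span_scale)
  fix x assume x: "x \<in> rels \<inter> supported (words A m)"
  then have "x \<in> rels" by simp
  then have "\<rho> x \<in> tensor_relations scale A m"
    unfolding rels_def
  proof (rule free.span_induct)
    show "free.subspace {x. \<rho> x \<in> tensor_relations scale A m}" by (rule sub)
  next
    fix g :: "'a list \<Rightarrow>\<^sub>0 'k"
    assume "g \<in> {Poly_Mapping.single (xs @ (x + y) # ys) 1 - Poly_Mapping.single (xs @ x # ys) 1
         - Poly_Mapping.single (xs @ y # ys) 1 | xs x y ys. True} \<union>
      {Poly_Mapping.single (xs @ scale c x # ys) 1 - Poly_Mapping.single (xs @ x # ys) c
         | xs c x ys. True}"
    then show "\<rho> g \<in> tensor_relations scale A m"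
    proof (elim UnE CollectE exE conjE)
      fix xs x y ys
      assume g: "g = Poly_Mapping.single (xs @ (x + y) # ys) 1 - Poly_Mapping.single (xs @ x # ys) 1
         - Poly_Mapping.single (xs @ y # ys) 1"
      let ?f = "map (compress \<epsilon>)"
      show ?thesis
      proof (cases "length xs + 1 + length ys = m")
        case True
        have "Poly_Mapping.single (?f xs @ (compress \<epsilon> x + compress \<epsilon> y) # ?f ys) 1
           - Poly_Mapping.single (?f xs @ compress \<epsilon> x # ?f ys) 1
           - Poly_Mapping.single (?f xs @ compress \<epsilon> y # ?f ys) 1 \<in> tensor_relations scale A m"
          unfolding tensor_relations_def
        proof (rule free.span_base, rule UnI1, rule CollectI, intro exI conjI)
          show "length (?f xs) + 1 + length (?f ys) = m" using True by simp
        qed (auto simp: A corner_eq)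
        with True show ?thesis by (simp add: g rho, simp add: \<rho>_def compress_add)
      next
        case False
        then show ?thesis
          by (simp add: g rho, simp add: \<rho>_def tensor_relations_def free.span_zero)
      qed
    next
      fix xs c x ys
      assume g: "g = Poly_Mapping.single (xs @ scale c x # ys) 1
          - Poly_Mapping.single (xs @ x # ys) c"
      let ?f = "map (compress \<epsilon>)"
      show ?thesis
      proof (cases "length xs + 1 + length ys = m")
        case True
        have "Poly_Mapping.single (?f xs @ scale c (compress \<epsilon> x) # ?f ys) 1
           - Poly_Mapping.single (?f xs @ compress \<epsilon> x # ?f ys) c \<in> tensor_relations scale A m"
          unfolding tensor_relations_def
        proof (rule free.span_base, rule UnI2, rule CollectI, intro exI conjI)
          show "length (?f xs) + 1 + length (?f ys) = m" using True by simp
        qed (auto simp: A corner_eq)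
        with True show ?thesis by (simp add: g rho, simp add: \<rho>_def compress_scale)
      next
        case False
        then show ?thesis
          by (simp add: g rho, simp add: \<rho>_def tensor_relations_def free.span_zero)
      qed
    qed
  qed
  \<comment> \<open>Compression fixes every letter of the corner, so the corner relation just
    obtained is \<open>x\<close> itself.\<close>
  moreover have "\<rho> x = x"
  proof (rule free_linear_eq_on[where S = "words A m"])
    show "free_linear \<rho>" unfolding \<rho>_def by (rule free_linear_linear_extension)
    show "free_linear (\<lambda>x. x)" by (rule free_linear_id)
    show "x \<in> supported (words A m)" using x by simp
    show "\<rho> (Poly_Mapping.single w 1) = Poly_Mapping.single w 1" if "w \<in> words A m" for w
    proof -
      have "map (compress \<epsilon>) w = w"
        using that corner_closed(4)[OF idem] A by (intro map_idI) (auto simp: words_def)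
      then show ?thesis using that by (simp add: \<rho>_def words_def)
    qed
  qed
  ultimately show "x \<in> tensor_relations scale A m" by simp
qed

end

section \<open>The operators of the cyclic bicomplex\<close>

text \<open>Inner products and the cyclic product share one index, which makes \<open>b\<close> a
  single alternating sum; every index past the inner range denotes the cyclic face.\<close>

definition face :: "nat \<Rightarrow> 'a::ring list \<Rightarrow> 'a list" where
  "face i w = (if i + 1 < length w then take i w @ (w ! i * w ! (i + 1)) # drop (i + 2) w
     else (last w * hd w) # butlast (tl w))"

definition rotr :: "'a list \<Rightarrow> 'a list" where
  "rotr w = last w # butlast w"

lemma length_rotr [simp]: "w \<noteq> [] \<Longrightarrow> length (rotr w) = length w"
  by (simp add: rotr_def)

lemma length_face: "2 \<le> length w \<Longrightarrow> length (face i w) = length w - 1"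
  by (auto simp: face_def)

lemma set_face:
  assumes "2 \<le> length w" "set w \<subseteq> A" "\<And>x y. x \<in> A \<Longrightarrow> y \<in> A \<Longrightarrow> x * y \<in> A"
  shows "set (face i w) \<subseteq> A"
proof -
  have "w ! j \<in> A" if "j < length w" for j using assms(2) that by (meson nth_mem subsetD)
  moreover have "last w \<in> A" "hd w \<in> A" using assms(1,2) by (cases w; auto)+
  moreover have "set (butlast (tl w)) \<subseteq> A"
    using assms(2) by (cases w) (auto dest: in_set_butlastD)
  ultimately show ?thesis
    using assms(2,3) set_take_subset[of i w] set_drop_subset[of "i + 2" w]
    by (auto simp: face_def)
qed

text \<open>Together with \<open>face_rotr\<close> these are the identities d_0 t = d_n and d_i t =
  t d_(i-1) of a cyclic object, still without signs.\<close>

lemma face_0_rotr: "2 \<le> length w \<Longrightarrow> face 0 (rotr w) = face (length w - 1) w"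
  by (cases w) (auto simp: face_def rotr_def butlast_tl)

lemma face_rotr:
  assumes "2 \<le> length w" "0 < i" "i < length w"
  shows "face i (rotr w) = rotr (face (i - 1) w)"
proof (cases "i = length w - 1")
  \<comment> \<open>Here face \<open>i\<close> of the rotated word is the cyclic one: it multiplies
    the last two letters of \<open>w\<close>, as \<open>face (i - 1)\<close> does inside
    \<open>w\<close>.\<close>
  case True
  obtain v y where v: "w = v @ [y]" using assms(1) by (cases w rule: rev_exhaust) auto
  obtain us x where "v = us @ [x]" using assms(1) v by (cases v rule: rev_exhaust) auto
  with v True show ?thesis
    by (auto simp: face_def rotr_def nth_append butlast_append nth_Cons')
next
  case False
  then have "i + 1 < length w" using assms by simp
  moreover obtain j where "i = Suc j" using assms(2) by (cases i) auto
  ultimately show ?thesis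
    by (auto simp: face_def rotr_def take_butlast butlast_append nth_butlast drop_butlast last_drop
        simp flip: butlast_drop)
qed

lemma map_face:
  assumes "\<And>x y. f (x * y) = f x * f y" "2 \<le> length w"
  shows "map f (face i w) = face i (map f w)"
proof -
  have "w \<noteq> []" using assms(2) by auto
  then show ?thesis
    using assms by (simp add: face_def take_map drop_map map_butlast last_map hd_map map_tl)
qed

lemma map_rotr: "w \<noteq> [] \<Longrightarrow> map f (rotr w) = rotr (map f w)"
  by (simp add: rotr_def map_butlast last_map)

lemma face_Cons:
  "1 \<le> length w \<Longrightarrow> face 0 (u # w) = (u * hd w) # tl w"
  "i + 1 < length w \<Longrightarrow> face (Suc i) (u # w) = u # face i w"
  by (cases w; auto simp: face_def)+

lemma op_b'_face: "op_b' w = (\<Sum>i<length w - 1. Poly_Mapping.single (face i w) ((-1) ^ i))"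
  unfolding op_b'_def by (rule sum.cong) (auto simp: face_def)

lemma op_b_face:
  assumes "w \<noteq> []"
  shows "op_b w = (\<Sum>i<length w. Poly_Mapping.single (face i w) ((-1) ^ i))"
proof -
  obtain n where n: "length w = Suc n" using assms by (cases w) auto
  have "face n w = (last w * hd w) # butlast (tl w)" using n by (simp add: face_def)
  then show ?thesis by (simp add: op_b_def op_b'_face n)
qed

text \<open>On words of length one \<^const>\<open>op_b\<close> is the quadratic map \<open>x \<mapsto> x x\<close>, which does not descend to
  tensors; it is replaced by zero there.\<close>

definition op_b0 :: "'a::ring list \<Rightarrow> ('a list \<Rightarrow>\<^sub>0 'k::field)" where
  "op_b0 w = (if length w \<le> 1 then 0 else op_b w)"

definition lin_b :: "('a::ring list \<Rightarrow>\<^sub>0 'k::field) \<Rightarrow> ('a list \<Rightarrow>\<^sub>0 'k)" where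
  "lin_b = linear_extension op_b0"

definition lin_b' :: "('a::ring list \<Rightarrow>\<^sub>0 'k::field) \<Rightarrow> ('a list \<Rightarrow>\<^sub>0 'k)" where
  "lin_b' = linear_extension op_b'"

definition lin_t :: "('a list \<Rightarrow>\<^sub>0 'k::field) \<Rightarrow> ('a list \<Rightarrow>\<^sub>0 'k)" where
  "lin_t = linear_extension op_t"

definition lin_N :: "('a list \<Rightarrow>\<^sub>0 'k::field) \<Rightarrow> ('a list \<Rightarrow>\<^sub>0 'k)" where
  "lin_N = linear_extension op_N"

text \<open>The sign of the face in \<open>b\<close> is built in. Together with the sign of
  \<open>lin_t\<close> this makes the commutation rules of faces and rotations sign-free.\<close>

definition lin_face :: "nat \<Rightarrow> ('a::ring list \<Rightarrow>\<^sub>0 'k::field) \<Rightarrow> ('a list \<Rightarrow>\<^sub>0 'k)" where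
  "lin_face i = linear_extension (\<lambda>w. Poly_Mapping.single (face i w) ((-1) ^ i))"

definition lin_map :: "('a \<Rightarrow> 'b) \<Rightarrow> ('a list \<Rightarrow>\<^sub>0 'k::field) \<Rightarrow> ('b list \<Rightarrow>\<^sub>0 'k)" where
  "lin_map f = linear_extension (\<lambda>w. Poly_Mapping.single (map f w) 1)"

definition lin_cons :: "'a \<Rightarrow> ('a list \<Rightarrow>\<^sub>0 'k::field) \<Rightarrow> ('a list \<Rightarrow>\<^sub>0 'k)" where
  "lin_cons u = linear_extension (\<lambda>w. Poly_Mapping.single (u # w) 1)"

lemma free_linear_ops:
  "free_linear lin_b" "free_linear lin_b'" "free_linear lin_t" "free_linear lin_N"
      "free_linear (lin_face i)"
  "free_linear (lin_map f)" "free_linear (lin_cons u)"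
  unfolding lin_b_def lin_b'_def lin_t_def lin_N_def lin_face_def lin_map_def lin_cons_def
  by (rule free_linear_linear_extension)+

abbreviation of_len :: "nat \<Rightarrow> ('a list \<Rightarrow>\<^sub>0 'k::field) set" where
  "of_len m \<equiv> supported (words UNIV m)"

lemma words_UNIV [simp]: "w \<in> words UNIV m \<longleftrightarrow> length w = m"
  by (simp add: words_def)

lemma lin_t_single: "lin_t (Poly_Mapping.single w c)
    = Poly_Mapping.single (rotr w) (c * (-1) ^ (length w - 1))"
  by (simp add: lin_t_def op_t_def rotr_def)

lemma lin_face_single [simp]: "lin_face i (Poly_Mapping.single w c)
    = Poly_Mapping.single (face i w) (c * (-1) ^ i)"
  by (simp add: lin_face_def)

lemma lin_map_single [simp]: "lin_map f (Poly_Mapping.single w c) = Poly_Mapping.single (map f w) c"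
  by (simp add: lin_map_def)

lemma lin_cons_single [simp]: "lin_cons u (Poly_Mapping.single w c) = Poly_Mapping.single (u # w) c"
  by (simp add: lin_cons_def)

lemma words_rotr: "w \<in> words A m \<Longrightarrow> 0 < m \<Longrightarrow> rotr w \<in> words A m"
  by (cases w rule: rev_exhaust) (auto simp: words_def rotr_def)

lemma lin_t_supported:
  assumes "x \<in> supported (words A m)" "0 < m"
  shows "lin_t x \<in> supported (words A m)"
  by (rule free_linear_supported[OF free_linear_ops(3) _ assms(1)])
    (simp add: lin_t_single single_supported words_rotr assms(2))

lemma funpow_lin_t_supported:
  assumes "x \<in> supported (words A m)" "0 < m"
  shows "(lin_t ^^ j) x \<in> supported (words A m)"
  using assms by (induction j) (auto intro: lin_t_supported)

lemma lin_face_supported: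
  assumes "x \<in> supported (words A m)" "2 \<le> m" "\<And>x y. x \<in> A \<Longrightarrow> y \<in> A \<Longrightarrow> x * y \<in> A"
  shows "lin_face i x \<in> supported (words A (m - 1))"
  by (rule free_linear_supported[OF free_linear_ops(5) _ assms(1)])
    (use assms(2,3) set_face[of _ A] in \<open>simp add: words_def length_face single_supported\<close>)

lemma lin_b_eq:
  fixes x :: "'a::ring list \<Rightarrow>\<^sub>0 'b::field"
  assumes "x \<in> of_len m" "2 \<le> m"
  shows "lin_b x = (\<Sum>i<m. lin_face i x)"
proof (rule free_linear_eq_on[OF free_linear_ops(1) free_linear_sum _ assms(1)])
  fix w :: "'a list" assume "w \<in> words UNIV m"
  then have "length w = m" "w \<noteq> []" using assms(2) by auto
  then show "lin_b (Poly_Mapping.single w 1) = (\<Sum>i<m. lin_face i (Poly_Mapping.single w (1::'b)))"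
    using assms(2) by (simp add: lin_b_def op_b0_def op_b_face)
qed (rule free_linear_ops)

lemma lin_b'_eq:
  assumes "x \<in> of_len m"
  shows "lin_b' x = (\<Sum>i<m - 1. lin_face i x)"
  by (rule free_linear_eq_on[OF free_linear_ops(2) free_linear_sum _ assms(1)])
    (auto simp: free_linear_ops lin_b'_def op_b'_face)

lemma lin_N_eq:
  assumes "x \<in> of_len m"
  shows "lin_N x = (\<Sum>i<m. (lin_t ^^ i) x)"
  by (rule free_linear_eq_on[OF free_linear_ops(4) free_linear_sum _ assms])
    (auto simp: free_linear_ops free_linear_funpow lin_N_def op_N_def simp flip: lin_t_def)

lemma lin_b_len1: "x \<in> of_len 1 \<Longrightarrow> lin_b x = 0"
  by (rule free_linear_eq_on[OF free_linear_ops(1) _, of "\<lambda>_. 0" "words UNIV 1"])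
    (auto simp: lin_b_def op_b0_def free_linear_iff)

lemma lin_b'_len1: "x \<in> of_len 1 \<Longrightarrow> lin_b' x = 0"
  by (simp add: lin_b'_eq[of x 1])

lemma lin_b_supported:
  assumes "x \<in> supported (words A m)" "2 \<le> m" "\<And>x y. x \<in> A \<Longrightarrow> y \<in> A \<Longrightarrow> x * y \<in> A"
  shows "lin_b x \<in> supported (words A (m - 1))"
proof -
  have "x \<in> of_len m" using assms(1) by (auto simp: supported_def words_def)
  then show ?thesis
    using lin_face_supported[OF assms]
        by (auto simp: lin_b_eq[OF _ assms(2)] intro!: free.subspace_sum[OF subspace_supported])
qed

lemma lin_b'_supported:
  assumes "x \<in> supported (words A m)" "2 \<le> m" "\<And>x y. x \<in> A \<Longrightarrow> y \<in> A \<Longrightarrow> x * y \<in> A"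
  shows "lin_b' x \<in> supported (words A (m - 1))"
proof -
  have "x \<in> of_len m" using assms(1) by (auto simp: supported_def words_def)
  then show ?thesis
    using lin_face_supported[OF assms]
        by (auto simp: lin_b'_eq intro!: free.subspace_sum[OF subspace_supported])
qed

lemma lin_N_supported:
  assumes "x \<in> supported (words A m)" "0 < m"
  shows "lin_N x \<in> supported (words A m)"
proof -
  have "x \<in> of_len m" using assms(1) by (auto simp: supported_def words_def)
  then show ?thesis
    using funpow_lin_t_supported[OF assms]
        by (auto simp: lin_N_eq intro!: free.subspace_sum[OF subspace_supported])
qed

section \<open>The identities between b, b', t and N\<close>

lemma lin_t_power_of_len:
  fixes x :: "'a list \<Rightarrow>\<^sub>0 'k::field"
  assumes "x \<in> of_len m" "0 < m"
  shows "(lin_t ^^ m) x = x"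
proof (rule free_linear_eq_on[OF free_linear_funpow[OF free_linear_ops(3)] free_linear_id _
    assms(1)])
  fix w :: "'a list" assume "w \<in> words UNIV m"
  then have w: "length w = m" by simp
  have nonempty: "(rotr ^^ j) w \<noteq> []" "length ((rotr ^^ j) w) = m" for j
  proof -
    show "length ((rotr ^^ j) w) = m" for j
      using w assms(2) by (induction j) (auto simp: rotr_def)
    then show "(rotr ^^ j) w \<noteq> []" using assms(2) by fastforce
  qed
  have "(lin_t ^^ j) (Poly_Mapping.single w (1::'k))
      = Poly_Mapping.single ((rotr ^^ j) w) ((-1) ^ (j * (m - 1)))" for j
    by (induction j) (auto simp: lin_t_single nonempty power_add mult.commute)
  \<comment> \<open>\<open>rotate1\<close> undoes \<open>rotr\<close>, which reduces the claim to
    the fact that rotating a list by its own length is the identity.\<close>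
  moreover have "(rotate1 ^^ j) ((rotr ^^ j) w) = w" for j
  proof (induction j)
    case (Suc j)
    have "rotate1 (rotr v) = v" if "v \<noteq> []" for v :: "'a list" using that by (simp add: rotr_def)
    then show ?case using Suc nonempty(1)[of j] by (simp add: funpow_swap1[of rotate1])
  qed simp
  then have "rotate m ((rotr ^^ m) w) = w" by (simp add: rotate_def)
  then have "(rotr ^^ m) w = w" using nonempty(2)[of m] by (simp add: rotate_id)
  \<comment> \<open>Each of the \<open>m\<close> rotations contributes the sign (-1)^(m -
    1).\<close>
  moreover have "even (m * (m - 1))" by (cases m) auto
  ultimately show "(lin_t ^^ m) (Poly_Mapping.single w (1::'k)) = Poly_Mapping.single w 1"
    by (simp add: minus_one_power_iff)
qed

text \<open>The \<open>m\<close>-th power of \<open>lin_t\<close> is the identity, so one more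
  rotation only permutes the summands of N cyclically.\<close>

lemma lin_N_lin_t:
  assumes "x \<in> of_len m" "0 < m"
  shows "lin_N x = lin_N (lin_t x)" "lin_t (lin_N x) = lin_N x"
proof -
  have "(\<Sum>i<m. (lin_t ^^ Suc i) x) = (\<Sum>i<m. (lin_t ^^ i) x)"
  proof -
    obtain n where n: "m = Suc n" using assms(2) by (cases m) auto
    have "(\<Sum>i<m. (lin_t ^^ Suc i) x) = (\<Sum>i<n. (lin_t ^^ Suc i) x) + (lin_t ^^ m) x"
      by (simp add: n)
    also have "\<dots> = (lin_t ^^ 0) x + (\<Sum>i<n. (lin_t ^^ Suc i) x)"
      using lin_t_power_of_len[OF assms] by simp
    also have "\<dots> = (\<Sum>i<m. (lin_t ^^ i) x)" by (simp only: n sum.lessThan_Suc_shift)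
    finally show ?thesis .
  qed
  moreover have "lin_N (lin_t x) = (\<Sum>i<m. (lin_t ^^ Suc i) x)"
    using lin_N_eq[OF lin_t_supported[OF assms]] by (simp add: funpow_swap1)
  moreover have "lin_t (lin_N x) = (\<Sum>i<m. (lin_t ^^ Suc i) x)"
    using lin_N_eq[OF assms(1)] by (simp add: module_hom.sum[OF free_linear_ops(3)])
  ultimately show "lin_N x = lin_N (lin_t x)" "lin_t (lin_N x) = lin_N x"
      using lin_N_eq[OF assms(1)] by auto
qed

lemma lin_face_0_lin_t:
  fixes x :: "'a::ring list \<Rightarrow>\<^sub>0 'b::field"
  assumes "x \<in> of_len m" "2 \<le> m"
  shows "lin_face 0 (lin_t x) = lin_face (m - 1) x"
proof (rule free_linear_eq_on[OF free_linear_compose[OF free_linear_ops(3,5)] free_linear_ops(5) _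
    assms(1)])
  fix w :: "'a list" assume "w \<in> words UNIV m"
  then have w: "length w = m" by simp
  then have "face 0 (rotr w) = face (m - 1) w" using face_0_rotr assms(2) by blast
  then show "lin_face 0 (lin_t (Poly_Mapping.single w 1))
      = lin_face (m - 1) (Poly_Mapping.single w (1 :: 'b))"
    by (simp only: lin_t_single lin_face_single w) simp
qed

lemma lin_face_lin_t:
  fixes x :: "'a::ring list \<Rightarrow>\<^sub>0 'b::field"
  assumes "x \<in> of_len m" "2 \<le> m" "0 < i" "i < m"
  shows "lin_face i (lin_t x) = lin_t (lin_face (i - 1) x)"
proof (rule free_linear_eq_on[OF free_linear_compose[OF free_linear_ops(3,5)]
      free_linear_compose[OF free_linear_ops(5,3)] _ assms(1)])
  obtain j where j: "i = Suc j" using assms(3) by (cases i) auto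
  obtain n where n: "m = Suc (Suc n)" using assms(3,4) j by (cases m; cases "m - 1") auto
  fix w :: "'a list" assume "w \<in> words UNIV m"
  then have w: "length w = m" by simp
  have "face i (rotr w) = rotr (face (i - 1) w)" using face_rotr assms(2-4) w by blast
  moreover have "length (face (i - 1) w) = m - 1" using length_face[of w] w assms(2) by simp
  moreover have "(-1 :: 'b) ^ (m - 1) * (-1) ^ i = (-1) ^ (i - 1) * (-1) ^ (m - 1 - 1)"
    by (simp add: j n)
  ultimately show "lin_face i (lin_t (Poly_Mapping.single w 1))
      = lin_t (lin_face (i - 1) (Poly_Mapping.single w (1::'b)))"
    by (simp only: lin_t_single lin_face_single w mult_1)
qed

lemma lin_face_funpow_lin_t_le:
  assumes "x \<in> of_len m" "2 \<le> m" "j \<le> i" "i < m"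
  shows "lin_face i ((lin_t ^^ j) x) = (lin_t ^^ j) (lin_face (i - j) x)"
  using assms(3,4)
proof (induction j arbitrary: i)
  case (Suc j)
  have "lin_face i ((lin_t ^^ Suc j) x) = lin_t (lin_face (i - 1) ((lin_t ^^ j) x))"
    unfolding funpow.simps(2) comp_apply
    by (rule lin_face_lin_t[OF funpow_lin_t_supported[OF assms(1)] assms(2)])
        (use Suc.prems in auto)
  also have "lin_face (i - 1) ((lin_t ^^ j) x) = (lin_t ^^ j) (lin_face (i - 1 - j) x)"
    by (rule Suc.IH) (use Suc.prems in auto)
  finally show ?case by simp
qed simp

text \<open>Moving past \<open>i\<close> rotations turns face \<open>i\<close> into face 0, the rule
  d_0 t = d_(m-1) then absorbs one rotation, and face \<open>m - 1\<close> moves past the remaining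
  \<open>j - i - 1\<close>. This leaves \<open>j - 1\<close> rotations and the index
  \<open>m + i - j\<close>.\<close>

lemma lin_face_funpow_lin_t_gt:
  assumes "x \<in> of_len m" "2 \<le> m" "i < j" "j \<le> m"
  shows "lin_face i ((lin_t ^^ j) x) = (lin_t ^^ (j - 1)) (lin_face (m + i - j) x)"
proof -
  obtain l where l: "j = Suc (i + l)" using assms(3) less_iff_Suc_add by blast
  let ?y = "(lin_t ^^ l) x"
  have y: "?y \<in> of_len m" using assms by (intro funpow_lin_t_supported) auto
  have "lin_face i ((lin_t ^^ j) x) = lin_face i ((lin_t ^^ i) (lin_t ?y))"
    by (simp add: l funpow_add funpow_swap1)
  also have "\<dots> = (lin_t ^^ i) (lin_face 0 (lin_t ?y))"
    using lin_face_funpow_lin_t_le[OF lin_t_supported[OF y] assms(2), of i i] assms by simp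
  also have "\<dots> = (lin_t ^^ i) (lin_face (m - 1) ?y)" using lin_face_0_lin_t[OF y assms(2)] by simp
  also have "\<dots> = (lin_t ^^ i) ((lin_t ^^ l) (lin_face (m - 1 - l) x))"
    using lin_face_funpow_lin_t_le[OF assms(1,2), of l "m - 1"] assms l by simp
  also have "\<dots> = (lin_t ^^ (j - 1)) (lin_face (m + i - j) x)"
    by (simp add: l funpow_add)
  finally show ?thesis .
qed

text \<open>On a rotated word the faces from 1 on sum to t b', and face 0 becomes the cyclic face,
  which is the difference b - b'.\<close>

lemma lin_b_lin_t:
  assumes "x \<in> of_len m" "2 \<le> m"
  shows "lin_b (x - lin_t x) = lin_b' x - lin_t (lin_b' x)"
proof -
  obtain n where n: "m = Suc n" using assms(2) by (cases m) auto
  have "lin_b (lin_t x) = (\<Sum>i<m. lin_face i (lin_t x))"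
    using lin_b_eq[OF lin_t_supported[OF assms(1)]] assms(2) by simp
  also have "\<dots> = lin_face 0 (lin_t x) + (\<Sum>i<n. lin_face (Suc i) (lin_t x))"
    by (simp only: n sum.lessThan_Suc_shift)
  also have "(\<Sum>i<n. lin_face (Suc i) (lin_t x)) = lin_t (lin_b' x)"
    using lin_face_lin_t[OF assms] by (auto
        simp: n lin_b'_eq[OF assms(1)] module_hom.sum[OF free_linear_ops(3)] intro!: sum.cong)
  also have "lin_face 0 (lin_t x) = lin_b x - lin_b' x"
    using lin_face_0_lin_t[OF assms] by (simp add: n lin_b'_eq[OF assms(1)] lin_b_eq[OF assms])
  finally show ?thesis by (simp add: module_hom.diff[OF free_linear_ops(1)])
qed

lemma lin_b'_lin_N:
  assumes "x \<in> of_len m" "2 \<le> m"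
  shows "lin_b' (lin_N x) = lin_N (lin_b x)"
proof -
  let ?I = "{..<m - 1} \<times> {..<m}" and ?J = "{..<m - 1} \<times> {..<m}"
  have "lin_b' (lin_N x) = (\<Sum>i<m-1. \<Sum>j<m. lin_face i ((lin_t ^^ j) x))"
    using lin_b'_eq[OF lin_N_supported[OF assms(1)]] assms(2)
    by (simp add: lin_N_eq[OF assms(1)] module_hom.sum[OF free_linear_ops(5)])
  also have "\<dots> = (\<Sum>(i, j)\<in>?I. lin_face i ((lin_t ^^ j) x))" by (simp add: sum.cartesian_product)
  \<comment> \<open>The two commutation rules match the terms. Pairs with \<open>j \<le> i\<close>
    land on index sums below \<open>m - 1\<close> and the others on index sums from
    \<open>m - 1\<close> on, so the image determines which rule was used.\<close>
  also have "\<dots> = (\<Sum>(j, i)\<in>?J. (lin_t ^^ j) (lin_face i x))"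
    by (rule sum.reindex_bij_witness[where
          j = "\<lambda>(i, j). if j \<le> i then (j, i - j) else (j - 1, m + i - j)" and
          i = "\<lambda>(j, i). if i + j < m - 1 then (i + j, j) else (i + j + 1 - m, j + 1)"])
      (use assms(2) in \<open>auto simp: lin_face_funpow_lin_t_le[OF assms] lin_face_funpow_lin_t_gt[OF
          assms] split: if_splits\<close>)
  also have "\<dots> = (\<Sum>j<m-1. \<Sum>i<m. (lin_t ^^ j) (lin_face i x))" by (simp add: sum.cartesian_product)
  also have "\<dots> = lin_N (lin_b x)"
    using lin_N_eq[OF lin_b_supported[OF assms(1,2)]]
    by (simp add: lin_b_eq[OF assms] module_hom.sum[OF free_linear_funpow[OF free_linear_ops(3)]])
  finally show ?thesis .
qed

lemma lin_cons_supported: "x \<in> of_len m \<Longrightarrow> lin_cons u x \<in> of_len (Suc m)"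
  by (rule free_linear_supported[OF free_linear_ops(7), rotated]) (auto intro: single_supported)

text \<open>The contraction of the bar complex: face 0 removes the prefixed unit, and face
  \<open>i + 1\<close> is face \<open>i\<close> behind the prefix with the opposite sign. For b the
  cyclic face would multiply the last letter into the prefix.\<close>

lemma lin_b'_lin_cons:
  assumes "x \<in> of_len m" "0 < m" "\<And>y. u * y = y"
  shows "lin_b' (lin_cons u x) + lin_cons u (lin_b' x) = x"
proof -
  obtain n where n: "m = Suc n" using assms(2) by (cases m) auto
  have 0: "lin_face 0 (lin_cons u x) = x"
  proof (rule free_linear_eq_on[OF free_linear_compose[OF free_linear_ops(7,5)] free_linear_id _
      assms(1)])
    show "lin_face 0 (lin_cons u (Poly_Mapping.single w 1)) = Poly_Mapping.single w 1"
        if "w \<in> words UNIV m" for w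
      using that assms(2,3) face_Cons(1)[of w u] by (cases w) simp_all
  qed
  have S: "lin_face (Suc i) (lin_cons u x) = - lin_cons u (lin_face i x)" if "i < n" for i
  proof (rule free_linear_eq_on[OF free_linear_compose[OF free_linear_ops(7,5)]
        free_linear_uminus[OF free_linear_compose[OF free_linear_ops(5,7)]] _ assms(1)])
    show "lin_face (Suc i) (lin_cons u (Poly_Mapping.single w 1))
        = - lin_cons u (lin_face i (Poly_Mapping.single w 1))"
      if "w \<in> words UNIV m" for w
      using that \<open>i < n\<close> n face_Cons(2)[of i w u] by (simp add: single_uminus)
  qed
  have "lin_b' (lin_cons u x) = (\<Sum>i<m. lin_face i (lin_cons u x))"
    using lin_b'_eq[OF lin_cons_supported[OF assms(1)]] by simp
  also have "\<dots> = x + (\<Sum>i<n. - lin_cons u (lin_face i x))"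
    by (simp only: n sum.lessThan_Suc_shift 0) (simp add: S)
  also have "(\<Sum>i<n. - lin_cons u (lin_face i x)) = - lin_cons u (lin_b' x)"
    by (simp add: lin_b'_eq[OF assms(1)] n sum_negf module_hom.sum[OF free_linear_ops(7)])
  finally show ?thesis by simp
qed

lemma lin_map_supported:
  assumes "x \<in> supported (words A m)" "\<And>a. a \<in> A \<Longrightarrow> f a \<in> B"
  shows "lin_map f x \<in> supported (words B m)"
  by (rule free_linear_supported[OF free_linear_ops(6) _ assms(1)])
    (use assms(2) in \<open>auto simp: words_def subset_iff intro!: single_supported\<close>)

lemma lin_map_id_on:
  assumes "x \<in> supported (words A m)" "\<And>a. a \<in> A \<Longrightarrow> f a = g a"
  shows "lin_map f x = lin_map g x"
  by (rule free_linear_eq_on[OF free_linear_ops(6) free_linear_ops(6) _ assms(1)])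
    (use assms(2) in \<open>auto simp: words_def subset_iff cong: map_cong\<close>)

lemma lin_map_ident: "lin_map (\<lambda>a. a) x = x"
  by (rule free_linear_eq_on[OF free_linear_ops(6) free_linear_id, of UNIV]) (auto
      simp: supported_def)

lemma lin_map_lin_map: "lin_map f (lin_map g x) = lin_map (\<lambda>a. f (g a)) x"
  by (rule free_linear_eq_on[OF free_linear_compose[OF free_linear_ops(6,6)] free_linear_ops(6), of
      UNIV])
    (auto simp: supported_def comp_def)

lemma lin_map_lin_face:
  assumes "x \<in> of_len m" "2 \<le> m" "\<And>x y. f (x * y) = f x * f y"
  shows "lin_map f (lin_face i x) = lin_face i (lin_map f x)"
  by (rule free_linear_eq_on[OF free_linear_compose[OF free_linear_ops(5,6)]
        free_linear_compose[OF free_linear_ops(6,5)] _ assms(1)])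
    (use assms(2,3) in \<open>simp add: map_face\<close>)

lemma lin_map_lin_t:
  assumes "x \<in> of_len m" "0 < m"
  shows "lin_map f (lin_t x) = lin_t (lin_map f x)"
  by (rule free_linear_eq_on[OF free_linear_compose[OF free_linear_ops(3,6)]
        free_linear_compose[OF free_linear_ops(6,3)] _ assms(1)])
    (use assms(2) in \<open>auto simp: lin_t_single map_rotr\<close>)

lemma lin_map_ops:
  assumes x: "x \<in> of_len m" "0 < m" and f: "\<And>x y. f (x * y) = f x * f y"
  shows "lin_map f (lin_b x) = lin_b (lin_map f x)" "lin_map f (lin_b' x)
      = lin_b' (lin_map f x)" "lin_map f (lin_N x) = lin_N (lin_map f x)"
proof -
  have fx: "lin_map f x \<in> of_len m" using lin_map_supported[OF x(1)] by blast
  show "lin_map f (lin_b x) = lin_b (lin_map f x)"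
  proof (cases "2 \<le> m")
    case True
    then show ?thesis using lin_map_lin_face[OF x(1) True f]
      by (simp add: lin_b_eq[OF x(1)] lin_b_eq[OF fx] module_hom.sum[OF free_linear_ops(6)])
  next
    case False
    then have "m = 1" using x(2) by simp
    then show ?thesis using lin_b_len1[of x] lin_b_len1[of "lin_map f x"] x(1) fx
        by (simp add: free_linear_0[OF free_linear_ops(6)])
  qed
  show "lin_map f (lin_b' x) = lin_b' (lin_map f x)"
  proof (cases "2 \<le> m")
    case True
    then show ?thesis using lin_map_lin_face[OF x(1) True f]
      by (simp add: lin_b'_eq[OF x(1)] lin_b'_eq[OF fx] module_hom.sum[OF free_linear_ops(6)])
  next
    case False
    then have "m = 1" using x(2) by simp
    then show ?thesis using lin_b'_len1[of x] lin_b'_len1[of "lin_map f x"] x(1) fx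
        by (simp add: free_linear_0[OF free_linear_ops(6)])
  qed
  have "lin_map f ((lin_t ^^ i) x) = (lin_t ^^ i) (lin_map f x)" for i
    by (induction i) (auto simp: lin_map_lin_t[OF funpow_lin_t_supported[OF x] x(2)])
  then show "lin_map f (lin_N x) = lin_N (lin_map f x)"
    by (simp add: lin_N_eq[OF x(1)] lin_N_eq[OF fx] module_hom.sum[OF free_linear_ops(6)])
qed

section \<open>Descent of the operators to tensors\<close>

context unital_algebra
begin

text \<open>A face multiplies the letter by a neighbour or leaves it alone, provided that there is
  another letter. In a word of length one the cyclic face would be \<open>z * z\<close>, which is
  not linear.\<close>

lemma linear_slot_face:
  assumes "i \<le> length xs + length ys" "xs \<noteq> [] \<or> ys \<noteq> []"
  shows "linear_slot xs ys (face i)"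
proof (cases "i < length xs + length ys")
  case inner: True
  consider "i + 1 < length xs" | "i + 1 = length xs" | "i = length xs" | "length xs < i" by linarith
  then show ?thesis
  proof cases
    case 1
    show ?thesis
      by (rule linear_slotI[where us = "take i xs @ (xs ! i * xs ! (i + 1)) # drop (i + 2) xs"
          and \<psi> = "\<lambda>z. z" and vs = ys])
        (use 1 in \<open>auto simp: face_def nth_append\<close>)
  next
    case 2
    show ?thesis
      by (rule linear_slotI[where us = "take i xs" and \<psi> = "\<lambda>z. xs ! i * z" and vs = ys])
        (use 2 in \<open>auto simp: face_def nth_append algebra_simps scale_mult_right\<close>)
  next
    case 3
    then obtain y vs where "ys = y # vs" using inner by (cases ys) auto
    then show ?thesis
      by (intro linear_slotI[where us = xs and \<psi> = "\<lambda>z. z * y" and vs = vs])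
        (use 3 in \<open>auto simp: face_def nth_append algebra_simps scale_mult_left\<close>)
  next
    case 4
    then obtain j where j: "i = Suc (length xs + j)" using less_iff_Suc_add by auto
    show ?thesis
      by (rule linear_slotI[where us = xs and \<psi> = "\<lambda>z. z" and
            vs = "take j ys @ (ys ! j * ys ! (j + 1)) # drop (j + 2) ys"])
        (use inner j in \<open>auto simp: face_def nth_append numeral_3_eq_3\<close>)
  qed
next
  case False
  then have i: "i = length xs + length ys" using assms(1) by simp
  consider "xs \<noteq> []" "ys \<noteq> []" | "xs = []" "ys \<noteq> []" | "xs \<noteq> []" "ys = []" using assms(2) by blast
  then show ?thesis
  proof cases
    case 1
    then show ?thesis
      by (intro linear_slotI[where us = "(last ys * hd xs) # tl xs" and \<psi> = "\<lambda>z. z"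
          and vs = "butlast ys"])
        (auto simp: i face_def butlast_append)
  next
    case 2
    then show ?thesis
      by (intro linear_slotI[where us = "[]" and \<psi> = "\<lambda>z. last ys * z" and vs = "butlast ys"])
        (auto simp: i face_def algebra_simps scale_mult_right)
  next
    case 3
    then show ?thesis
      by (intro linear_slotI[where us = "[]" and \<psi> = "\<lambda>z. z * hd xs" and vs = "tl xs"])
        (auto simp: i face_def algebra_simps scale_mult_left butlast_append)
  qed
qed

lemma linear_slot_rotr: "linear_slot xs ys rotr"
proof (cases "ys = []")
  case True
  then show ?thesis by (intro linear_slotI[where us = "[]" and \<psi> = "\<lambda>z. z" and vs = xs]) (auto
      simp: rotr_def)
next
  case False
  then show ?thesis
    by (intro linear_slotI[where us = "last ys # xs" and \<psi> = "\<lambda>z. z" and vs = "butlast ys"])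
      (auto simp: rotr_def butlast_append)
qed

lemma descends_lin_b: "descends lin_b"
  unfolding lin_b_def
proof (rule descends_linear_extension)
  fix xs ys :: "'a list"
  show "multilinear_at xs ys (op_b0 :: _ \<Rightarrow> 'a list \<Rightarrow>\<^sub>0 'k)"
  proof (cases "xs = [] \<and> ys = []")
    case True
    then show ?thesis by (simp add: multilinear_at_def op_b0_def)
  next
    case False
    have "multilinear_at xs ys (\<lambda>w. \<Sum>i<length xs
        + Suc (length ys). Poly_Mapping.single (face i w) ((-1 :: 'k) ^ i))"
      using False by (intro multilinear_at_sum multilinear_at_single linear_slot_face) auto
    also have "?this \<longleftrightarrow> ?thesis"
      by (rule multilinear_at_cong) (use False in \<open>auto simp: op_b0_def op_b_face\<close>)
    finally show ?thesis .
  qed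
qed

lemma descends_lin_b': "descends lin_b'"
  unfolding lin_b'_def
proof (rule descends_linear_extension)
  fix xs ys :: "'a list"
  have "multilinear_at xs ys (\<lambda>w. \<Sum>i<length xs
      + length ys. Poly_Mapping.single (face i w) ((-1 :: 'k) ^ i))"
    by (intro multilinear_at_sum multilinear_at_single linear_slot_face) auto
  also have "?this \<longleftrightarrow> multilinear_at xs ys (op_b' :: _ \<Rightarrow> 'a list \<Rightarrow>\<^sub>0 'k)"
    by (rule multilinear_at_cong) (auto simp: op_b'_face)
  finally show "multilinear_at xs ys (op_b' :: _ \<Rightarrow> 'a list \<Rightarrow>\<^sub>0 'k)" .
qed

lemma descends_lin_t: "descends lin_t"
  unfolding lin_t_def
proof (rule descends_linear_extension)
  fix xs ys :: "'a list"
  have "multilinear_at xs ys (\<lambda>w. Poly_Mapping.single (rotr w) ((-1 :: 'k) ^ (length xs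
      + length ys)))"
    by (intro multilinear_at_single linear_slot_rotr)
  also have "?this \<longleftrightarrow> multilinear_at xs ys (op_t :: _ \<Rightarrow> 'a list \<Rightarrow>\<^sub>0 'k)"
    by (rule multilinear_at_cong) (auto simp: op_t_def rotr_def)
  finally show "multilinear_at xs ys (op_t :: _ \<Rightarrow> 'a list \<Rightarrow>\<^sub>0 'k)" .
qed

lemma descends_lin_N: "descends lin_N"
  unfolding lin_N_def
proof (rule descends_linear_extension)
  fix xs ys :: "'a list"
  have "multilinear_at xs ys (\<lambda>w. \<Sum>i<length xs
      + Suc (length ys). (lin_t ^^ i) (Poly_Mapping.single w (1::'k)))"
    by (intro multilinear_at_sum multilinear_at_descends[OF descends_funpow[OF descends_lin_t]]
        multilinear_at_single linear_slotI[where \<psi> = "\<lambda>z. z"]) auto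
  also have "?this \<longleftrightarrow> multilinear_at xs ys (op_N :: _ \<Rightarrow> 'a list \<Rightarrow>\<^sub>0 'k)"
    by (rule multilinear_at_cong) (auto simp: op_N_def lin_t_def)
  finally show "multilinear_at xs ys (op_N :: _ \<Rightarrow> 'a list \<Rightarrow>\<^sub>0 'k)" .
qed

lemma descends_lin_cons: "descends (lin_cons u)"
  unfolding lin_cons_def
  by (intro descends_linear_extension multilinear_at_single linear_slotI[where us = "u # _"
      and \<psi> = "\<lambda>z. z"]) auto

lemma descends_lin_map:
  assumes "\<And>x y. f (x + y) = f x + f y" "\<And>c x. f (scale c x) = scale c (f x)"
  shows "descends (lin_map f)"
  unfolding lin_map_def using assms
  by (intro descends_linear_extension multilinear_at_single linear_slotI[where us = "map f _"
      and vs = "map f _" and \<psi> = f]) auto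

lemma single_letter_sum:
  assumes "finite I"
  shows "Poly_Mapping.single ((\<Sum>i\<in>I. f i) # ys) 1 \<approx> (\<Sum>i\<in>I. Poly_Mapping.single (f i # ys) 1)"
  using assms
proof (induction I)
  case empty
  show ?case using zero_letter[of "0 # ys" 1] by (simp add: eqv_def)
next
  case (insert i I)
  have "Poly_Mapping.single ((f i + (\<Sum>i\<in>I. f i)) # ys) 1
      \<approx> Poly_Mapping.single (f i # ys) 1 + Poly_Mapping.single ((\<Sum>i\<in>I. f i) # ys) 1"
    using rels_gen_add[of "[]" "f i" _ ys] by (simp add: eqv_def diff_diff_eq)
  also have "\<dots> \<approx> Poly_Mapping.single (f i # ys) 1 + (\<Sum>i\<in>I. Poly_Mapping.single (f i # ys) 1)"
    by (intro eqv_add insert.IH) auto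
  finally show ?case using insert by simp
qed

end

section \<open>Faces of a word with an inserted letter\<close>

definition insert_at :: "nat \<Rightarrow> 'a \<Rightarrow> 'a list \<Rightarrow> 'a list" where
  "insert_at k z w = take k w @ z # drop k w"

lemma length_insert_at [simp]: "length (insert_at k z w) = Suc (length w)"
  by (simp add: insert_at_def)

lemma nth_insert_at:
  assumes "k \<le> length w" "j \<le> length w"
  shows "insert_at k z w ! j = (if j < k then w ! j else if j = k then z else w ! (j - 1))"
  using assms by (auto simp: insert_at_def nth_append nth_Cons')

lemma nth_face:
  assumes "2 \<le> length w" "i < length w" "j < length w - 1"
  shows "face i w ! j = (if i + 1 < length w
      then (if j < i then w ! j else if j = i then w ! i * w ! (i + 1) else w ! (j + 1))
      else (if j = 0 then w ! (length w - 1) * w ! 0 else w ! j))"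
proof -
  have "w \<noteq> []" using assms by auto
  then show ?thesis
    using assms by (auto simp: face_def nth_append nth_Cons' nth_butlast nth_tl last_conv_nth
        hd_conv_nth)
qed

text \<open>A face away from the inserted letter commutes with the insertion; in front of it the gap
  moves one step to the left, behind it (\<open>face_insert_at_gt\<close>) the gap stays.\<close>

lemma face_insert_at_lt:
  assumes "i + 1 < k" "k \<le> length w"
  shows "face i (insert_at k z w) = insert_at (k - 1) z (face i w)"
  by (rule nth_equalityI) (use assms in \<open>auto simp: length_face nth_face nth_insert_at\<close>)

lemma face_insert_at_gt:
  assumes "0 < k" "k < i" "i \<le> length w"
  shows "face i (insert_at k z w) = insert_at k z (face (i - 1) w)"
  by (rule nth_equalityI) (use assms in \<open>auto simp: length_face nth_face nth_insert_at\<close>)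

text \<open>Face \<open>k\<close> multiplies the inserted letter into the next one. For
  \<open>k = length w\<close> the inserted letter is last and the face is the cyclic one, hence the
  \<open>mod\<close>.\<close>

lemma face_insert_at_eq:
  assumes "0 < k" "k \<le> length w" "z * w ! (k mod length w) = w ! (k mod length w)"
  shows "face k (insert_at k z w) = w"
  by (rule nth_equalityI) (use assms in \<open>auto simp: length_face nth_face nth_insert_at\<close>)

lemma face_insert_at_pred:
  assumes "k < length w" "w ! k * z = 0"
  shows "0 \<in> set (face k (insert_at (Suc k) z w))"
proof -
  have "face k (insert_at (Suc k) z w) ! k = 0"
    using assms by (auto simp: nth_face nth_insert_at)
  moreover have "length (face k (insert_at (Suc k) z w)) = length w"
    using assms(1) by (subst length_face) auto
  ultimately show ?thesis using assms(1) by (metis nth_mem)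
qed

section \<open>Contracting the words with a cyclic defect\<close>

text \<open>Letters in \<open>E a R E b\<close> carry the label \<open>(a, b)\<close>. A word has a defect between two cyclically
  consecutive letters labelled \<open>(a, b)\<close> and \<open>(c, d)\<close> if \<open>b \<noteq> c\<close>. The operator \<open>b\<close> kills the product
  across a defect and preserves all the other defects, and inserting \<open>E c\<close> into the first defect
  contracts it.\<close>

definition peirce_word :: "('i \<Rightarrow> 'a::ring) \<Rightarrow> ('i \<times> 'i) list \<Rightarrow> 'a list \<Rightarrow> 'a list" where
  "peirce_word E L w = map2 (\<lambda>(a, b) x. E a * x * E b) L w"

definition next_source :: "('i \<times> 'i) list \<Rightarrow> nat \<Rightarrow> 'i" where
  "next_source L k = fst (L ! (k mod length L))"

text \<open>Gap \<open>k\<close> follows letter \<open>k - 1\<close>; gap \<open>length L\<close>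
  closes the circle and takes the place of gap 0. Choosing the first defect singles out one gap, and
  the choice is compatible with every face except the one across that gap.\<close>

definition first_defect :: "('i \<times> 'i) list \<Rightarrow> nat \<Rightarrow> bool" where
  "first_defect L k \<longleftrightarrow> 0 < k \<and> k \<le> length L \<and>
     (\<forall>i. i + 1 < k \<longrightarrow> snd (L ! i) = fst (L ! (i + 1))) \<and> snd (L ! (k - 1)) \<noteq> next_source L k"

text \<open>Labels (a, b) and (c, d) combine to (a, d), also across a defect, where the product of
  the letters is zero and any label fits.\<close>

definition label_face :: "nat \<Rightarrow> ('i \<times> 'i) list \<Rightarrow> ('i \<times> 'i) list" where
  "label_face i L = (if i + 1 < length L then take i L @ (fst (L ! i), snd (L ! (i + 1)))
      # drop (i + 2) L
     else (fst (last L), snd (hd L)) # butlast (tl L))"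

lemma length_peirce_word: "length L = length w \<Longrightarrow> length (peirce_word E L w) = length w"
  by (simp add: peirce_word_def)

lemma nth_peirce_word: "length L = length w \<Longrightarrow> i < length w
    \<Longrightarrow> peirce_word E L w ! i = E (fst (L ! i)) * w ! i * E (snd (L ! i))"
  by (simp add: peirce_word_def split_beta)

lemma length_label_face: "2 \<le> length L \<Longrightarrow> length (label_face i L) = length L - 1"
  by (auto simp: label_face_def)

lemma nth_label_face:
  assumes "2 \<le> length L" "i < length L" "j < length L - 1"
  shows "label_face i L ! j = (if i + 1 < length L
      then (if j < i then L ! j else
          if j = i then (fst (L ! i), snd (L ! (i + 1))) else L ! (j + 1))
      else (if j = 0 then (fst (L ! (length L - 1)), snd (L ! 0)) else L ! j))"
proof -
  have "L \<noteq> []" using assms by auto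
  then show ?thesis
    using assms by (auto simp: label_face_def nth_append nth_Cons' nth_butlast nth_tl last_conv_nth
        hd_conv_nth)
qed

lemma first_defect_unique:
  assumes "first_defect L k" "first_defect L k'"
  shows "k = k'"
proof -
  have False if "first_defect L k" "first_defect L k'" "k < k'" for k k'
  proof -
    have "k - 1 + 1 < k'" "k mod length L = k" "k - 1 + 1 = k"
      using that by (auto simp: first_defect_def)
    then show False using that unfolding first_defect_def next_source_def by metis
  qed
  then show ?thesis using assms by (metis nat_neq_iff)
qed

text \<open>Merging two letters in front of the gap keeps both sides of the gap and shortens the
  matching chain before it by one. If the gap closes the circle, its far side is the source of
  letter 0, which a merge at \<open>i = 0\<close> retains.\<close>

lemma first_defect_face_lt:
  assumes "first_defect L k" "i + 1 < k"
  shows "first_defect (label_face i L) (k - 1)" "next_source (label_face i L) (k - 1)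
      = next_source L k"
proof -
  have m: "2 \<le> length L" "i < length L" "k \<le> length L"
    using assms by (auto simp: first_defect_def)
  have l: "length (label_face i L) = length L - 1" using length_label_face[OF m(1)] .
  have nth: "label_face i L ! j = (if j < i then L ! j else if j
      = i then (fst (L ! i), snd (L ! (i + 1))) else L ! (j + 1))"
    if "j < length L - 1" for j
    using nth_label_face[OF m(1,2) that] assms(2) m(3) by simp
  show ns: "next_source (label_face i L) (k - 1) = next_source L k"
  proof (cases "k = length L")
    case True
    then show ?thesis using nth[of 0] m assms(2) by (auto simp: next_source_def l)
  next
    case False
    then have "k < length L" using m(3) by simp
    then show ?thesis using nth[of "k - 1"] assms(2) by (auto simp: next_source_def l)
  qed
  have "snd (label_face i L ! j) = fst (label_face i L ! (j + 1))" if "j + 1 < k - 1" for j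
  proof -
    have "snd (L ! j) = fst (L ! (j + 1))" "snd (L ! (j + 1)) = fst (L ! (j + 2))"
      using assms(1) that by (auto simp: first_defect_def)
    then show ?thesis using nth[of j] nth[of "j + 1"] that m(3) by auto
  qed
  moreover have "snd (label_face i L ! (k - 1 - 1)) = snd (L ! (k - 1))"
    using nth[of "k - 2"] assms(2) m(3) by (auto simp: numeral_2_eq_2 Suc_diff_Suc)
  ultimately show "first_defect (label_face i L) (k - 1)"
    using assms ns m by (auto simp: first_defect_def l)
qed

text \<open>The faces behind the gap include the cyclic one, which changes letter 0 only in its
  source; the chain of matches up to \<open>k\<close> does not involve that source. If
  \<open>k = length L - 1\<close>, the cyclic face turns gap \<open>k\<close> into the closing
  gap.\<close>

lemma first_defect_face_ge:
  assumes "first_defect L k" "k \<le> i" "i < length L"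
  shows "first_defect (label_face i L) k" "next_source (label_face i L) k = next_source L k"
proof -
  have k: "0 < k" using assms by (auto simp: first_defect_def)
  have m: "2 \<le> length L" "k < length L"
    using assms k by auto
  have l: "length (label_face i L) = length L - 1" using length_label_face[OF m(1)] .
  note nth = nth_label_face[OF m(1) assms(3)]
  show ns: "next_source (label_face i L) k = next_source L k"
  proof (cases "k = length L - 1")
    case True
    then show ?thesis using nth[of 0] m assms(2,3) by (auto simp: next_source_def l)
  next
    case False
    then have "k < length L - 1" using m by simp
    then show ?thesis using nth[of k] assms(2,3) k by (auto simp: next_source_def l)
  qed
  have snd: "snd (label_face i L ! j) = snd (L ! j)" if "j < k" for j
    using nth[of j] that assms(2,3) by auto
  have "fst (label_face i L ! (j + 1)) = fst (L ! (j + 1))" if "j + 1 < k" for j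
    using nth[of "j + 1"] that assms(2,3) by auto
  then show "first_defect (label_face i L) k"
    using assms ns m k snd by (auto simp: first_defect_def l)
qed

text \<open>Without a defect, sources and targets match around the whole circle while
  \<open>\<rho>\<close> never decreases. Returning to the start forces equality at every letter, so
  all labels are one and the same (a, a).\<close>

lemma first_defect_exists:
  fixes \<rho> :: "'i \<Rightarrow> nat"
  assumes "L \<noteq> []" "\<And>a b. (a, b) \<in> set L \<Longrightarrow> a = b \<or> \<rho> a < \<rho> b" "\<And>a. \<not> set L \<subseteq> {(a, a)}"
  shows "\<exists>k. first_defect L k"
proof (rule ccontr)
  assume none: "\<nexists>k. first_defect L k"
  let ?m = "length L"
  \<comment> \<open>Strong induction: if no earlier gap is a defect, a defect at \<open>k\<close>
    would be the first one.\<close>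
  have nodef: "snd (L ! (k - 1)) = next_source L k" if "0 < k" "k \<le> ?m" for k
    using that
  proof (induction k rule: less_induct)
    case (less k)
    have "snd (L ! i) = fst (L ! (i + 1))" if "i + 1 < k" for i
      using less.IH[of "i + 1"] that less.prems by (simp add: next_source_def)
    then show ?case using none less.prems by (auto simp: first_defect_def)
  qed
  have le: "\<rho> (fst (L ! i)) \<le> \<rho> (snd (L ! i))" if "i < ?m" for i
    using assms(2)[of "fst (L ! i)" "snd (L ! i)"] nth_mem[OF that] by auto
  have step: "snd (L ! i) = fst (L ! Suc i)" if "Suc i < ?m" for i
    using nodef[of "Suc i"] that by (simp add: next_source_def)
  have up: "\<rho> (fst (L ! 0)) \<le> \<rho> (fst (L ! i))" if "i < ?m" for i
    using that
  proof (induction i)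
    case (Suc i)
    then show ?case using le[of i] step[of i] by simp
  qed simp
  \<comment> \<open>Induction backwards from the last letter; the closing gap supplies the
    start.\<close>
  have down: "\<rho> (snd (L ! (?m - 1 - i))) \<le> \<rho> (fst (L ! 0))" if "i < ?m" for i
    using that
  proof (induction i)
    case 0
    then show ?case using nodef[of ?m] by (simp add: next_source_def)
  next
    case (Suc i)
    have "snd (L ! (?m - 1 - Suc i)) = fst (L ! (?m - 1 - i))"
      using step[of "?m - 1 - Suc i"] Suc.prems by (simp add: Suc_diff_Suc)
    moreover have "?m - 1 - i < ?m" using Suc.prems by simp
    ultimately show ?case using Suc le by fastforce
  qed
  have eq: "fst (L ! i) = snd (L ! i)" if "i < ?m" for i
  proof -
    have "\<rho> (snd (L ! i)) \<le> \<rho> (fst (L ! 0))" using down[of "?m - 1 - i"] that by simp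
    then show ?thesis
      using assms(2)[of "fst (L ! i)" "snd (L ! i)"] nth_mem[OF that] up[OF that] by auto
  qed
  have "fst (L ! i) = fst (L ! 0)" if "i < ?m" for i
    using that
  proof (induction i)
    case (Suc i)
    then show ?case using step[of i] eq[of i] by simp
  qed simp
  with eq have "set L \<subseteq> {(fst (L ! 0), fst (L ! 0))}"
    by (force simp: in_set_conv_nth)
  with assms(3) show False by blast
qed

section \<open>Peirce decomposition of words and the homotopy for b\<close>

locale peirce = unital_algebra scale unit
  for scale :: "'k::field \<Rightarrow> 'a::ring \<Rightarrow> 'a" and unit +
  fixes E :: "'i::finite \<Rightarrow> 'a"
  assumes E_mult: "E i * E j = (if i = j then E i else 0)"
    and E_sum: "(\<Sum>i\<in>UNIV. E i) = unit"
begin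

definition labels :: "nat \<Rightarrow> ('i \<times> 'i) list set" where
  "labels m = {L. length L = m}"

lemma finite_labels: "finite (labels m)"
  using finite_lists_length_eq[of "UNIV :: ('i \<times> 'i) set" m] by (simp add: labels_def)

text \<open>A zero letter fits every label, so \<open>L\<close> need not be determined by
  \<open>w\<close>; a word with such a letter vanishes modulo \<open>rels\<close> anyway.\<close>

definition homogeneous :: "('i \<times> 'i) list \<Rightarrow> 'a list \<Rightarrow> bool" where
  "homogeneous L w \<longleftrightarrow> length L = length w
      \<and> (\<forall>i<length w. E (fst (L ! i)) * w ! i = w ! i \<and> w ! i * E (snd (L ! i)) = w ! i)"

lemma E_idem: "E a * (E a * x) = E a * x" "x * E a * E a = x * E a"
  by (simp_all add: E_mult mult.assoc[symmetric]) (simp add: mult.assoc E_mult)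

lemma homogeneous_peirce_word: "length L = length w \<Longrightarrow> homogeneous L (peirce_word E L w)"
  by (auto simp: homogeneous_def length_peirce_word nth_peirce_word E_idem mult.assoc E_mult)

lemma homogeneous_peirce_word_same: "homogeneous L w \<Longrightarrow> peirce_word E L w = w"
  by (rule nth_equalityI) (auto simp: homogeneous_def length_peirce_word nth_peirce_word)

text \<open>Two different label words differ at some letter, and orthogonality of the
  \<open>E i\<close> kills that letter from the left or from the right.\<close>

lemma peirce_word_other:
  assumes "homogeneous L w" "length L' = length w" "L' \<noteq> L"
  shows "0 \<in> set (peirce_word E L' w)"
proof -
  obtain i where i: "i < length w" "L' ! i \<noteq> L ! i"
    using assms nth_equalityI[of L' L] by (auto simp: homogeneous_def)
  have w: "w ! i = E (fst (L ! i)) * w ! i" "w ! i = w ! i * E (snd (L ! i))"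
    using assms(1) i by (auto simp: homogeneous_def)
  have "E (fst (L' ! i)) * w ! i * E (snd (L' ! i)) = 0"
  proof (cases "fst (L' ! i) = fst (L ! i)")
    case True
    then have "snd (L ! i) \<noteq> snd (L' ! i)" using i(2) by (auto simp: prod_eq_iff)
    then have "w ! i * E (snd (L' ! i)) = 0"
      by (subst w(2)) (simp add: mult.assoc E_mult)
    then show ?thesis by (simp add: mult.assoc)
  next
    case False
    then have "E (fst (L' ! i)) * w ! i = 0"
      by (subst w(1)) (simp add: mult.assoc[symmetric] E_mult)
    then show ?thesis by simp
  qed
  then show ?thesis
    using nth_mem[of i "peirce_word E L' w"] i assms(2)
        by (simp add: length_peirce_word nth_peirce_word)
qed

lemma homogeneous_face:
  assumes "homogeneous L w" "2 \<le> length w" "i < length w"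
  shows "homogeneous (label_face i L) (face i w)"
proof -
  have L: "length L = length w" using assms by (simp add: homogeneous_def)
  have "E (fst (label_face i L ! j)) * face i w ! j = face i w ! j \<and>
      face i w ! j * E (snd (label_face i L ! j)) = face i w ! j" if "j < length w - 1" for j
  proof -
    have h: "E (fst (L ! j)) * w ! j = w ! j" "w ! j * E (snd (L ! j)) = w ! j" if "j < length w"
        for j
      using assms(1) that by (auto simp: homogeneous_def)
    have h': "E (fst (L ! j)) * (w ! j * x) = w ! j * x" "x * w ! j * E (snd (L ! j)) = x * w ! j"
      if "j < length w" for j x
      using h[OF that] by (simp_all add: mult.assoc) (simp add: mult.assoc[symmetric])
    have "w \<noteq> []" using assms by auto
    then show ?thesis
      using nth_label_face[of L i j] nth_face[of w i j] assms(2,3) that L h h'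
      by (auto split: if_splits)
  qed
  then show ?thesis using assms L by (simp add: homogeneous_def length_face length_label_face)
qed

lemma peirce_word_append:
  "length L1 = length w1 \<Longrightarrow> peirce_word E (L1 @ L2) (w1 @ w2)
      = peirce_word E L1 w1 @ peirce_word E L2 w2"
  by (simp add: peirce_word_def)

lemma linear_slot_peirce_word:
  assumes "length L = length xs + Suc (length ys)"
  obtains us vs a b where "\<And>z. peirce_word E L (xs @ z # ys) = us @ (E a * z * E b) # vs"
    "length us = length xs" "length vs = length ys"
proof -
  define L1 where "L1 = take (length xs) L"
  obtain a b L2 where ab: "drop (length xs) L = (a, b) # L2"
    using assms by (cases "drop (length xs) L") auto
  have L: "L = L1 @ (a, b) # L2" using ab append_take_drop_id[of "length xs" L]
      by (simp add: L1_def)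
  have "length L1 = length xs" using assms by (simp add: L1_def)
  moreover from this have "length L2 = length ys" using assms L by simp
  ultimately show thesis
    by (intro that[of "peirce_word E L1 xs" a b "peirce_word E L2 ys"])
        (simp_all add: L peirce_word_append length_peirce_word, simp_all add: peirce_word_def)
qed

lemma multilinear_at_insert_at_peirce_word:
  assumes "length L = length xs + Suc (length ys)"
  shows "multilinear_at xs ys (\<lambda>w. Poly_Mapping.single (insert_at k y (peirce_word E L w)) c)"
proof (rule multilinear_at_single)
  obtain us vs a b where uv: "\<And>z. peirce_word E L (xs @ z # ys) = us @ (E a * z * E b) # vs"
    using linear_slot_peirce_word[OF assms] by metis
  have lin: "E a * (x + x') * E b = E a * x * E b + E a * x' * E b"
    "E a * scale d x * E b = scale d (E a * x * E b)" for x x' d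
    by (simp_all add: distrib_left distrib_right scale_mult_left scale_mult_right)
  show "linear_slot xs ys (\<lambda>w. insert_at k y (peirce_word E L w))"
  proof (cases "k \<le> length us")
    case True
    then show ?thesis
      by (intro linear_slotI[where us = "take k us @ y # drop k us" and \<psi> = "\<lambda>z. E a * z * E b"
          and vs = vs] lin)
        (simp add: insert_at_def uv)
  next
    case False
    then have "k = Suc (length us + (k - Suc (length us)))" by simp
    then obtain j where "k = Suc (length us + j)" by blast
    then show ?thesis
      by (intro linear_slotI[where us = us and \<psi> = "\<lambda>z. E a * z * E b"
          and vs = "take j vs @ y # drop j vs"])
        (simp_all add: insert_at_def uv lin)
  qed
qed

definition defects :: "nat \<Rightarrow> (('i \<times> 'i) list \<times> nat) set" where
  "defects m = {(L, k). L \<in> labels m \<and> first_defect L k}"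

lemma finite_defects: "finite (defects m)"
proof (rule finite_subset)
  show "defects m \<subseteq> labels m \<times> {..m}" by (auto simp: defects_def first_defect_def labels_def)
qed (simp add: finite_labels)

text \<open>Summing over all label words, instead of prescribing values on homogeneous words only,
  is what makes the map multilinear. The sign (-1)^k gives coefficient 1 to the face that removes
  the inserted letter again.\<close>

definition lin_insert :: "('a list \<Rightarrow>\<^sub>0 'k) \<Rightarrow> ('a list \<Rightarrow>\<^sub>0 'k)" where
  "lin_insert = linear_extension (\<lambda>w. \<Sum>(L, k)\<in>defects (length w).
     Poly_Mapping.single (insert_at k (E (next_source L k)) (peirce_word E L w)) ((-1) ^ k))"

lemma descends_lin_insert: "descends lin_insert"
  unfolding lin_insert_def
proof (rule descends_linear_extension)
  fix xs ys :: "'a list"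
  have "multilinear_at xs ys (\<lambda>w. \<Sum>p\<in>defects (length xs + Suc (length ys)).
     Poly_Mapping.single (insert_at (snd p) (E (next_source (fst p) (snd p))) (peirce_word E (fst p)
         w)) ((-1 :: 'k) ^ snd p))"
    by (intro multilinear_at_sum multilinear_at_insert_at_peirce_word) (auto
        simp: defects_def labels_def)
  also have "?this \<longleftrightarrow> multilinear_at xs ys (\<lambda>w. \<Sum>(L, k)\<in>defects (length w).
     Poly_Mapping.single (insert_at k (E (next_source L k)) (peirce_word E L w)) ((-1 :: 'k) ^ k))"
    by (rule multilinear_at_cong) (auto simp: split_beta)
  finally show "multilinear_at xs ys (\<lambda>w. \<Sum>(L, k)\<in>defects (length w).
     Poly_Mapping.single (insert_at k (E (next_source L k)) (peirce_word E L w))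
         ((-1 :: 'k) ^ k))" .
qed

lemma set_insert_at: "set (insert_at k z w) = insert z (set w)"
  using append_take_drop_id[of k w] set_append[of "take k w" "drop k w"]
      by (auto simp: insert_at_def)

lemma lin_insert_homogeneous:
  assumes "homogeneous L w" "first_defect L k"
  shows "lin_insert (Poly_Mapping.single w c)
      \<approx> Poly_Mapping.single (insert_at k (E (next_source L k)) w) (c * (-1) ^ k)"
proof -
  let ?f = "\<lambda>p. Poly_Mapping.single (insert_at (snd p) (E (next_source (fst p) (snd p)))
      (peirce_word E (fst p) w)) ((-1 :: 'k) ^ snd p)"
  have mem: "(L, k) \<in> defects (length w)" using assms
      by (auto simp: defects_def labels_def homogeneous_def)
  \<comment> \<open>Another pair with the same label word is excluded by uniqueness of the first
    defect; a different label word gives a zero letter.\<close>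
  have "?f p \<in> rels" if "p \<in> defects (length w) - {(L, k)}" for p
  proof -
    have "length (fst p) = length w" "fst p \<noteq> L"
      using that first_defect_unique[OF assms(2)] by (auto simp: defects_def labels_def)
    then show ?thesis using peirce_word_other[OF assms(1)]
        by (intro zero_letter) (auto simp: set_insert_at)
  qed
  then have "sum ?f (defects (length w) - {(L, k)}) \<in> rels" by (rule rels_sum)
  then have "sum ?f (defects (length w)) \<approx> ?f (L, k)"
    by (simp add: eqv_def sum.remove[OF finite_defects mem])
  then have "free_scale c (sum ?f (defects (length w))) \<approx> free_scale c (?f (L, k))"
      by (rule eqv_scale)
  then show ?thesis by (simp add: lin_insert_def split_beta homogeneous_peirce_word_same[OF
      assms(1)])
qed

text \<open>Every letter is written as \<open>unit * x * unit\<close> with \<open>unit\<close> the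
  sum of the \<open>E i\<close>, and the word is expanded one letter at a time.\<close>

lemma word_decomp: "Poly_Mapping.single w 1
    \<approx> (\<Sum>L\<in>labels (length w). Poly_Mapping.single (peirce_word E L w) 1)"
proof (induction w)
  case Nil
  have "labels (length ([] :: 'a list)) = {[]}" by (auto simp: labels_def)
  then show ?case by (simp add: peirce_word_def)
next
  case (Cons x w)
  have x: "x = (\<Sum>(a, b)\<in>UNIV. E a * x * E b)"
  proof -
    have "x = unit * x * unit" by (simp add: unit_left unit_right)
    also have "\<dots> = (\<Sum>a\<in>UNIV. \<Sum>b\<in>UNIV. E a * x * E b)"
      by (simp add: sum_distrib_left sum_distrib_right flip: E_sum) (rule sum.swap)
    finally show ?thesis by (simp add: sum.cartesian_product UNIV_Times_UNIV)
  qed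
  have bij: "labels (Suc (length w)) = (\<lambda>(l, L). l # L) ` (UNIV \<times> labels (length w))"
    by (auto simp: labels_def length_Suc_conv image_iff)
  have "Poly_Mapping.single (x # w) 1 = lin_cons x (Poly_Mapping.single w 1)" by simp
  also have "\<dots> \<approx> lin_cons x (\<Sum>L\<in>labels (length w). Poly_Mapping.single (peirce_word E L w) 1)"
    by (rule descends_eqv[OF descends_lin_cons Cons.IH])
  also have "\<dots> = (\<Sum>L\<in>labels (length w). Poly_Mapping.single (x # peirce_word E L w) 1)"
    by (simp add: descends_simps[OF descends_lin_cons])
  also have "\<dots> \<approx> (\<Sum>L\<in>labels (length w). \<Sum>l\<in>UNIV. Poly_Mapping.single ((E (fst l) * x * E (snd l))
      # peirce_word E L w) 1)"
    by (rule eqv_sum, subst (1) x) (simp add: split_beta single_letter_sum[OF finite])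
  also have "\<dots> = (\<Sum>l\<in>UNIV. \<Sum>L\<in>labels (length w). Poly_Mapping.single ((E (fst l) * x * E (snd l))
      # peirce_word E L w) 1)"
    by (rule sum.swap)
  also have "\<dots> = (\<Sum>p\<in>UNIV \<times> labels (length w). Poly_Mapping.single (peirce_word E (fst p # snd p) (x
      # w)) 1)"
    by (simp add: sum.cartesian_product split_beta peirce_word_def)
  also have "\<dots> = (\<Sum>L\<in>labels (length (x # w)). Poly_Mapping.single (peirce_word E L (x # w)) 1)"
    unfolding length_Cons bij by (subst sum.reindex) (auto simp: inj_on_def split_beta)
  finally show ?case .
qed

definition anticomm :: "('a list \<Rightarrow>\<^sub>0 'k) \<Rightarrow> ('a list \<Rightarrow>\<^sub>0 'k)" where
  "anticomm x = lin_b (lin_insert x) + lin_insert (lin_b x)"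

lemma descends_anticomm: "descends anticomm"
  unfolding anticomm_def[abs_def] by
      (intro descends_add descends_compose[OF descends_lin_insert descends_lin_b]
          descends_compose[OF descends_lin_b descends_lin_insert])

text \<open>Write h for the insertion at the first defect. Away from the gap the terms of b h and h
  b cancel in pairs: \<open>\<alpha>\<close> collects the faces in front of the gap,
  \<open>\<beta>\<close> those behind it. Face \<open>k\<close> of the inserted word gives back
  \<open>w\<close>, while the face joining the left neighbour to the inserted letter and the face of
  \<open>w\<close> across the defect vanish.\<close>

lemma anticomm_homogeneous:
  assumes w: "homogeneous L w" and k: "first_defect L k"
  shows "anticomm (Poly_Mapping.single w 1) \<approx> Poly_Mapping.single w 1"
proof -
  define m where "m = length w"
  define z where "z = E (next_source L k)"
  obtain j where j: "k = Suc j" using k by (cases k) (auto simp: first_defect_def)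
  have L: "length L = m" and km: "k \<le> m" "j < m" using w k j
      by (auto simp: homogeneous_def m_def first_defect_def)
  have wz: "w ! j * z = 0"
  proof -
    have "w ! j * E (snd (L ! j)) = w ! j" using w km by (simp add: homogeneous_def m_def)
    then have "w ! j * z = w ! j * (E (snd (L ! j)) * z)" by (metis mult.assoc)
    then show ?thesis using k j by (simp add: z_def E_mult first_defect_def)
  qed
  have zw: "z * w ! (k mod m) = w ! (k mod m)"
  proof -
    have "k mod m < m" using km by (intro mod_less_divisor) simp
    then show ?thesis using w L by (simp add: homogeneous_def m_def z_def next_source_def)
  qed
  define \<alpha> where "\<alpha> i = Poly_Mapping.single (insert_at (k - 1) z (face i w)) ((-1 :: 'k) ^ (k + i))"
      for i
  define \<beta> where "\<beta> i = Poly_Mapping.single (insert_at k z (face i w)) ((-1 :: 'k) ^ (k + i))" for i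
  let ?W = "insert_at k z w"
  define f where "f i = Poly_Mapping.single (face i ?W) ((-1 :: 'k) ^ (k + i))" for i
  have split: "(\<Sum>i<n. g i) = (\<Sum>i<j. g i) + g j + (\<Sum>i=k..<n. g i)"
    if "j < n" for n and g :: "nat \<Rightarrow> 'a list \<Rightarrow>\<^sub>0 'k"
    using that sum.atLeastLessThan_concat[of 0 j n g] sum.atLeast_Suc_lessThan[of j n g]
    by (simp add: j lessThan_atLeast0 add.assoc)
  have fsum: "(\<Sum>i<Suc m. f i) = (\<Sum>i<j. f i) + f j + (f k + (\<Sum>i=k..<m. f (Suc i)))"
  proof -
    have "(\<Sum>i=k..<Suc m. f i) = f k + (\<Sum>i=Suc k..<Suc m. f i)"
      by (rule sum.atLeast_Suc_lessThan) (use km in simp)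
    moreover have "(\<Sum>i<Suc m. f i) = (\<Sum>i<j. f i) + f j + (\<Sum>i=k..<Suc m. f i)"
      by (rule split) (use km in simp)
    ultimately show ?thesis by (simp only: sum.shift_bounds_Suc_ivl)
  qed
  have "lin_b (lin_insert (Poly_Mapping.single w 1)) \<approx> lin_b (Poly_Mapping.single ?W ((-1) ^ k))"
    using lin_insert_homogeneous[OF w k, of 1]
        by (intro descends_eqv[OF descends_lin_b]) (simp add: z_def)
  also have "\<dots> = (\<Sum>i<Suc m. f i)"
    using lin_b_eq[of "Poly_Mapping.single ?W ((-1) ^ k)" "Suc m"] km
    by (simp add: single_supported m_def f_def power_add)
  also have "\<dots> = (\<Sum>i<j. f i) + f j + (f k + (\<Sum>i=k..<m. f (Suc i)))"
    by (rule fsum)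
  also have "\<dots> \<approx> (\<Sum>i<j. \<alpha> i) + 0 + (Poly_Mapping.single w 1 + (\<Sum>i=k..<m. - \<beta> i))"
  proof (intro eqv_add eqv_sum)
    show "f i \<approx> \<alpha> i" if "i \<in> {..<j}" for i
      using face_insert_at_lt[of i k w z] that j km by (simp add: f_def \<alpha>_def m_def)
    show "f j \<approx> 0"
      unfolding eqv_0_iff f_def j using face_insert_at_pred[of j w z] wz km
          by (intro zero_letter) (simp add: m_def)
    show "f k \<approx> Poly_Mapping.single w 1"
      using face_insert_at_eq[of k w z] zw km j by (simp add: f_def m_def flip: power_add mult_2)
    show "f (Suc i) \<approx> - \<beta> i" if "i \<in> {k..<m}" for i
      using face_insert_at_gt[of k "Suc i" w z] that j
          by (simp add: f_def \<beta>_def m_def single_uminus)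
  qed
  finally have bs1: "lin_b (lin_insert (Poly_Mapping.single w 1)) \<approx>
    (\<Sum>i<j. \<alpha> i) + (Poly_Mapping.single w 1 - (\<Sum>i=k..<m. \<beta> i))" by (simp add: sum_negf)
  have bs2: "lin_insert (lin_b (Poly_Mapping.single w 1)) \<approx> - (\<Sum>i<j. \<alpha> i) + (\<Sum>i=k..<m. \<beta> i)"
  proof (cases "2 \<le> m")
    \<comment> \<open>A word of length one has its only gap at \<open>k = 1\<close>;
      \<open>lin_b\<close> is zero on it and both sums are empty.\<close>
    case False
    then have "m = 1" "j = 0" "k = 1" using km j by auto
    then show ?thesis
      using lin_b_len1[of "Poly_Mapping.single w (1::'k)"]
          by (simp add: single_supported m_def descends_simps(4)[OF descends_lin_insert])
  next
    case True
    define g where "g i = lin_insert (Poly_Mapping.single (face i w) ((-1 :: 'k) ^ i))" for i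
    have "lin_insert (lin_b (Poly_Mapping.single w 1)) = (\<Sum>i<m. g i)"
      using lin_b_eq[of "Poly_Mapping.single w (1::'k)" m] True
      by (simp add: single_supported m_def g_def descends_simps[OF descends_lin_insert])
    also have "\<dots> = (\<Sum>i<j. g i) + g j + (\<Sum>i=k..<m. g i)" by (rule split[OF km(2)])
    also have "\<dots> \<approx> (\<Sum>i<j. - \<alpha> i) + 0 + (\<Sum>i=k..<m. \<beta> i)"
    proof (intro eqv_add eqv_sum)
      fix i assume "i \<in> {..<j}"
      then have i: "i + 1 < k" "i < m" using j km by auto
      show "g i \<approx> - \<alpha> i"
        using lin_insert_homogeneous[OF homogeneous_face[OF w] first_defect_face_lt(1)[OF k i(1)],
            of "(-1) ^ i"] True i(2)
          first_defect_face_lt(2)[OF k i(1)]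
        by (simp add: g_def \<alpha>_def m_def z_def j single_uminus power_add mult.commute)
    next
      \<comment> \<open>The product across the defect: \<open>z\<close> is a left unit for the
        letter after the gap and is annihilated by the letter before it. For \<open>k = m\<close>
        this is the cyclic face.\<close>
      have "0 \<in> set (face j w)"
      proof (cases "k = m")
        case True
        then have "face j w = (w ! j * w ! 0) # butlast (tl w)"
          using j \<open>2 \<le> m\<close> by (cases w) (auto simp: face_def m_def last_conv_nth)
        moreover have "w ! j * w ! 0 = 0"
          using wz zw True by (metis mod_self mult.assoc mult_zero_left)
        ultimately show ?thesis by simp
      next
        case False
        then have "k < m" using km by simp
        then have "w ! j * w ! k = 0" using wz zw by (metis mod_less mult.assoc mult_zero_left)
        then show ?thesis using \<open>k < m\<close> by (simp add: face_def m_def j)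
      qed
      then show "g j \<approx> 0"
        unfolding g_def eqv_0_iff by (intro descends_rels[OF descends_lin_insert] zero_letter)
    next
      fix i assume "i \<in> {k..<m}"
      then have i: "k \<le> i" "i < m" "i < length L" using L by auto
      show "g i \<approx> \<beta> i"
        using lin_insert_homogeneous[OF homogeneous_face[OF w] first_defect_face_ge(1)[OF k i(1,3)],
            of "(-1) ^ i"] True i(2)
          first_defect_face_ge(2)[OF k i(1,3)]
        by (simp add: g_def \<beta>_def m_def z_def power_add mult.commute)
    qed
    finally show ?thesis by (simp add: sum_negf)
  qed
  show ?thesis using eqv_add[OF bs1 bs2] by (simp add: anticomm_def)
qed

end

section \<open>The part of the bicomplex outside the two corners\<close>

definition vert :: "nat \<Rightarrow> ('a::ring list \<Rightarrow>\<^sub>0 'k::field) \<Rightarrow> ('a list \<Rightarrow>\<^sub>0 'k)" where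
  "vert p x = (if even p then lin_b x else - lin_b' x)"

definition horiz :: "nat \<Rightarrow> ('a list \<Rightarrow>\<^sub>0 'k::field) \<Rightarrow> ('a list \<Rightarrow>\<^sub>0 'k)" where
  "horiz p x = (if even p then x - lin_t x else lin_N x)"

lemma free_linear_vert: "free_linear (vert p)"
  using free_linear_ops(1) free_linear_uminus[OF free_linear_ops(2)]
  by (cases "even p") (simp_all add: vert_def[abs_def])

lemma free_linear_horiz: "free_linear (horiz p)"
  using free_linear_minus[OF free_linear_id free_linear_ops(3)] free_linear_ops(4)
  by (cases "even p") (simp_all add: horiz_def[abs_def])

lemma vert_supported:
  assumes "x \<in> supported (words A m)" "2 \<le> m" "\<And>x y. x \<in> A \<Longrightarrow> y \<in> A \<Longrightarrow> x * y \<in> A"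
  shows "vert p x \<in> supported (words A (m - 1))"
  using lin_b_supported[OF assms] lin_b'_supported[OF assms] by (simp add: vert_def supported_neg)

lemma horiz_supported:
  assumes "x \<in> supported (words A m)" "0 < m"
  shows "horiz p x \<in> supported (words A m)"
  using lin_t_supported[OF assms] lin_N_supported[OF assms] assms(1)
      by (simp add: horiz_def supported_diff)

lemma vert_len1: "x \<in> of_len 1 \<Longrightarrow> vert p x = 0"
  using lin_b_len1[of x] lin_b'_len1[of x] by (simp add: vert_def)

lemma vert_horiz:
  assumes "x \<in> of_len m" "2 \<le> m"
  shows "vert p (horiz p x) = - horiz p (vert (Suc p) x)"
  using lin_b_lin_t[OF assms] lin_b'_lin_N[OF assms]
  by (simp add: vert_def horiz_def module_hom.neg[OF free_linear_ops(3)])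

lemma horiz_horiz:
  assumes "x \<in> of_len m" "0 < m"
  shows "horiz p (horiz (Suc p) x) = 0"
  using lin_N_lin_t[OF assms] by (simp add: horiz_def module_hom.diff[OF free_linear_ops(4)])

lemma lin_map_vert_horiz:
  assumes "x \<in> of_len m" "0 < m" "\<And>x y. f (x * y) = f x * f y"
  shows "lin_map f (vert p x) = vert p (lin_map f x)" "lin_map f (horiz p x)
      = horiz p (lin_map f x)"
  using lin_map_ops[OF assms(1,2), of f] lin_map_lin_t[OF assms(1,2), of f] assms(3)
  by (simp_all add: vert_def horiz_def module_hom.diff[OF free_linear_ops(6)]
      module_hom.neg[OF free_linear_ops(6)])

context unital_algebra
begin

lemma descends_vert: "descends (vert p)"
  using descends_lin_b descends_uminus[OF descends_lin_b']
      by (cases "even p") (simp_all add: vert_def[abs_def])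

lemma descends_horiz: "descends (horiz p)"
  using descends_minus[OF descends_id descends_lin_t] descends_lin_N
      by (cases "even p") (simp_all add: horiz_def[abs_def])

lemma descends_compress: "descends (lin_map (compress \<epsilon>))"
  by (rule descends_lin_map) (rule compress_add compress_scale)+

end

section \<open>Compressions of homogeneous words\<close>

context peirce
begin

definition esum :: "'i set \<Rightarrow> 'a" where
  "esum I = (\<Sum>i\<in>I. E i)"

lemma E_esum: "E a * esum I = (if a \<in> I then E a else 0)" "esum I * E a
    = (if a \<in> I then E a else 0)"
  by (simp_all add: esum_def sum_distrib_left sum_distrib_right E_mult if_distrib cong: if_cong)

lemma esum_mult: "esum I * esum J = esum (I \<inter> J)"
proof -
  have "esum I * esum J = (\<Sum>i\<in>I. if i \<in> J then E i else 0)"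
    by (subst esum_def) (simp add: sum_distrib_right E_esum)
  then show ?thesis by (simp add: esum_def sum.inter_restrict)
qed

lemma compress_compress: "compress (esum I) (compress (esum J) x) = compress (esum (I \<inter> J)) x"
proof -
  have "compress (esum I) (compress (esum J) x) = (esum I * esum J) * x * (esum J * esum I)"
    by (simp add: compress_def mult.assoc)
  then show ?thesis by (simp add: esum_mult compress_def Int_commute)
qed

lemma compress_homogeneous_letter:
  assumes "E a * x = x" "x * E b = x"
  shows "compress (esum I) x = (if a \<in> I \<and> b \<in> I then x else 0)"
proof -
  have "compress (esum I) x = (esum I * E a) * x * (E b * esum I)"
    using assms by (metis compress_def mult.assoc)
  then show ?thesis using assms by (simp add: E_esum)
qed

lemma lin_map_compress_homogeneous:
  assumes "homogeneous L w"
  shows "lin_map (compress (esum I)) (Poly_Mapping.single w c)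
      \<approx> (if set L \<subseteq> I \<times> I then Poly_Mapping.single w c else 0)"
proof -
  have L: "length L = length w" using assms by (simp add: homogeneous_def)
  have letter: "compress (esum I) (w ! i) = (if L ! i \<in> I \<times> I then w ! i else 0)" if "i < length w"
      for i
    using compress_homogeneous_letter[of "fst (L ! i)" "w ! i" "snd (L ! i)" I] assms that
    by (auto simp: homogeneous_def mem_Times_iff)
  show ?thesis
  proof (cases "set L \<subseteq> I \<times> I")
    case True
    then have "L ! i \<in> I \<times> I" if "i < length w" for i using that L by (metis nth_mem subsetD)
    then have "map (compress (esum I)) w = w" by (intro nth_equalityI) (simp_all add: letter)
    then show ?thesis using True by simp
  next
    case False
    then obtain i where i: "i < length w" "L ! i \<notin> I \<times> I" using L by (metis in_set_conv_nth subsetI)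
    then have "0 \<in> set (map (compress (esum I)) w)" using letter[of i]
        by (metis length_map nth_map nth_mem)
    then show ?thesis using False by (simp only: lin_map_single eqv_0_iff zero_letter if_False)
  qed
qed

lemma lin_insert_supported:
  assumes "x \<in> of_len m"
  shows "lin_insert x \<in> of_len (Suc m)"
proof (rule free_linear_supported[OF descends_linear[OF descends_lin_insert] _ assms])
  fix w :: "'a list" assume w: "w \<in> words UNIV m"
  have "Poly_Mapping.single (insert_at (snd q) (E (next_source (fst q) (snd q)))
      (peirce_word E (fst q) w)) ((-1 :: 'k) ^ snd q)
      \<in> of_len (Suc m)" if "q \<in> defects m" for q
    using that w by (intro single_supported) (auto simp: defects_def labels_def length_peirce_word)
  then have "(\<Sum>q\<in>defects m. Poly_Mapping.single (insert_at (snd q) (E (next_source (fst q) (snd q)))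
      (peirce_word E (fst q) w))
      ((-1 :: 'k) ^ snd q)) \<in> of_len (Suc m)"
    by (rule free.subspace_sum[OF subspace_supported])
  then show "lin_insert (Poly_Mapping.single w 1) \<in> of_len (Suc m)"
    using w by (simp add: lin_insert_def split_beta)
qed

end

text \<open>By \<open>vanish\<close>, a nonzero component \<open>E a R E b\<close> with \<open>a \<noteq> b\<close> increases \<open>\<rho>\<close>, so a word without
  defect has all its labels equal to a single \<open>(a, a)\<close> and lies in one of the two corners.\<close>

locale oriented_peirce = peirce scale unit E
  for scale :: "'k::field \<Rightarrow> 'a::ring \<Rightarrow> 'a" and unit and E :: "'i::finite \<Rightarrow> 'a" +
  fixes I1 I2 :: "'i set" and \<rho> :: "'i \<Rightarrow> nat"
  assumes vanish: "a \<noteq> b \<Longrightarrow> \<not> \<rho> a < \<rho> b \<Longrightarrow> E a * x * E b = 0"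
    and cover: "I1 \<union> I2 = UNIV"
    and convex1: "a \<in> I1 \<Longrightarrow> b \<in> I1 \<Longrightarrow> c \<notin> I1 \<Longrightarrow> E a * x * E c * y * E b = 0"
    and convex2: "a \<in> I2 \<Longrightarrow> b \<in> I2 \<Longrightarrow> c \<notin> I2 \<Longrightarrow> E a * x * E c * y * E b = 0"
begin

abbreviation "c1 \<equiv> compress (esum I1)"
abbreviation "c2 \<equiv> compress (esum I2)"
abbreviation "c0 \<equiv> compress (esum (I1 \<inter> I2))"

text \<open>Insert \<open>unit = esum I + esum (- I)\<close> between the factors: the second summand
  only contributes products that leave \<open>I\<close> and return, and these vanish by
  assumption.\<close>

lemma compress_mult_convex:
  assumes "\<And>a b c x y. a \<in> I \<Longrightarrow> b \<in> I \<Longrightarrow> c \<notin> I \<Longrightarrow> E a * x * E c * y * E b = 0"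
  shows "compress (esum I) (x * y) = compress (esum I) x * compress (esum I) y"
proof -
  have "esum I * x * esum (- I) * y * esum I = (\<Sum>b\<in>I. \<Sum>c\<in>-I. \<Sum>a\<in>I. E a * x * E c * y * E b)"
    by (simp add: esum_def sum_distrib_left sum_distrib_right)
  also have "\<dots> = 0" using assms by (intro sum.neutral ballI) auto
  finally have 0: "esum I * (x * (esum (- I) * (y * esum I))) = 0" by (simp add: mult.assoc)
  have "unit = esum I + esum (- I)"
    using sum.union_disjoint[of I "- I" E] by (simp add: esum_def E_sum Compl_partition)
  then have "x * y = x * esum I * y + x * esum (- I) * y"
    by (metis distrib_left distrib_right unit_right)
  then have "compress (esum I) (x * y)
      = esum I * x * esum I * y * esum I + esum I * x * esum (- I) * y * esum I"
    by (simp add: compress_def distrib_left distrib_right mult.assoc)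
  also have "esum I * x * esum I * y * esum I = esum I * x * (esum I * esum I) * y * esum I"
      by (simp add: esum_mult)
  finally show ?thesis using 0 by (simp add: compress_def mult.assoc)
qed

lemma c1_mult: "c1 (x * y) = c1 x * c1 y"
  by (rule compress_mult_convex) (rule convex1)

lemma c2_mult: "c2 (x * y) = c2 x * c2 y"
  by (rule compress_mult_convex) (rule convex2)

lemma c0_mult: "c0 (x * y) = c0 x * c0 y"
  by (simp add: c1_mult c2_mult flip: compress_compress)

text \<open>As \<open>c1\<close> and \<open>c2\<close> compose to \<open>c0\<close>, this is the
  projection (1 - c1)(1 - c2) on chains. Modulo relations it keeps the homogeneous words whose
  labels fit in neither index set and kills the others.\<close>

definition mixed :: "('a list \<Rightarrow>\<^sub>0 'k) \<Rightarrow> ('a list \<Rightarrow>\<^sub>0 'k)" where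
  "mixed x = x - lin_map c1 x - lin_map c2 x + lin_map c0 x"

lemma descends_mixed: "descends mixed"
  unfolding mixed_def[abs_def] by (intro descends_add descends_minus descends_id descends_compress)

lemma mixed_mixed: "mixed (mixed x) = mixed x"
proof -
  have "lin_map (compress (esum I)) (lin_map (compress (esum J)) y)
      = lin_map (compress (esum (I \<inter> J))) y" for I J and y :: "'a list \<Rightarrow>\<^sub>0 'k"
    by (simp add: lin_map_lin_map compress_compress)
  then show ?thesis
    by (simp add: mixed_def module_hom.diff[OF free_linear_ops(6)]
        module_hom.add[OF free_linear_ops(6)] Int_ac)
qed

lemma mixed_vert_horiz:
  assumes "x \<in> of_len m" "0 < m"
  shows "mixed (vert p x) = vert p (mixed x)" "mixed (horiz p x) = horiz p (mixed x)"
  using lin_map_vert_horiz[OF assms c1_mult] lin_map_vert_horiz[OF assms c2_mult]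
      lin_map_vert_horiz[OF assms c0_mult]
  by (simp_all add: mixed_def module_hom.diff[OF free_linear_vert]
      module_hom.add[OF free_linear_vert]
      module_hom.diff[OF free_linear_horiz] module_hom.add[OF free_linear_horiz])

lemma mixed_supported: "x \<in> of_len m \<Longrightarrow> mixed x \<in> of_len m"
  unfolding mixed_def
  by (intro supported_add supported_diff) (auto intro: lin_map_supported)

lemma mixed_homogeneous:
  assumes "homogeneous L w" "w \<noteq> []"
  shows "anticomm (mixed (Poly_Mapping.single w 1)) \<approx> mixed (Poly_Mapping.single w 1)"
proof -
  let ?S = "Poly_Mapping.single w (1 :: 'k)"
  have L: "length L = length w" "L \<noteq> []" using assms by (auto simp: homogeneous_def)
  have "mixed ?S \<approx> ?S - (if set L \<subseteq> I1 \<times> I1 then ?S else 0) - (if set L \<subseteq> I2 \<times> I2 then ?S else 0)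
      + (if set L \<subseteq> (I1 \<inter> I2) \<times> (I1 \<inter> I2) then ?S else 0)"
    unfolding mixed_def by (intro eqv_add eqv_diff lin_map_compress_homogeneous assms eqv_refl)
  also have "set L \<subseteq> (I1 \<inter> I2) \<times> (I1 \<inter> I2) \<longleftrightarrow> set L \<subseteq> I1 \<times> I1 \<and> set L \<subseteq> I2 \<times> I2" by auto
  finally have mixed: "mixed ?S \<approx> (if set L \<subseteq> I1 \<times> I1 \<or> set L \<subseteq> I2 \<times> I2 then 0 else ?S)"
    by (cases "set L \<subseteq> I1 \<times> I1"; cases "set L \<subseteq> I2 \<times> I2"; simp)
  note fixed = descends_fixed_eqv[OF descends_anticomm]
  have anticomm_0: "anticomm 0 \<approx> 0" by (simp add: descends_simps[OF descends_anticomm])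
  have "anticomm ?S \<approx> ?S" if n: "\<not> (set L \<subseteq> I1 \<times> I1 \<or> set L \<subseteq> I2 \<times> I2)"
  proof (cases "\<exists>(a, b)\<in>set L. a \<noteq> b \<and> \<not> \<rho> a < \<rho> b")
    \<comment> \<open>A label against the order belongs to a vanishing Peirce component, so the word
      has a zero letter.\<close>
    case True
    then obtain i where i: "i < length w" "fst (L ! i) \<noteq> snd (L ! i)"
        "\<not> \<rho> (fst (L ! i)) < \<rho> (snd (L ! i))"
      using L by (force simp: in_set_conv_nth)
    then have "w ! i = E (fst (L ! i)) * w ! i * E (snd (L ! i))" using assms(1)
        by (simp add: homogeneous_def)
    then have "w ! i = 0" using vanish[OF i(2,3)] by simp
    then have "0 \<in> set w" using i(1) by (metis nth_mem)
    then have "?S \<approx> 0" by (simp only: eqv_0_iff zero_letter)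
    then show ?thesis using anticomm_0 by (rule fixed)
  next
    case False
    \<comment> \<open>A constant label (a, a) would place the word in one of the corners, because
      \<open>I1\<close> and \<open>I2\<close> cover all indices.\<close>
    have "\<not> set L \<subseteq> {(a, a)}" for a using n cover by blast
    with False have "\<exists>k. first_defect L k" by (intro first_defect_exists[OF L(2), of \<rho>]) auto
    then show ?thesis using anticomm_homogeneous[OF assms(1)] by blast
  qed
  then have "anticomm (if set L \<subseteq> I1 \<times> I1 \<or> set L \<subseteq> I2 \<times> I2 then 0 else ?S)
      \<approx> (if set L \<subseteq> I1 \<times> I1 \<or> set L \<subseteq> I2 \<times> I2 then 0 else ?S)"
    using anticomm_0 by presburger
  with mixed show ?thesis by (rule fixed)
qed

lemma anticomm_mixed:
  assumes "x \<in> of_len m" "0 < m"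
  shows "anticomm (mixed x) \<approx> mixed x"
proof -
  have descends: "descends (\<lambda>x. anticomm (mixed x) - mixed x)"
    by (intro descends_minus descends_compose[OF descends_mixed descends_anticomm] descends_mixed)
  have sub: "free.subspace {x. anticomm (mixed x) - mixed x \<in> rels}"
    using descends_simps[OF descends] rels_0 rels_add rels_scale by (simp add: free.subspace_def)
  have "anticomm (mixed (Poly_Mapping.single w 1)) - mixed (Poly_Mapping.single w 1) \<in> rels"
      if "w \<in> words UNIV m" for w
  proof -
    have "anticomm (mixed (Poly_Mapping.single (peirce_word E L w) 1))
        - mixed (Poly_Mapping.single (peirce_word E L w) 1) \<in> rels"
      if "L \<in> labels (length w)" for L
    proof -
      have "length L = length w" "peirce_word E L w \<noteq> []"
        using that \<open>w \<in> words UNIV m\<close> assms(2) length_peirce_word[of L w E]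
            by (auto simp: labels_def)
      then show ?thesis using mixed_homogeneous[OF homogeneous_peirce_word] by (simp add: eqv_def)
    qed
    then have "(\<Sum>L\<in>labels (length w). anticomm (mixed (Poly_Mapping.single (peirce_word E L w) 1))
        - mixed (Poly_Mapping.single (peirce_word E L w) 1)) \<in> rels"
      by (rule rels_sum)
    with descends_eqv[OF descends word_decomp[of w]] show ?thesis
      using rels_add by (fastforce simp: eqv_def descends_simps(6)[OF descends])
  qed
  then show ?thesis using supported_induct[OF assms(1) sub] by (simp add: eqv_def)
qed

text \<open>The sign in odd columns offsets the one in the vertical differential - b'.\<close>

definition col_homotopy :: "nat \<Rightarrow> ('a list \<Rightarrow>\<^sub>0 'k) \<Rightarrow> ('a list \<Rightarrow>\<^sub>0 'k)" where
  "col_homotopy p x = (if even p then lin_insert x else - lin_cons unit x)"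

lemma col_homotopy_supported: "x \<in> of_len m \<Longrightarrow> col_homotopy p x \<in> of_len (Suc m)"
  by (simp add: col_homotopy_def lin_insert_supported lin_cons_supported supported_neg)

text \<open>The homotopies are not claimed to preserve mixed chains. Since \<open>mixed\<close>
  commutes with the vertical differential and fixes \<open>z\<close>, projecting the preimage
  repairs this.\<close>

lemma vert_col_homotopy:
  assumes z: "z \<in> of_len m" "0 < m" "mixed z = z" "vert p z \<approx> 0"
  shows "vert p (mixed (col_homotopy p z)) \<approx> z"
proof -
  have "vert p (col_homotopy p z) \<approx> z"
  proof (cases "even p")
    case True
    have "lin_insert (lin_b z) \<approx> lin_insert 0" using z(4) True
        by (intro descends_eqv[OF descends_lin_insert]) (simp add: vert_def)
    then have "anticomm z - lin_insert (lin_b z) \<approx> z - 0"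
      using anticomm_mixed[OF z(1,2)] z(3)
          by (intro eqv_diff) (simp_all add: descends_simps[OF descends_lin_insert])
    then show ?thesis using True by (simp add: anticomm_def vert_def col_homotopy_def)
  next
    case False
    have "lin_b' z \<approx> 0" using z(4) False eqv_neg[of "vert p z" 0] by (simp add: vert_def)
    then have "lin_cons unit (lin_b' z) \<approx> lin_cons unit 0"
        by (rule descends_eqv[OF descends_lin_cons])
    then have "z - lin_cons unit (lin_b' z) \<approx> z - 0"
        by (intro eqv_diff) (simp_all add: descends_simps[OF descends_lin_cons])
    moreover have "lin_b' (lin_cons unit z) = z - lin_cons unit (lin_b' z)"
      using lin_b'_lin_cons[OF z(1,2) unit_left] by (simp add: eq_diff_eq)
    ultimately show ?thesis using False
        by (simp add: vert_def col_homotopy_def module_hom.neg[OF free_linear_ops(2)])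
  qed
  then have "mixed (vert p (col_homotopy p z)) \<approx> mixed z" by (rule descends_eqv[OF descends_mixed])
  then show ?thesis using mixed_vert_horiz(1)[OF col_homotopy_supported[OF z(1)]] z(3) by simp
qed

text \<open>The components of the bounding chain are found from the last column to the first.\<close>

lemma mixed_cycle_boundary:
  assumes x: "\<And>p. p \<le> n \<Longrightarrow> x p \<in> of_len (n - p + 1)"
    and cyc: "\<And>p. p < n \<Longrightarrow> vert p (x p) + horiz p (x (p + 1)) \<approx> 0"
  shows "\<exists>y. (\<forall>p\<le>n + 1. y p \<in> of_len (n + 2 - p))
      \<and> (\<forall>p\<le>n. vert p (y p) + horiz p (y (p + 1)) \<approx> mixed (x p))"
proof -
  \<comment> \<open>The induction also carries \<open>mixed (y p) = y p\<close>, which makes the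
    right-hand side \<open>z\<close> for the next column mixed.\<close>
  have "\<exists>y. (\<forall>p. q \<le> p \<longrightarrow> p \<le> n + 1 \<longrightarrow> y p \<in> of_len (n + 2 - p) \<and> mixed (y p) = y p) \<and>
      (\<forall>p. q \<le> p \<longrightarrow> p \<le> n \<longrightarrow> vert p (y p) + horiz p (y (p + 1)) \<approx> mixed (x p))" if "q \<le> n + 1" for q
    using that
  proof (induction q rule: inc_induct)
    case base
    \<comment> \<open>Only the entry in column \<open>n + 1\<close> is constrained so far, and zero
      will do.\<close>
    show ?case
      by (rule exI[of _ "\<lambda>_. 0"])
        (auto simp: descends_simps[OF descends_mixed] supported_0)
  next
    case (step q)
    then obtain y where y: "\<And>p. Suc q \<le> p \<Longrightarrow> p \<le> n + 1 \<Longrightarrow> y p \<in> of_len (n + 2 - p) \<and> mixed (y p)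
        = y p"
      and dy: "\<And>p. Suc q \<le> p \<Longrightarrow> p \<le> n \<Longrightarrow> vert p (y p) + horiz p (y (p + 1)) \<approx> mixed (x p)" by blast
    have q: "q \<le> n" using step by simp
    let ?m = "n - q + 1"
    \<comment> \<open>What remains for column \<open>q\<close> to hit after the horizontal image of
      the entry already chosen in column \<open>q + 1\<close>.\<close>
    define z where "z = mixed (x q) - horiz q (y (q + 1))"
    have yq: "y (q + 1) \<in> of_len ?m" "mixed (y (q + 1)) = y (q + 1)"
      using y[of "q + 1"] q by (simp_all add: Suc_diff_le)
    have xq: "x q \<in> of_len ?m" using x[OF q] .
    have z: "z \<in> of_len ?m" unfolding z_def
      using horiz_supported[OF yq(1)] mixed_supported[OF xq] by (intro supported_diff) auto
    have prz: "mixed z = z"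
      using mixed_vert_horiz(2)[OF yq(1)] yq(2)
          by (simp add: z_def descends_simps[OF descends_mixed] mixed_mixed)
    \<comment> \<open>In column \<open>n\<close> the chain \<open>z\<close> consists of words of
      length one. Otherwise anticommutation of the differentials moves the question to column
      \<open>q + 1\<close>, where the equation for \<open>y\<close> applies; two successive
      horizontal maps compose to zero, and the cycle condition on \<open>x\<close> finishes.\<close>
    have vz: "vert q z \<approx> 0"
    proof (cases "q = n")
      case True
      then show ?thesis using vert_len1[of z q] z by simp
    next
      case False
      then have qn: "q < n" "2 \<le> ?m" using q by auto
      have y2: "y (q + 2) \<in> of_len (n - q)" using y[of "q + 2"] qn by simp
      have xq1: "x (q + 1) \<in> of_len (n - q)" using x[of "q + 1"] qn by (simp add: Suc_diff_Suc)
      have "vert q z = mixed (vert q (x q)) + horiz q (vert (Suc q) (y (q + 1)))"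
        using vert_horiz[OF yq(1) qn(2), of q] mixed_vert_horiz(1)[OF xq]
        by (simp add: z_def module_hom.diff[OF free_linear_vert])
      also have "\<dots> \<approx> mixed (vert q (x q)) + horiz q (mixed (x (q + 1)) - horiz (Suc q) (y (q + 2)))"
      proof (intro eqv_add eqv_refl descends_eqv[OF descends_horiz])
        show "vert (Suc q) (y (q + 1)) \<approx> mixed (x (q + 1)) - horiz (Suc q) (y (q + 2))"
          using eqv_diff[OF dy[of "q + 1"] eqv_refl[of "horiz (Suc q) (y (q + 2))"]] qn by simp
      qed
      also have "\<dots> = mixed (vert q (x q) + horiz q (x (q + 1)))"
        using horiz_horiz[OF y2, of q] mixed_vert_horiz(2)[OF xq1, of q] qn
        by (simp add: module_hom.diff[OF free_linear_horiz] descends_simps[OF descends_mixed])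
      also have "\<dots> \<approx> mixed 0" by (rule descends_eqv[OF descends_mixed cyc[OF qn(1)]])
      finally show ?thesis by (simp add: descends_simps[OF descends_mixed])
    qed
    have "vert q (mixed (col_homotopy q z)) \<approx> z" using vert_col_homotopy[OF z _ prz vz] by simp
    then have new: "vert q (mixed (col_homotopy q z)) + horiz q (y (q + 1)) \<approx> mixed (x q)"
      using eqv_add[of "vert q (mixed (col_homotopy q z))" z "horiz q (y (q + 1))"
          "horiz q (y (q + 1))"] by (simp add: z_def)
    have sup: "mixed (col_homotopy q z) \<in> of_len (n + 2 - q)"
      using mixed_supported[OF col_homotopy_supported[OF z, of q]] q by (simp add: Suc_diff_le)
    show ?case
    proof (rule exI[of _ "y(q := mixed (col_homotopy q z))"], intro conjI allI impI)
      fix p assume "q \<le> p" "p \<le> n + 1"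
      then show "(y(q := mixed (col_homotopy q z))) p
          \<in> of_len (n + 2 - p)" "mixed ((y(q := mixed (col_homotopy q z))) p) =
              (y(q := mixed (col_homotopy q z))) p"
        using sup y[of p] mixed_mixed by (cases "p = q"; simp)+
    next
      fix p assume "q \<le> p" "p \<le> n"
      then show "vert p ((y(q := mixed (col_homotopy q z))) p)
          + horiz p ((y(q := mixed (col_homotopy q z))) (p + 1)) \<approx> mixed (x p)"
        using new dy[of p] by (cases "p = q") auto
    qed
  qed
  from this[of 0] show ?thesis by auto
qed

end

section \<open>Cyclic homology by representatives\<close>

lemma presented_free: "presented (free_space S) (supported S) {0} free_scale (\<lambda>x. x)"
  by (auto simp: presented_def free_space_def supported_def)

definition family_scale :: "'k \<Rightarrow> ('i \<Rightarrow> ('w \<Rightarrow>\<^sub>0 'k::field)) \<Rightarrow> ('i \<Rightarrow> ('w \<Rightarrow>\<^sub>0 'k))" where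
  "family_scale c x = (\<lambda>i. free_scale c (x i))"

lemma family_scale_apply [simp]: "family_scale c x i = free_scale c (x i)"
  by (simp add: family_scale_def)

definition tot_d :: "(nat \<Rightarrow> ('a::ring list \<Rightarrow>\<^sub>0 'k::field)) \<Rightarrow> nat \<Rightarrow> ('a list \<Rightarrow>\<^sub>0 'k)" where
  "tot_d x p = vert p (x p) + horiz p (x (p + 1))"

lemma tot_d_simps:
  "tot_d (x + y) p = tot_d x p + tot_d y p" "tot_d (- x) p = - tot_d x p" "tot_d 0 p = 0"
  "tot_d (family_scale c x) p = free_scale c (tot_d x p)"
  by (simp_all add: tot_d_def module_hom.add[OF free_linear_vert]
      module_hom.add[OF free_linear_horiz]
      module_hom.neg[OF free_linear_vert] module_hom.neg[OF free_linear_horiz]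
      module_hom.zero[OF free_linear_vert] module_hom.zero[OF free_linear_horiz]
      module_hom.scale[OF free_linear_vert] module_hom.scale[OF free_linear_horiz]
          free.scale_right_distrib)

text \<open>Values beyond column \<open>n\<close> are left arbitrary, which makes this a plain
  subgroup of a function type; all comparisons are therefore restricted to
  \<open>p \<le> n\<close>.\<close>

definition tot_chains :: "'a set \<Rightarrow> nat \<Rightarrow> (nat \<Rightarrow> ('a list \<Rightarrow>\<^sub>0 'k::field)) set" where
  "tot_chains A n = {x. \<forall>p\<le>n. x p \<in> supported (words A (n - p + 1))}"

lemma tot_chainsD: "x \<in> tot_chains A n \<Longrightarrow> p \<le> n \<Longrightarrow> x p \<in> supported (words A (n - p + 1))"
  by (simp add: tot_chains_def)

lemma scaled_group_tot_chains: "scaled_group family_scale (tot_chains A n)"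
  by (auto simp: scaled_group_def tot_chains_def supported_0 supported_add supported_neg
      free.subspace_scale[OF subspace_supported])

lemma tot_d_chains:
  assumes y: "y \<in> tot_chains A (Suc n)" and A: "\<And>x y. x \<in> A \<Longrightarrow> y \<in> A \<Longrightarrow> x * y \<in> A"
  shows "tot_d y \<in> tot_chains A n"
proof -
  have "tot_d y p \<in> supported (words A (n - p + 1))" if p: "p \<le> n" for p
  proof -
    have 1: "y p \<in> supported (words A (n - p + 2))" "y (p + 1) \<in> supported (words A (n - p + 1))"
      using tot_chainsD[OF y, of p] tot_chainsD[OF y, of "p + 1"] p by (simp_all add: Suc_diff_le)
    have "vert p (y p) \<in> supported (words A (n - p + 2 - 1))"
      by (rule vert_supported[OF 1(1)]) (auto intro: A)
    moreover have "horiz p (y (p + 1)) \<in> supported (words A (n - p + 1))"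
      by (rule horiz_supported[OF 1(2)]) simp
    ultimately show ?thesis
      using supported_add by (simp add: tot_d_def)
  qed
  then show ?thesis by (simp add: tot_chains_def)
qed

context unital_algebra
begin

definition tot_cycles :: "'a set \<Rightarrow> nat \<Rightarrow> (nat \<Rightarrow> ('a list \<Rightarrow>\<^sub>0 'k)) set" where
  "tot_cycles A n = {x \<in> tot_chains A n. \<forall>p<n. tot_d x p \<in> rels}"

text \<open>The full preimage of the boundaries, so it contains every family of relations, as
  \<open>presented_quotient\<close> demands of the larger subgroup.\<close>

definition tot_bounds :: "'a set \<Rightarrow> nat \<Rightarrow> (nat \<Rightarrow> ('a list \<Rightarrow>\<^sub>0 'k)) set" where
  "tot_bounds A n = {x \<in> tot_chains A n. \<exists>y\<in>tot_chains A (n + 1). \<forall>p\<le>n. x p - tot_d y p \<in> rels}"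

lemma scaled_group_tot_cycles: "scaled_group family_scale (tot_cycles A n)"
  using scaled_groupD[OF scaled_group_tot_chains[of A n]] rels_0 rels_add rels_neg rels_scale
  by (auto simp: scaled_group_def tot_cycles_def tot_d_simps)

lemma scaled_group_tot_bounds: "scaled_group family_scale (tot_bounds A n)"
  unfolding scaled_group_def
proof (intro conjI ballI allI)
  note X = scaled_groupD[OF scaled_group_tot_chains[of A n]]
      and Y = scaled_groupD[OF scaled_group_tot_chains[of A "n + 1"]]
  show "0 \<in> tot_bounds A n"
    using X(1) Y(1) rels_0 unfolding tot_bounds_def by (auto intro!: bexI[of _ 0] simp: tot_d_simps)
  fix x assume x: "x \<in> tot_bounds A n"
  then obtain u where u: "u \<in> tot_chains A (n + 1)" "\<forall>p\<le>n. x p - tot_d u p \<in> rels"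
      by (auto simp: tot_bounds_def)
  have "\<forall>p\<le>n. (- x) p - tot_d (- u) p \<in> rels"
    using rels_neg u(2) by (fastforce simp: tot_d_simps)
  then show "- x \<in> tot_bounds A n" using x X(3) Y(3)[OF u(1)] by (auto simp: tot_bounds_def)
  show "family_scale c x \<in> tot_bounds A n" for c
  proof -
    have "\<forall>p\<le>n. family_scale c x p - tot_d (family_scale c u) p \<in> rels"
      using rels_scale[of _ c] u(2) by (simp add: tot_d_simps flip: free.scale_right_diff_distrib)
    then show ?thesis using x X(4) Y(4)[OF u(1)] by (auto simp: tot_bounds_def)
  qed
  fix y assume y: "y \<in> tot_bounds A n"
  then obtain v where v: "v \<in> tot_chains A (n + 1)" "\<forall>p\<le>n. y p - tot_d v p \<in> rels"
      by (auto simp: tot_bounds_def)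
  have "\<forall>p\<le>n. (x + y) p - tot_d (u + v) p \<in> rels"
    using rels_add u(2) v(2) by (simp add: tot_d_simps add_diff_add)
  then show "x + y \<in> tot_bounds A n" using x y X(2) Y(2)[OF u(1) v(1)]
      by (auto simp: tot_bounds_def)
qed

end

section \<open>Presentation of \<open>HC\<close> of a corner\<close>

locale corner_algebra = unital_algebra scale unit
  for scale :: "'k::field \<Rightarrow> 'a::ring \<Rightarrow> 'a" and unit +
  fixes \<epsilon> :: 'a and A :: "'a set"
  assumes idem: "\<epsilon> * \<epsilon> = \<epsilon>" and A_eq: "A = corner \<epsilon>"
begin

lemma A_mult: "x \<in> A \<Longrightarrow> y \<in> A \<Longrightarrow> x * y \<in> A"
  using corner_closed(3)[OF idem] by (simp add: A_eq)

definition tclass :: "nat \<Rightarrow> ('a list \<Rightarrow>\<^sub>0 'k) \<Rightarrow> ('a list \<Rightarrow>\<^sub>0 'k) set" where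
  "tclass m x = tensor_relations scale A m +>\<^bsub>free_space (words A m)\<^esub> x"

lemma tensor_relations_A: "tensor_relations scale A m = rels \<inter> supported (words A m)"
  by (rule tensor_relations_eq[OF idem A_eq])

lemma scaled_group_tensor_relations: "scaled_group free_scale (rels \<inter> supported (words A m))"
  by (intro scaled_group_subspace free.subspace_inter subspace_rels subspace_supported)

lemma presented_tensor_power:
  "presented (tensor_power scale A m) (supported (words A m)) (rels \<inter> supported (words A m))
      free_scale (tclass m)"
proof -
  have "(free_space (words A m) :: ('k, _) module)\<lparr>carrier := (\<lambda>x. x) ` supported (words A m)\<rparr>
      = free_space (words A m)"
    by (simp add: free_space_def supported_def)
  moreover have "presented (quotient_space
      ((free_space (words A m))\<lparr>carrier := (\<lambda>x. x) ` supported (words A m)\<rparr>)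
          ((\<lambda>x. x) ` (rels \<inter> supported (words A m))))
      (supported (words A m)) (rels \<inter> supported (words A m)) free_scale
      (\<lambda>x. ((\<lambda>x. x) ` (rels \<inter> supported (words A m))) +>\<^bsub>free_space (words A m)\<^esub> x)"
    by (rule presented_quotient[OF presented_free scaled_group_supported scaled_group_supported
        order_refl
          scaled_group_tensor_relations])
      (auto simp: rels_0 free.scale_right_distrib supported_0)
  ultimately show ?thesis
    by (simp add: tensor_power_def tensor_relations_A tclass_def[abs_def])
qed

text \<open>\<open>\<phi>\<close> is compared with a descending \<open>g\<close> only on words of
  the relevant length, because the extension of \<open>op_b\<close> itself does not descend on words
  of length one.\<close>

lemma tensor_map_tclass:
  assumes g: "descends g" "\<And>x. x \<in> supported (words A m') \<Longrightarrow> linear_extension \<phi> x = g x"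
    "\<And>x. x \<in> supported (words A m') \<Longrightarrow> g x \<in> supported (words A m)"
    and x: "x \<in> supported (words A m')"
  shows "tensor_map scale A m \<phi> (tclass m' x) = tclass m (g x)"
proof -
  have coset: "tclass m' x = (\<lambda>r. r + x) ` (rels \<inter> supported (words A m'))"
    by (auto simp: tclass_def tensor_relations_A a_r_coset_def' free_space_def)
  have "induced_map (free_space (words A m)) ((\<lambda>x. x) ` (rels \<inter> supported (words A m)))
      (linear_extension \<phi>) (tclass m' x)
      = ((\<lambda>x. x) ` (rels \<inter> supported (words A m))) +>\<^bsub>free_space (words A m)\<^esub> g x"
  proof (rule induced_map_coset[OF presented_free scaled_group_supported
      scaled_group_tensor_relations])
    show "tclass m' x \<noteq> {}" using rels_0 supported_0 by (auto simp: coset)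
    fix u assume "u \<in> tclass m' x"
    then obtain r where r: "u = r + x" "r \<in> rels" "r \<in> supported (words A m')" by (auto simp: coset)
    have u: "u \<in> supported (words A m')" using r x supported_add by simp
    show "\<exists>v\<in>supported (words A m). linear_extension \<phi> u = v \<and> v - g x
        \<in> rels \<inter> supported (words A m)"
    proof (intro bexI conjI IntI)
      show "g u - g x \<in> rels" using descends_rels[OF g(1) r(2)]
          by (simp add: r(1) descends_simps[OF g(1)])
      show "g u - g x \<in> supported (words A m)"
        using g(3) u x supported_diff by blast
    qed (use g u in auto)
  qed (use g(3) x rels_0 supported_0 in auto)
  then show ?thesis by (simp add: tensor_map_def tensor_relations_A tclass_def)
qed

lemma CC_vert_tclass:
  assumes "x \<in> supported (words A (q + 2))"
  shows "CC_vert scale A p q (tclass (q + 2) x) = tclass (q + 1) (vert p x)"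
  unfolding CC_vert_def
proof (rule tensor_map_tclass[OF descends_vert _ _ assms])
  fix x :: "'a list \<Rightarrow>\<^sub>0 'k" assume x: "x \<in> supported (words A (q + 2))"
  show "vert p x \<in> supported (words A (q + 1))" using vert_supported[OF x _ A_mult] by simp
  show "linear_extension (if even p then op_b else (\<lambda>rs. - op_b' rs)) x = vert p x"
  proof (rule free_linear_eq_on[OF free_linear_linear_extension free_linear_vert _ x])
    \<comment> \<open>The length is at least two, where \<open>op_b0\<close> agrees with
      \<open>op_b\<close>.\<close>
    fix w assume "w \<in> words A (q + 2)"
    then show "linear_extension (if even p then op_b else (\<lambda>rs.
        - op_b' rs)) (Poly_Mapping.single w 1)
        = vert p (Poly_Mapping.single w (1 :: 'k))"
      by (simp add: vert_def lin_b_def lin_b'_def op_b0_def words_def)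
  qed
qed

lemma CC_horiz_tclass:
  assumes "x \<in> supported (words A (q + 1))"
  shows "CC_horiz scale A p q (tclass (q + 1) x) = tclass (q + 1) (horiz p x)"
  unfolding CC_horiz_def
proof (rule tensor_map_tclass[OF descends_horiz _ _ assms])
  fix x :: "'a list \<Rightarrow>\<^sub>0 'k" assume x: "x \<in> supported (words A (q + 1))"
  show "horiz p x \<in> supported (words A (q + 1))" using horiz_supported[OF x] by simp
  show "linear_extension (if even p then (\<lambda>rs. Poly_Mapping.single rs 1 - op_t rs) else op_N) x
      = horiz p x"
    by (rule free_linear_eq_on[OF free_linear_linear_extension free_linear_horiz _ x])
      (simp add: horiz_def lin_t_def lin_N_def)
qed

definition tot_class :: "nat \<Rightarrow> (nat \<Rightarrow> ('a list \<Rightarrow>\<^sub>0 'k)) \<Rightarrow> nat \<Rightarrow> ('a list \<Rightarrow>\<^sub>0 'k) set" where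
  "tot_class n x = (\<lambda>p\<in>{..n}. tclass (n - p + 1) (x p))"

lemma presented_Tot:
  "presented (Tot scale A n) (tot_chains A n) {x. \<forall>p\<le>n. x p
      \<in> rels \<inter> supported (words A (n - p + 1))}
     family_scale (tot_class n)"
proof -
  have "presented (CC scale A p (n - p)) (supported (words A (n - p + 1)))
      (rels \<inter> supported (words A (n - p + 1))) free_scale (tclass (n - p + 1))" for p
    unfolding CC_def by (rule presented_tensor_power)
  from presented_product[of "{..n}", OF this] show ?thesis
    by (simp add: Tot_def tot_chains_def tot_class_def[abs_def] family_scale_def[abs_def] Ball_def)
qed

lemma tot_class_eq_iff:
  assumes "x \<in> tot_chains A n" "y \<in> tot_chains A n"
  shows "tot_class n x = tot_class n y \<longleftrightarrow> (\<forall>p\<le>n. x p - y p \<in> rels)"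
proof -
  have "x - y \<in> tot_chains A n" using assms scaled_groupD(5)[OF scaled_group_tot_chains] by blast
  then show ?thesis using presented_Tot[of n] assms by (auto simp: presented_def tot_chains_def)
qed

lemma Tot_diff_tot_class:
  assumes y: "y \<in> tot_chains A (Suc n)"
  shows "Tot_diff scale A n (tot_class (Suc n) y) = tot_class n (tot_d y)"
  unfolding Tot_diff_def tot_class_def
proof (rule restrict_ext)
  fix p assume "p \<in> {..n}"
  then have p: "p \<le> n" by simp
  have 1: "y p \<in> supported (words A (n - p + 2))" "y (p + 1) \<in> supported (words A (n - p + 1))"
    using tot_chainsD[OF y, of p] tot_chainsD[OF y, of "p + 1"] p by (simp_all add: Suc_diff_le)
  have 2: "vert p (y p) \<in> supported (words A (n - p + 1))" "horiz p (y (p + 1))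
      \<in> supported (words A (n - p + 1))"
    using vert_supported[OF 1(1) _ A_mult] horiz_supported[OF 1(2)] by auto
  have "(\<lambda>p\<in>{..Suc n}. tclass (Suc n - p + 1) (y p)) p = tclass (n - p + 2) (y p)"
    "(\<lambda>p\<in>{..Suc n}. tclass (Suc n - p + 1) (y p)) (p + 1) = tclass (n - p + 1) (y (p + 1))"
    using p by (simp_all add: Suc_diff_le)
  then show "CC_vert scale A p (n - p) ((\<lambda>p\<in>{..Suc n}. tclass (Suc n - p + 1) (y p)) p)
      \<oplus>\<^bsub>CC scale A p (n - p)\<^esub> CC_horiz scale A p (n - p)
          ((\<lambda>p\<in>{..Suc n}. tclass (Suc n - p + 1) (y p)) (p + 1))
      = tclass (n - p + 1) (tot_d y p)"
    using CC_vert_tclass[OF 1(1)] CC_horiz_tclass[OF 1(2)] presented_tensor_power[of "n - p + 1"] 2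
    by (simp add: presented_def CC_def tot_d_def)
qed

lemma Tot_cycles_eq: "Tot_cycles scale A n = tot_class n ` tot_cycles A n"
proof (cases n)
  case 0
  then show ?thesis using presented_Tot[of 0]
      by (simp add: Tot_cycles_def presented_def tot_cycles_def)
next
  case (Suc m)
  have "Tot_diff scale A m (tot_class (Suc m) x) = \<zero>\<^bsub>Tot scale A m\<^esub> \<longleftrightarrow> (\<forall>p\<le>m. tot_d x p \<in> rels)"
    if "x \<in> tot_chains A (Suc m)" for x
  proof -
    have "\<zero>\<^bsub>Tot scale A m\<^esub> = tot_class m 0" using presented_Tot[of m] by (simp add: presented_def)
    then show ?thesis
      using tot_class_eq_iff[OF tot_d_chains[OF that A_mult]
          scaled_groupD(1)[OF scaled_group_tot_chains]] Tot_diff_tot_class[OF that]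
      by simp
  qed
  moreover have "carrier (Tot scale A n) = tot_class n ` tot_chains A n" using presented_Tot[of n]
      by (simp add: presented_def)
  ultimately show ?thesis
    by (auto simp: Suc Tot_cycles_def a_kernel_def kernel_def tot_cycles_def less_Suc_eq_le)
qed

lemma Tot_boundaries_eq: "Tot_boundaries scale A n = tot_class n ` tot_bounds A n"
proof -
  have "carrier (Tot scale A (Suc n)) = tot_class (Suc n) ` tot_chains A (Suc n)"
    using presented_Tot[of "Suc n"] by (simp add: presented_def)
  then have "Tot_boundaries scale A n = (\<lambda>y. tot_class n (tot_d y)) ` tot_chains A (Suc n)"
    by (simp add: Tot_boundaries_def image_image Tot_diff_tot_class)
  also have "\<dots> = tot_class n ` tot_bounds A n"
  proof (intro equalityI subsetI)
    fix z assume "z \<in> (\<lambda>y. tot_class n (tot_d y)) ` tot_chains A (Suc n)"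
    then obtain y where y: "y \<in> tot_chains A (Suc n)" "z = tot_class n (tot_d y)" by blast
    then have "tot_d y \<in> tot_bounds A n" using tot_d_chains[OF y(1) A_mult] rels_0
        unfolding tot_bounds_def by force
    with y show "z \<in> tot_class n ` tot_bounds A n" by blast
  next
    fix z assume "z \<in> tot_class n ` tot_bounds A n"
    then obtain x y where x: "x \<in> tot_chains A n" "z = tot_class n x"
        and y: "y \<in> tot_chains A (Suc n)" "\<forall>p\<le>n. x p - tot_d y p \<in> rels"
      by (auto simp: tot_bounds_def)
    then have "z = tot_class n (tot_d y)" using tot_class_eq_iff tot_d_chains[OF y(1) A_mult]
        by simp
    with y show "z \<in> (\<lambda>y. tot_class n (tot_d y)) ` tot_chains A (Suc n)" by blast
  qed
  finally show ?thesis .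
qed

definition hclass :: "nat \<Rightarrow> (nat \<Rightarrow> ('a list \<Rightarrow>\<^sub>0 'k)) \<Rightarrow> (nat \<Rightarrow> ('a list \<Rightarrow>\<^sub>0 'k) set) set" where
  "hclass n x = Tot_boundaries scale A n +>\<^bsub>Tot scale A n\<^esub> tot_class n x"

lemma presented_HC:
  "presented (HC scale A n) (tot_cycles A n) (tot_bounds A n) family_scale (hclass n)"
  unfolding HC_def hclass_def[abs_def] Tot_cycles_eq Tot_boundaries_eq
proof (rule presented_quotient[OF presented_Tot scaled_group_tot_chains scaled_group_tot_cycles _
    scaled_group_tot_bounds])
  \<comment> \<open>A family of relations differs from the boundary of the zero chain only by
    relations.\<close>
  show "{x. \<forall>p\<le>n. x p \<in> rels \<inter> supported (words A (n - p + 1))} \<subseteq> tot_bounds A n"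
    using scaled_groupD(1)[OF scaled_group_tot_chains[of A "n + 1"]]
    by (auto simp: tot_bounds_def tot_chains_def tot_d_simps intro!: exI[of _ 0])
qed (auto simp: tot_cycles_def tot_bounds_def family_scale_def free.scale_right_distrib fun_eq_iff)

end

section \<open>The exact sequence\<close>

lemma presented_direct_sum:
  assumes U: "presented U X B sc cl" and V: "presented V Y C sc cl'"
  shows "presented (direct_sum U V) (X \<times> Y) (B \<times> C) (\<lambda>c. map_prod (sc c) (sc c)) (map_prod cl cl')"
proof -
  have "carrier U \<times> carrier V = map_prod cl cl' ` (X \<times> Y)"
    using U V by (simp add: presented_def map_prod_surj_on)
  with U V show ?thesis
    by (auto simp: presented_def direct_sum_def zero_prod_def)
qed

text \<open>The map is defined by choosing representatives; the choice does not matter because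
  \<open>\<phi>\<close> takes \<open>B\<close> into \<open>C\<close>.\<close>

lemma presented_map:
  fixes X :: "'x::ab_group_add set" and Y :: "'y::ab_group_add set"
  assumes U: "presented U X B sc cl" "scaled_group sc X" and V: "presented V Y C sc' cl'"
    and \<phi>: "\<And>x. x \<in> X \<Longrightarrow> \<phi> x \<in> Y" "\<And>x. x \<in> X \<Longrightarrow> x \<in> B \<Longrightarrow> \<phi> x \<in> C"
      "\<And>x y. x \<in> X \<Longrightarrow> y \<in> X \<Longrightarrow> \<phi> (x + y) = \<phi> x + \<phi> y" "\<And>c x. x \<in> X \<Longrightarrow> \<phi> (sc c x) = sc' c (\<phi> x)"
  shows "\<exists>F\<in>linear_maps U V. \<forall>x\<in>X. F (cl x) = cl' (\<phi> x)"
proof -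
  note XD = scaled_groupD[OF U(2)]
  define F where "F \<xi> = cl' (\<phi> (SOME x. x \<in> X \<and> cl x = \<xi>))" for \<xi>
  have F: "F (cl x) = cl' (\<phi> x)" if x: "x \<in> X" for x
  proof -
    define y where "y = (SOME y. y \<in> X \<and> cl y = cl x)"
    have y: "y \<in> X" "cl y = cl x" unfolding y_def using someI[of "\<lambda>y. y \<in> X \<and> cl y = cl x" x] x
        by auto
    then have "y - x \<in> B" using U(1) x by (simp add: presented_def)
    then have "\<phi> (y - x) \<in> C" using \<phi>(2) XD(5) x y(1) by blast
    moreover have "\<phi> y - \<phi> x = \<phi> (y - x)" using \<phi>(3)[of "y - x" x] XD(5) x y(1) by simp
    ultimately have "cl' (\<phi> y) = cl' (\<phi> x)" using V \<phi>(1) x y(1) by (simp add: presented_def)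
    then show ?thesis by (simp add: F_def y_def)
  qed
  have "F \<in> linear_maps U V"
    unfolding linear_maps_def
  proof (intro CollectI conjI ballI allI funcsetI)
    have U': "carrier U = cl ` X" "x \<in> X \<Longrightarrow> y \<in> X \<Longrightarrow> cl x \<oplus>\<^bsub>U\<^esub> cl y = cl (x + y)"
      "x \<in> X \<Longrightarrow> c \<odot>\<^bsub>U\<^esub> cl x = cl (sc c x)" for x y c
      using U(1) by (auto simp: presented_def)
    have V': "carrier V = cl' ` Y" "x \<in> Y \<Longrightarrow> y \<in> Y \<Longrightarrow> cl' x \<oplus>\<^bsub>V\<^esub> cl' y = cl' (x + y)"
      "x \<in> Y \<Longrightarrow> c \<odot>\<^bsub>V\<^esub> cl' x = cl' (sc' c x)" for x y c
      using V by (auto simp: presented_def)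
    show "F \<xi> \<in> carrier V" if "\<xi> \<in> carrier U" for \<xi>
      using that F \<phi>(1) by (auto simp: U'(1) V'(1))
    show "F (\<xi> \<oplus>\<^bsub>U\<^esub> \<eta>) = F \<xi> \<oplus>\<^bsub>V\<^esub> F \<eta>" if "\<xi> \<in> carrier U" "\<eta> \<in> carrier U" for \<xi> \<eta>
      using that F \<phi>(1,3) XD(2) by (auto simp: U' V')
    show "F (c \<odot>\<^bsub>U\<^esub> \<xi>) = c \<odot>\<^bsub>V\<^esub> F \<xi>" if "\<xi> \<in> carrier U" for c \<xi>
      using that F \<phi>(1,4) XD(4) by (auto simp: U' V')
  qed
  with F show ?thesis by blast
qed

lemma presented_exact:
  fixes X :: "'x::ab_group_add set" and Y :: "'y::ab_group_add set" and Z :: "'z::ab_group_add set"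
  assumes U: "presented U X B sc cl" and V: "presented V Y C sc' cl'"
      and W: "presented W Z D sc'' cl''"
    and f: "\<And>x. x \<in> X \<Longrightarrow> f (cl x) = cl' (\<phi> x)" "\<And>x. x \<in> X \<Longrightarrow> \<phi> x \<in> Y"
    and g: "\<And>y. y \<in> Y \<Longrightarrow> g (cl' y) = cl'' (\<gamma> y)" "\<And>y. y \<in> Y \<Longrightarrow> \<gamma> y \<in> Z" "0 \<in> Z"
    and exact: "\<And>y. y \<in> Y \<Longrightarrow> \<gamma> y \<in> D \<longleftrightarrow> (\<exists>x\<in>X. y - \<phi> x \<in> C)"
  shows "exact_at U V W f g"
proof -
  have img: "f ` carrier U = (\<lambda>x. cl' (\<phi> x)) ` X"
    using U f(1) by (auto simp: presented_def image_iff)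
  have ker: "a_kernel V W g = cl' ` {y \<in> Y. \<gamma> y \<in> D}"
  proof -
    have "cl'' (\<gamma> y) = \<zero>\<^bsub>W\<^esub> \<longleftrightarrow> \<gamma> y \<in> D" if "y \<in> Y" for y
      using W g(2)[OF that] g(3) by (simp add: presented_def)
    then show ?thesis using V g(1) by (auto simp: a_kernel_def kernel_def presented_def)
  qed
  have eq: "cl' y = cl' (\<phi> x) \<longleftrightarrow> y - \<phi> x \<in> C" if "y \<in> Y" "x \<in> X" for x y
    using V f(2) that by (simp add: presented_def)
  show ?thesis
    unfolding exact_at_def img ker
  proof (intro equalityI subsetI)
    fix \<eta> assume "\<eta> \<in> (\<lambda>x. cl' (\<phi> x)) ` X"
    then obtain x where x: "x \<in> X" "\<eta> = cl' (\<phi> x)" by blast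
    then have "\<phi> x - \<phi> x \<in> C" using eq[of "\<phi> x" x] f(2) by blast
    then show "\<eta> \<in> cl' ` {y \<in> Y. \<gamma> y \<in> D}" using exact[of "\<phi> x"] f(2) x by blast
  next
    fix \<eta> assume "\<eta> \<in> cl' ` {y \<in> Y. \<gamma> y \<in> D}"
    then obtain y where y: "y \<in> Y" "\<gamma> y \<in> D" "\<eta> = cl' y" by blast
    then obtain x where x: "x \<in> X" "y - \<phi> x \<in> C" using exact[OF y(1)] by blast
    then have "\<eta> = cl' (\<phi> x)" using eq y by blast
    with x(1) show "\<eta> \<in> (\<lambda>x. cl' (\<phi> x)) ` X" by blast
  qed
qed

section \<open>Chain maps induced by compression\<close>

context unital_algebra
begin

lemma tot_chains_mono: "A \<subseteq> B \<Longrightarrow> tot_chains A n \<subseteq> tot_chains B n"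
  by (fastforce simp: tot_chains_def supported_def words_def)

lemma tot_cycles_mono: "A \<subseteq> B \<Longrightarrow> tot_cycles A n \<subseteq> tot_cycles B n"
  using tot_chains_mono[of A B n] by (auto simp: tot_cycles_def)

lemma tot_bounds_mono: "A \<subseteq> B \<Longrightarrow> tot_bounds A n \<subseteq> tot_bounds B n"
  using tot_chains_mono[of A B n] tot_chains_mono[of A B "n + 1"] by (auto simp: tot_bounds_def)

text \<open>Identities such as \<open>tot_map_corner\<close> hold only in columns
  \<open>p \<le> n\<close>, so membership has to be transported along equality in those
  columns.\<close>

lemma tot_bounds_cong:
  assumes "x \<in> tot_bounds A n" "y \<in> tot_chains A n" "\<And>p. p \<le> n \<Longrightarrow> y p = x p"
  shows "y \<in> tot_bounds A n"
  using assms by (simp add: tot_bounds_def)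

definition tot_map :: "'a \<Rightarrow> (nat \<Rightarrow> ('a list \<Rightarrow>\<^sub>0 'k)) \<Rightarrow> (nat \<Rightarrow> ('a list \<Rightarrow>\<^sub>0 'k))" where
  "tot_map \<epsilon> x p = lin_map (compress \<epsilon>) (x p)"

lemma tot_map_chains: "x \<in> tot_chains A n \<Longrightarrow> tot_map \<epsilon> x \<in> tot_chains (corner \<epsilon>) n"
  by (auto simp: tot_chains_def tot_map_def corner_eq intro!: lin_map_supported)

lemma tot_chains_of_len: "x \<in> tot_chains A n \<Longrightarrow> p \<le> n \<Longrightarrow> x p \<in> of_len (n - p + 1)"
  by (drule subsetD[OF tot_chains_mono[of A UNIV], OF subset_UNIV]) (rule tot_chainsD)

lemma tot_d_tot_map:
  assumes "x \<in> tot_chains A (Suc n)" "p \<le> n" "\<And>x y. compress \<epsilon> (x * y)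
      = compress \<epsilon> x * compress \<epsilon> y"
  shows "tot_d (tot_map \<epsilon> x) p = lin_map (compress \<epsilon>) (tot_d x p)"
  using lin_map_vert_horiz(1)[OF tot_chains_of_len[OF assms(1), of p] _ assms(3)]
    lin_map_vert_horiz(2)[OF tot_chains_of_len[OF assms(1), of "p + 1"] _ assms(3)] assms(2)
  by (simp add: tot_d_def tot_map_def descends_simps[OF descends_compress])

lemma tot_map_cycles:
  assumes "x \<in> tot_cycles A n" "\<And>x y. compress \<epsilon> (x * y) = compress \<epsilon> x * compress \<epsilon> y"
  shows "tot_map \<epsilon> x \<in> tot_cycles (corner \<epsilon>) n"
proof -
  have "tot_d (tot_map \<epsilon> x) p \<in> rels" if p: "p < n" for p
  proof -
    obtain m where m: "n = Suc m" "p \<le> m" using p by (cases n) auto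
    then show ?thesis
      using tot_d_tot_map[of x A m p \<epsilon>] assms descends_rels[OF descends_compress]
          by (simp add: tot_cycles_def)
  qed
  then show ?thesis using assms(1) tot_map_chains[of x A n \<epsilon>] by (simp add: tot_cycles_def)
qed

lemma tot_map_bounds:
  assumes "x \<in> tot_bounds A n" "\<And>x y. compress \<epsilon> (x * y) = compress \<epsilon> x * compress \<epsilon> y"
  shows "tot_map \<epsilon> x \<in> tot_bounds (corner \<epsilon>) n"
proof -
  obtain y where x: "x \<in> tot_chains A n"
      and y: "y \<in> tot_chains A (Suc n)" "\<forall>p\<le>n. x p - tot_d y p \<in> rels"
    using assms(1) by (auto simp: tot_bounds_def)
  have "tot_map \<epsilon> x p - tot_d (tot_map \<epsilon> y) p \<in> rels" if "p \<le> n" for p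
    using descends_rels[OF descends_compress, of "x p - tot_d y p" \<epsilon>] y(2) that
        tot_d_tot_map[OF y(1) that assms(2)]
    by (simp add: tot_map_def descends_simps[OF descends_compress])
  then show ?thesis
    using tot_map_chains[OF x] tot_map_chains[OF y(1)] by (auto simp: tot_bounds_def)
qed

lemma tot_map_simps:
  "tot_map \<epsilon> (x + y) = tot_map \<epsilon> x + tot_map \<epsilon> y" "tot_map \<epsilon> (x - y) = tot_map \<epsilon> x - tot_map \<epsilon> y"
  "tot_map \<epsilon> (- x) = - tot_map \<epsilon> x"
  by (simp_all add: tot_map_def fun_eq_iff descends_simps[OF descends_compress])

end

section \<open>Exactness in terms of cycles and boundaries\<close>

context oriented_peirce
begin

abbreviation "A1 \<equiv> corner (esum I1)"
abbreviation "A2 \<equiv> corner (esum I2)"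
abbreviation "A0 \<equiv> corner (esum (I1 \<inter> I2))"

lemma corner_esum_mono:
  assumes "J \<subseteq> I"
  shows "corner (esum J) \<subseteq> corner (esum I)"
proof
  fix x assume "x \<in> corner (esum J)"
  then obtain u where u: "x = compress (esum J) u" by (auto simp: corner_eq)
  have "I \<inter> J = J" using assms by blast
  then have "x = compress (esum I) x" using compress_compress[of I J u] u by simp
  then show "x \<in> corner (esum I)" by (auto simp: corner_eq)
qed

text \<open>Compressions compose by intersecting index sets, and a corner is fixed by its own
  compression. In particular, compressing a chain of \<open>A2\<close> to \<open>A1\<close> is the
  same as compressing it to \<open>A0\<close>.\<close>

lemma tot_map_corner:
  assumes "x \<in> tot_chains (corner (esum J)) n" "p \<le> n"
  shows "tot_map (esum I) x p = tot_map (esum (I \<inter> J)) x p" "tot_map (esum J) x p = x p"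
proof -
  note x = tot_chainsD[OF assms]
  have "compress (esum I) a = compress (esum (I \<inter> J)) a" "compress (esum J) a = a"
      if a: "a \<in> corner (esum J)" for a
  proof -
    obtain u where u: "a = compress (esum J) u" using a by (auto simp: corner_eq)
    show "compress (esum I) a = compress (esum (I \<inter> J)) a" "compress (esum J) a = a"
        by (simp_all add: u compress_compress Int_ac)
  qed
  then have "lin_map (compress (esum I)) (x p) = lin_map (compress (esum (I \<inter> J))) (x p)"
      "lin_map (compress (esum J)) (x p) = lin_map (\<lambda>a. a) (x p)"
    by (auto intro!: lin_map_id_on[OF x])
  then show "tot_map (esum I) x p = tot_map (esum (I \<inter> J)) x p" "tot_map (esum J) x p = x p"
    by (simp_all add: tot_map_def lin_map_ident)
qed

lemma corner_sub: "A0 \<subseteq> A1" "A0 \<subseteq> A2" "A1 \<subseteq> UNIV" "A2 \<subseteq> UNIV"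
  using corner_esum_mono by auto

lemmas chainsD = scaled_groupD[OF scaled_group_tot_chains]
  and cyclesD = scaled_groupD[OF scaled_group_tot_cycles]
  and boundsD = scaled_groupD[OF scaled_group_tot_bounds]

lemma cycles_chains: "x \<in> tot_cycles A n \<Longrightarrow> x \<in> tot_chains A n"
  by (simp add: tot_cycles_def)

lemma surjective:
  assumes x: "x \<in> tot_cycles UNIV n"
  shows "\<exists>a\<in>tot_cycles A1 n. \<exists>b\<in>tot_cycles A2 n. x - (a + b) \<in> tot_bounds UNIV n"
proof (intro bexI)
  \<comment> \<open>Chosen so that \<open>x - (?a + ?b)\<close> is \<open>mixed (x p)\<close> in
    column \<open>p\<close>, which \<open>mixed_cycle_boundary\<close> bounds.\<close>
  let ?a = "tot_map (esum I1) x" and ?b = "tot_map (esum I2) x - tot_map (esum (I1 \<inter> I2)) x"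
  show a: "?a \<in> tot_cycles A1 n" by (rule tot_map_cycles[OF x c1_mult])
  have "tot_map (esum (I1 \<inter> I2)) x \<in> tot_cycles A2 n"
    using tot_map_cycles[OF x c0_mult] tot_cycles_mono[OF corner_sub(2)] by blast
  then show b: "?b \<in> tot_cycles A2 n" by (intro cyclesD(5) tot_map_cycles[OF x c2_mult])
  have xc: "x \<in> tot_chains UNIV n" using x by (rule cycles_chains)
  obtain y where y: "\<forall>p\<le>n + 1. y p \<in> of_len (n + 2 - p)"
    "\<forall>p\<le>n. vert p (y p) + horiz p (y (p + 1)) \<approx> mixed (x p)"
  proof -
    have "\<exists>y. (\<forall>p\<le>n + 1. y p \<in> of_len (n + 2 - p))
        \<and> (\<forall>p\<le>n. vert p (y p) + horiz p (y (p + 1)) \<approx> mixed (x p))"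
      using x by (intro mixed_cycle_boundary tot_chainsD[OF xc])
        (auto simp: tot_cycles_def eqv_0_iff tot_d_def)
    then show thesis using that by blast
  qed
  have "y \<in> tot_chains UNIV (n + 1)" using y(1) by (auto simp: tot_chains_def Suc_diff_le)
  moreover have "(x - (?a + ?b)) p - tot_d y p \<in> rels" if "p \<le> n" for p
    using eqv_sym[of "tot_d y p" "mixed (x p)"] y(2) that
    by (simp add: tot_d_def eqv_def mixed_def tot_map_def algebra_simps)
  moreover have "x - (?a + ?b) \<in> tot_chains UNIV n"
    by (intro chainsD(5) chainsD(2) xc subsetD[OF tot_chains_mono[OF subset_UNIV]
        cycles_chains[OF a]]
        subsetD[OF tot_chains_mono[OF subset_UNIV] cycles_chains[OF b]])
  ultimately show "x - (?a + ?b) \<in> tot_bounds UNIV n" by (auto simp: tot_bounds_def)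
qed

text \<open>Compressing a bounding chain of \<open>a + b\<close> to \<open>A1\<close>,
  \<open>A2\<close> and \<open>A0\<close> bounds \<open>a + ?r0 b\<close>, \<open>?r0 a + b\<close>
  and \<open>?r0 a + ?r0 b\<close>, with \<open>?r0\<close> the compression to \<open>A0\<close>.
  The first of these and the difference of the other two show that \<open>c = - ?r0 b\<close>
  works.\<close>

lemma middle:
  assumes a: "a \<in> tot_cycles A1 n" and b: "b \<in> tot_cycles A2 n"
  shows "a + b \<in> tot_bounds UNIV n \<longleftrightarrow> (\<exists>c\<in>tot_cycles A0 n. a - c \<in> tot_bounds A1 n \<and> b + c
      \<in> tot_bounds A2 n)"
proof
  assume "\<exists>c\<in>tot_cycles A0 n. a - c \<in> tot_bounds A1 n \<and> b + c \<in> tot_bounds A2 n"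
  then obtain c where "a - c \<in> tot_bounds UNIV n" "b + c \<in> tot_bounds UNIV n"
    using tot_bounds_mono[OF corner_sub(3)] tot_bounds_mono[OF corner_sub(4)] by blast
  from boundsD(2)[OF this] show "a + b \<in> tot_bounds UNIV n" by simp
next
  assume ab: "a + b \<in> tot_bounds UNIV n"
  let ?r0 = "tot_map (esum (I1 \<inter> I2))"
  have ac: "a \<in> tot_chains A1 n" and bc: "b \<in> tot_chains A2 n" using a b
      by (auto intro: cycles_chains)
  have r0: "?r0 a \<in> tot_cycles A0 n" "?r0 b \<in> tot_cycles A0 n"
    using tot_map_cycles[OF a c0_mult] tot_map_cycles[OF b c0_mult] by auto
  then have r0c: "?r0 x \<in> tot_chains A1 n" "?r0 x \<in> tot_chains A2 n" if "x = a \<or> x = b" for x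
    using that cycles_chains tot_chains_mono[OF corner_sub(1)] tot_chains_mono[OF corner_sub(2)]
        by blast+
  have 1: "a + ?r0 b \<in> tot_bounds A1 n"
  proof (rule tot_bounds_cong[OF tot_map_bounds[OF ab c1_mult]])
    show "a + ?r0 b \<in> tot_chains A1 n" using r0c ac by (intro chainsD(2)) auto
    show "(a + ?r0 b) p = tot_map (esum I1) (a + b) p" if "p \<le> n" for p
      using tot_map_corner(2)[OF ac that] tot_map_corner(1)[OF bc that, of I1]
          by (simp add: tot_map_simps)
  qed
  have 2: "?r0 a + b \<in> tot_bounds A2 n"
  proof (rule tot_bounds_cong[OF tot_map_bounds[OF ab c2_mult]])
    show "?r0 a + b \<in> tot_chains A2 n" using r0c bc by (intro chainsD(2)) auto
    show "(?r0 a + b) p = tot_map (esum I2) (a + b) p" if "p \<le> n" for p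
      using tot_map_corner(2)[OF bc that] tot_map_corner(1)[OF ac that, of I2]
      by (simp add: tot_map_simps Int_commute)
  qed
  have "?r0 (a + b) \<in> tot_bounds A2 n"
    using tot_map_bounds[OF ab c0_mult] tot_bounds_mono[OF corner_sub(2)] by blast
  then have "(?r0 a + b) - ?r0 (a + b) \<in> tot_bounds A2 n" by (rule boundsD(5)[OF 2])
  then have 3: "b - ?r0 b \<in> tot_bounds A2 n" by (simp add: tot_map_simps)
  show "\<exists>c\<in>tot_cycles A0 n. a - c \<in> tot_bounds A1 n \<and> b + c \<in> tot_bounds A2 n"
    using 1 3 cyclesD(3)[OF r0(2)] by (intro bexI[of _ "- ?r0 b"]) simp_all
qed

text \<open>Compression to \<open>A0\<close> is a chain map fixing \<open>c\<close>, so it carries a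
  bounding chain in \<open>A1\<close> to one in \<open>A0\<close>.\<close>

lemma injective:
  assumes c: "c \<in> tot_cycles A0 n" and b: "c \<in> tot_bounds A1 n"
  shows "c \<in> tot_bounds A0 n"
proof (rule tot_bounds_cong[OF tot_map_bounds[OF b c0_mult]])
  show "c \<in> tot_chains A0 n" using c by (rule cycles_chains)
  then show "c p = tot_map (esum (I1 \<inter> I2)) c p" if "p \<le> n" for p
    using tot_map_corner(2) that by simp
qed

lemma scaled_group_prod:
  "scaled_group sc X \<Longrightarrow> scaled_group sc Y \<Longrightarrow> scaled_group (\<lambda>c. map_prod (sc c) (sc c)) (X \<times> Y)"
  by (auto simp: scaled_group_def zero_prod_def)

text \<open>\<open>f\<close> is induced by sending c to (c, -c), \<open>g\<close> by addition, and
  \<open>\<delta>\<close> is zero. The long sequence thus breaks up into short exact ones, given by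
  \<open>injective\<close>, \<open>middle\<close> and \<open>surjective\<close>.\<close>

lemma mayer_vietoris:
  "\<exists>f g \<delta>.
    (\<forall>n. f n \<in> linear_maps (HC scale A0 n) (direct_sum (HC scale A1 n) (HC scale A2 n))) \<and>
    (\<forall>n. g n \<in> linear_maps (direct_sum (HC scale A1 n) (HC scale A2 n)) (HC scale UNIV n)) \<and>
    (\<forall>n. \<delta> n \<in> linear_maps (HC scale UNIV (n + 1)) (HC scale A0 n)) \<and>
    (\<forall>n. exact_at (HC scale A0 n) (direct_sum (HC scale A1 n) (HC scale A2 n)) (HC scale UNIV n)
           (f n) (g n)) \<and>
    (\<forall>n. exact_at (direct_sum (HC scale A1 (n + 1)) (HC scale A2 (n + 1))) (HC scale UNIV (n + 1))
           (HC scale A0 n) (g (n + 1)) (\<delta> n)) \<and>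
    (\<forall>n. exact_at (HC scale UNIV (n + 1)) (HC scale A0 n)
           (direct_sum (HC scale A1 n) (HC scale A2 n)) (\<delta> n) (f n)) \<and>
    g 0 ` carrier (direct_sum (HC scale A1 0) (HC scale A2 0)) = carrier (HC scale UNIV 0)"
proof -
  have idem: "esum I * esum I = esum I" for I by (simp add: esum_mult)
  interpret C0: corner_algebra scale unit "esum (I1 \<inter> I2)" A0 by unfold_locales (simp_all add: idem)
  interpret C1: corner_algebra scale unit "esum I1" A1 by unfold_locales (simp_all add: idem)
  interpret C2: corner_algebra scale unit "esum I2" A2 by unfold_locales (simp_all add: idem)
  \<comment> \<open>The whole algebra is the corner of its unit, so all four homologies have the
    same kind of presentation.\<close>
  interpret CR: corner_algebra scale unit unit UNIV
    by unfold_locales (auto simp: corner_eq compress_def unit_left unit_right)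
  let ?S = "\<lambda>n. direct_sum (HC scale A1 n) (HC scale A2 n)"
  let ?Z = "\<lambda>n. tot_cycles A1 n \<times> tot_cycles A2 n"
  let ?scl = "\<lambda>n. map_prod (C1.hclass n) (C2.hclass n)"
  note P0 = C0.presented_HC and PR = CR.presented_HC
  have PS: "presented (?S n) (?Z n) (tot_bounds A1 n \<times> tot_bounds A2 n)
      (\<lambda>c. map_prod (family_scale c) (family_scale c)) (?scl n)" for n
    by (rule presented_direct_sum[OF C1.presented_HC C2.presented_HC])
  note SG = scaled_group_tot_cycles
      and SGS = scaled_group_prod[OF scaled_group_tot_cycles scaled_group_tot_cycles]
  have sub: "x \<in> tot_cycles A0 n \<Longrightarrow> x \<in> tot_cycles A1 n" "x \<in> tot_cycles A0 n \<Longrightarrow> x \<in> tot_cycles A2 n"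
    "x \<in> tot_cycles A1 n \<Longrightarrow> x \<in> tot_cycles UNIV n" "x \<in> tot_cycles A2 n \<Longrightarrow> x \<in> tot_cycles UNIV n"
        for x n
    using corner_sub tot_cycles_mono by blast+
  have subb: "x \<in> tot_bounds A0 n \<Longrightarrow> x \<in> tot_bounds A1 n" "x \<in> tot_bounds A0 n \<Longrightarrow> x \<in> tot_bounds A2 n"
    "x \<in> tot_bounds A1 n \<Longrightarrow> x \<in> tot_bounds UNIV n" "x \<in> tot_bounds A2 n \<Longrightarrow> x \<in> tot_bounds UNIV n"
        for x n
    using corner_sub tot_bounds_mono by blast+
  have fs: "family_scale c (- x) = - family_scale c x" "family_scale c (x + y)
      = family_scale c x + family_scale c y"
    for c and x y :: "nat \<Rightarrow> ('a list \<Rightarrow>\<^sub>0 'k)"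
    by (simp_all add: fun_eq_iff free.scale_right_distrib free.scale_minus_right)
  \<comment> \<open>The minus sign makes the composite of \<open>?f\<close> and \<open>?g\<close>
    zero.\<close>
  let ?f = "\<lambda>x. (x, - x)" and ?g = "\<lambda>z. fst z + snd z"
  have "\<forall>n. \<exists>F. F \<in> linear_maps (HC scale A0 n) (?S n)
      \<and> (\<forall>x\<in>tot_cycles A0 n. F (C0.hclass n x) = ?scl n (?f x))"
  proof
    fix n
    have "\<exists>F\<in>linear_maps (HC scale A0 n) (?S n). \<forall>x\<in>tot_cycles A0 n. F (C0.hclass n x)
        = ?scl n (?f x)"
      by (rule presented_map[OF P0 SG PS]) (auto simp: fs intro: sub subb cyclesD(3) boundsD(3))
    then show "\<exists>F. F \<in> linear_maps (HC scale A0 n) (?S n)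
        \<and> (\<forall>x\<in>tot_cycles A0 n. F (C0.hclass n x) = ?scl n (?f x))"
      by blast
  qed
  then obtain f where f: "\<And>n. f n \<in> linear_maps (HC scale A0 n) (?S n)"
    "\<And>n x. x \<in> tot_cycles A0 n \<Longrightarrow> f n (C0.hclass n x) = ?scl n (?f x)" by metis
  have "\<forall>n. \<exists>F. F \<in> linear_maps (?S n) (HC scale UNIV n)
      \<and> (\<forall>z\<in>?Z n. F (?scl n z) = CR.hclass n (?g z))"
  proof
    fix n
    have "\<exists>F\<in>linear_maps (?S n) (HC scale UNIV n). \<forall>z\<in>?Z n. F (?scl n z) = CR.hclass n (?g z)"
      by (rule presented_map[OF PS SGS PR]) (auto simp: fs intro!: cyclesD(2) boundsD(2)
          intro: sub subb)
    then show "\<exists>F. F \<in> linear_maps (?S n) (HC scale UNIV n)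
        \<and> (\<forall>z\<in>?Z n. F (?scl n z) = CR.hclass n (?g z))"
      by blast
  qed
  then obtain g where g: "\<And>n. g n \<in> linear_maps (?S n) (HC scale UNIV n)"
    "\<And>n z. z \<in> ?Z n \<Longrightarrow> g n (?scl n z) = CR.hclass n (?g z)" by metis
  have "\<forall>n. \<exists>F. F \<in> linear_maps (HC scale UNIV (n + 1)) (HC scale A0 n) \<and>
      (\<forall>x\<in>tot_cycles UNIV (n + 1). F (CR.hclass (n + 1) x) = C0.hclass n 0)"
  proof
    fix n
    have "\<exists>F\<in>linear_maps (HC scale UNIV (n + 1)) (HC scale A0 n).
        \<forall>x\<in>tot_cycles UNIV (n + 1). F (CR.hclass (n + 1) x) = C0.hclass n 0"
      by (rule presented_map[OF PR SG P0]) (auto simp: fun_eq_iff intro: cyclesD(1) boundsD(1))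
    then show "\<exists>F. F \<in> linear_maps (HC scale UNIV (n + 1)) (HC scale A0 n) \<and>
      (\<forall>x\<in>tot_cycles UNIV (n + 1). F (CR.hclass (n + 1) x) = C0.hclass n 0)" by blast
  qed
  then obtain \<delta> where \<delta>: "\<And>n. \<delta> n \<in> linear_maps (HC scale UNIV (n + 1)) (HC scale A0 n)"
    "\<And>n x. x \<in> tot_cycles UNIV (n + 1) \<Longrightarrow> \<delta> n (CR.hclass (n + 1) x) = C0.hclass n 0" by metis
  have g_mem: "z \<in> ?Z n \<Longrightarrow> ?g z \<in> tot_cycles UNIV n" for n z
    by (auto intro!: cyclesD(2) intro: sub)
  have f_mem: "x \<in> tot_cycles A0 n \<Longrightarrow> ?f x \<in> ?Z n" for n x
    by (auto intro: sub cyclesD(3))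
  have surj: "\<exists>z\<in>?Z n. x - ?g z \<in> tot_bounds UNIV n" if "x \<in> tot_cycles UNIV n" for n x
    using surjective[OF that] by force
  have "exact_at (HC scale A0 n) (?S n) (HC scale UNIV n) (f n) (g n)" for n
  proof (rule presented_exact[where \<phi> = ?f
      and \<gamma> = ?g, OF P0 PS PR f(2) f_mem g(2) g_mem cyclesD(1)])
    show "?g z \<in> tot_bounds UNIV n \<longleftrightarrow> (\<exists>x\<in>tot_cycles A0 n. z - ?f x
        \<in> tot_bounds A1 n \<times> tot_bounds A2 n)"
      if "z \<in> ?Z n" for z
      using middle[of "fst z" n "snd z"] that by (cases z) simp
  qed
  moreover have "exact_at (?S (n + 1)) (HC scale UNIV (n + 1)) (HC scale A0 n) (g (n + 1)) (\<delta> n)"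
      for n
  \<comment> \<open>Every class is in the kernel of the zero map, so exactness here is surjectivity
    of \<open>g\<close>.\<close>
  proof (rule presented_exact[where \<phi> = ?g and \<gamma> = "\<lambda>_. 0", OF PS PR P0])
    show "g (n + 1) (?scl (n + 1) z) = CR.hclass (n + 1) (?g z)" if "z \<in> ?Z (n + 1)" for z
      by (rule g(2)[OF that])
    show "\<delta> n (CR.hclass (n + 1) x) = C0.hclass n 0" if "x \<in> tot_cycles UNIV (n + 1)" for x
      by (rule \<delta>(2)[OF that])
    show "0 \<in> tot_bounds A0 n \<longleftrightarrow> (\<exists>z\<in>?Z (n + 1). x - ?g z \<in> tot_bounds UNIV (n + 1))"
      if "x \<in> tot_cycles UNIV (n + 1)" for x
      using surj[OF that] boundsD(1) by blast
  qed (rule g_mem cyclesD(1), assumption?)+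
  moreover have "exact_at (HC scale UNIV (n + 1)) (HC scale A0 n) (?S n) (\<delta> n) (f n)" for n
  \<comment> \<open>The zero map has trivial image, so exactness here is injectivity of
    \<open>f\<close>, and the component in \<open>A1\<close> alone decides.\<close>
  proof (rule presented_exact[where \<phi> = "\<lambda>_. 0" and \<gamma> = ?f, OF PR P0 PS])
    show "\<delta> n (CR.hclass (n + 1) x) = C0.hclass n 0" if "x \<in> tot_cycles UNIV (n + 1)" for x
      by (rule \<delta>(2)[OF that])
    show "f n (C0.hclass n x) = ?scl n (?f x)" if "x \<in> tot_cycles A0 n" for x
      by (rule f(2)[OF that])
    show "?f x \<in> ?Z n" if "x \<in> tot_cycles A0 n" for x
      by (rule f_mem[OF that])
    show "0 \<in> tot_cycles A0 n" by (rule cyclesD(1))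
    show "0 \<in> ?Z n" using cyclesD(1) by (simp add: zero_prod_def)
    fix x assume x: "x \<in> tot_cycles A0 n"
    show "?f x \<in> tot_bounds A1 n \<times> tot_bounds A2 n
        \<longleftrightarrow> (\<exists>u\<in>tot_cycles UNIV (n + 1). x - 0 \<in> tot_bounds A0 n)"
      using injective[OF x] subb boundsD(3) cyclesD(1)[of UNIV "n + 1"] by auto
  qed
  moreover have "g 0 ` carrier (?S 0) = carrier (HC scale UNIV 0)"
  proof -
    have "carrier (?S 0) = ?scl 0 ` ?Z 0" "carrier (HC scale UNIV 0)
        = CR.hclass 0 ` tot_cycles UNIV 0"
      using PS[of 0] PR[of 0] by (simp_all add: presented_def)
    moreover have "CR.hclass 0 x \<in> (\<lambda>z. CR.hclass 0 (?g z)) ` ?Z 0" if x: "x \<in> tot_cycles UNIV 0"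
        for x
    proof -
      obtain z where z: "z \<in> ?Z 0" "x - ?g z \<in> tot_bounds UNIV 0" using surj[OF x] by blast
      then have "CR.hclass 0 x = CR.hclass 0 (?g z)" using PR[of 0] x g_mem
          by (simp add: presented_def)
      with z(1) show ?thesis by blast
    qed
    ultimately show ?thesis using g_mem[of _ 0] by (auto simp: image_image g(2))
  qed
  ultimately show ?thesis using f(1) g(1) \<delta>(1) by (intro exI[of _ f] exI[of _ g] exI[of _ \<delta>]) simp
qed

end

section \<open>From an orientation to ordered idempotents\<close>

theorem theorem3p5:
  fixes scale :: "'k::field \<Rightarrow> 'a::ring \<Rightarrow> 'a"
    and unit e e1' e2' :: 'a
    and A1 A2 C R :: "'a set"
  assumes "unital_algebra scale unit"
    and "oriented_by unit e e1' e2'"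
    and "R = UNIV"
    and "A1 = corner (e1' + e)"
    and "A2 = corner (e2' + e)"
    and "C = corner e"
  shows "\<exists>f g \<delta>.
    (\<forall>n. f n \<in> linear_maps (HC scale C n) (direct_sum (HC scale A1 n) (HC scale A2 n))) \<and>
    (\<forall>n. g n \<in> linear_maps (direct_sum (HC scale A1 n) (HC scale A2 n)) (HC scale R n)) \<and>
    (\<forall>n. \<delta> n \<in> linear_maps (HC scale R (n + 1)) (HC scale C n)) \<and>
    (\<forall>n. exact_at (HC scale C n) (direct_sum (HC scale A1 n) (HC scale A2 n)) (HC scale R n)
           (f n) (g n)) \<and>
    (\<forall>n. exact_at (direct_sum (HC scale A1 (n + 1)) (HC scale A2 (n + 1))) (HC scale R (n + 1))
           (HC scale C n) (g (n + 1)) (\<delta> n)) \<and>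
    (\<forall>n. exact_at (HC scale R (n + 1)) (HC scale C n)
           (direct_sum (HC scale A1 n) (HC scale A2 n)) (\<delta> n) (f n)) \<and>
    g 0 ` carrier (direct_sum (HC scale A1 0) (HC scale A2 0)) = carrier (HC scale R 0)"
proof -
  define E where "E i = (case i of None \<Rightarrow> e | Some True \<Rightarrow> e1' | Some False \<Rightarrow> e2')" for i
  have E: "E None = e" "E (Some True) = e1'" "E (Some False) = e2'" by (simp_all add: E_def)
  have UN: "(UNIV :: bool option set) = {None, Some True, Some False}"
    by (auto simp: UNIV_option_conv UNIV_bool)
  have ex: thesis if "i = None \<Longrightarrow> thesis" "i = Some True \<Longrightarrow> thesis" "i = Some False \<Longrightarrow> thesis"
    for i :: "bool option" and thesis
    using that UNIV_I[of i] unfolding UN by blast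
  note or = assms(2)[unfolded oriented_by_def]
  let ?I1 = "{None, Some True}" and ?I2 = "{None, Some False}"
  \<comment> \<open>Heights relative to e at 1: e'_i is placed below when e R e'_i = 0, so that only
    e'_i R e can survive, and above otherwise. How e'_1 and e'_2 compare does not matter, since no
    nonzero component joins them.\<close>
  define r1 r2 :: nat where "r1 = (if \<forall>x. e * x * e1' = 0 then 0 else 2)"
    and "r2 = (if \<forall>x. e * x * e2' = 0 then 0 else 2)"
  define \<rho> :: "bool option \<Rightarrow> nat" where
    "\<rho> i = (case i of None \<Rightarrow> 1 | Some True \<Rightarrow> r1 | Some False \<Rightarrow> r2)" for i
  interpret unital_algebra scale unit by (rule assms(1))
  \<comment> \<open>Each of the three alternatives in the orientation gives this for both outer
    idempotents.\<close>
  have one: "(\<forall>x. e * x * e1' = 0) \<or> (\<forall>x. e1' * x * e = 0)" "(\<forall>x. e * x * e2'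
      = 0) \<or> (\<forall>x. e2' * x * e = 0)"
    using or by blast+
  \<comment> \<open>A product that leaves e for e'_i and returns to e has a vanishing half; this is
    the critical case of convexity.\<close>
  have via: "e * x * e1' * y * e = 0" "e * x * e2' * y * e = 0" for x y
    using one by (metis mult.assoc mult_zero_left mult_zero_right)+
  interpret oriented_peirce scale unit E ?I1 ?I2 \<rho>
  proof unfold_locales
    show "E i * E j = (if i = j then E i else 0)" for i j
      using or by (cases i rule: ex; cases j rule: ex) (simp_all add: E)
    show "(\<Sum>i\<in>UNIV. E i) = unit" using or by (simp add: UN E add_ac)
    show "?I1 \<union> ?I2 = UNIV" by (auto simp: UN)
    have r: "1 < r1 \<or> (\<forall>x. e * x * e1' = 0)" "r1 < 1 \<or> (\<forall>x. e1' * x * e = 0)"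
      "1 < r2 \<or> (\<forall>x. e * x * e2' = 0)" "r2 < 1 \<or> (\<forall>x. e2' * x * e = 0)"
      using one by (auto simp: r1_def r2_def)
    show "E a * x * E b = 0" if "a \<noteq> b" "\<not> \<rho> a < \<rho> b" for a b x
      using that r or by (cases a rule: ex; cases b rule: ex) (simp_all add: E \<rho>_def)
    \<comment> \<open>Here \<open>c\<close> can only be the other outer idempotent. If
      \<open>a\<close> or \<open>b\<close> is outer, the vanishing of e'_1 R e'_2 and e'_2 R e'_1
      applies; otherwise both are e and \<open>via\<close> applies.\<close>
    show "E a * x * E c * y * E b = 0" if "a \<in> ?I1" "b \<in> ?I1" "c \<notin> ?I1" for a b c x y
    proof -
      have "e1' * x * e2' = 0" "e2' * y * e1' = 0" "c = Some False" using or that(3)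
          by (auto intro: ex[of c])
      moreover have "E a * x * E c * y * E b = E a * x * (E c * y * E b)" by (simp add: mult.assoc)
      ultimately show ?thesis using that(1,2) via(2)[of x y]
          by (elim insertE emptyE) (simp_all add: E)
    qed
    show "E a * x * E c * y * E b = 0" if "a \<in> ?I2" "b \<in> ?I2" "c \<notin> ?I2" for a b c x y
    proof -
      have "e2' * x * e1' = 0" "e1' * y * e2' = 0" "c = Some True" using or that(3)
          by (auto intro: ex[of c])
      moreover have "E a * x * E c * y * E b = E a * x * (E c * y * E b)" by (simp add: mult.assoc)
      ultimately show ?thesis using that(1,2) via(1)[of x y]
          by (elim insertE emptyE) (simp_all add: E)
    qed
  qed
  have "esum ?I1 = e1' + e" "esum ?I2 = e2' + e" "esum (?I1 \<inter> ?I2) = e"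
    by (simp_all add: esum_def E add.commute)
  then show ?thesis using mayer_vietoris assms(3-6) by simp
qed

end
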